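(* Let $L(\lambda)$ be a regular $n\times n$ Hermitian matrix pencil and let $\lambda_1,\dots,\lambda_\kappa$ denote the pairwise distinct eigenvalues (finite or infinite) of $L(\lambda)$, having the partial multiplicities $n_{i,1}\geq\dots\geq n_{i,g_i}>0$ for $i=1,\dots,\kappa$, respectively. Let $r$ be a positive integer, let $0\leq s\leq\lfloor r/2\rfloor$, $\ell=r-2s$, and let $\Phi_s$ be the map on $\mathbb R^{2\ell}\times\mathbb C^{(r+s)n}$ defined in the context. Then there exists a generic set $\mathcal G_s$ in $\mathbb R^{2\ell}\times\mathbb C^{(r+s)n}$ such that, for all $E(\lambda)\in\Phi_s(\mathcal G_s)$, the perturbed pencil $L+E$ is regular and, for $i=1,\dots,\kappa$, the partial multiplicities of $L+E$ at $\lambda_i$ are given by $n_{i,r+1}\geq\cdots\geq n_{i,g_i}$. (In particular, if $r\geq g_i$ then $\lambda_i$ is not an eigenvalue of $L+E$.) Furthermore, all eigenvalues of $L+E$ that are different from those of $L$ are simple.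
   Context: A matrix pencil $L(\lambda)=A+\lambda B$ with $A,B\in\mathbb C^{n\times n}$ is Hermitian if $A=A^*$ and $B=B^*$; it is regular if $\det L(\lambda)\not\equiv 0$. For a regular pencil, a finite eigenvalue is a root of $\det L(\lambda)$; $\infty$ is an eigenvalue if $0$ is an eigenvalue of the reversal $\operatorname{rev}L(\lambda)=B+\lambda A$. The partial multiplicities of a regular pencil at an eigenvalue are the sizes of the corresponding Jordan blocks in its Weierstrass canonical form (at $\infty$: the partial multiplicities of $\operatorname{rev}L$ at $0$); the algebraic multiplicity is their sum, and an eigenvalue is simple if its algebraic multiplicity is $1$. For a vector polynomial $w(\lambda)=w_0+\lambda w_1$ with $w_0,w_1\in\mathbb C^n$, $w^*$ denotes $w_0^*+\lambda w_1^*$ (conjugate transpose is applied to coefficients only, not to $\lambda$). The map $\Phi_s$ is defined on $\mathbb R^{2\ell}\times\mathbb C^{(r+s)n}$, $\ell=r-2s$: a point consists of real numbers $a_1,b_1,\dots,a_\ell,b_\ell$ and of vectors $u_1,\dots,u_\ell,v_1,\dots,v_s,\gamma_1,\dots,\gamma_s,\delta_1,\dots,\delta_s\in\mathbb C^n$ (stacked to a vector in $\mathbb C^{(\ell+3s)n}=\mathbb C^{(r+s)n}$), and is mapped to the Hermitian pencil $$\sum_{i=1}^{\ell}(a_i+\lambda b_i)u_iu_i^*+\sum_{j=1}^{s}\big(v_jw_j^*+w_jv_j^*\big),\qquad w_j(\lambda)=\gamma_j+\lambda\delta_j .$$ Genericity: for $\mathbb F\in\{\mathbb R,\mathbb C\}$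 a subset of $\mathbb F^m$ is generic if its complement is contained in a proper algebraic set, i.e., in a set of common zeros of finitely many polynomials in $m$ variables over $\mathbb F$ that is not all of $\mathbb F^m$. Here $\mathbb R^{2\ell}\times\mathbb C^{(r+s)n}$ is identified with $\mathbb R^{2\ell+2(r+s)n}$ by taking real and imaginary parts of the complex variables, and genericity is understood over $\mathbb R$. *)

theory Defs
  imports
    "Jordan_Normal_Form.Jordan_Normal_Form"
    "Jordan_Normal_Form.Schur_Decomposition"
    "HOL-Library.Poly_Mapping"
begin

section \<open>Matrix pencils\<close>

text \<open>The pair \<open>(A, B)\<close> stands for the pencil \<open>A + \<lambda> B\<close>.\<close>

type_synonym pencil = "complex mat \<times> complex mat"

definition pencil_carrier :: "nat \<Rightarrow> pencil set" where
  "pencil_carrier n = carrier_mat n n \<times> carrier_mat n n"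

definition hermitian_pencil :: "pencil \<Rightarrow> bool" where
  "hermitian_pencil L \<longleftrightarrow> mat_adjoint (fst L) = fst L \<and> mat_adjoint (snd L) = snd L"

definition pencil_add :: "pencil \<Rightarrow> pencil \<Rightarrow> pencil" where
  "pencil_add L E = (fst L + fst E, snd L + snd E)"

definition pencil_rev :: "pencil \<Rightarrow> pencil" where
  "pencil_rev L = (snd L, fst L)"

definition pencil_det :: "pencil \<Rightarrow> complex poly" where
  "pencil_det L =
     det (map_mat (\<lambda>a. [:a:]) (fst L) + [:0, 1:] \<cdot>\<^sub>m map_mat (\<lambda>b. [:b:]) (snd L))"

definition regular_pencil :: "pencil \<Rightarrow> bool" where
  "regular_pencil L \<longleftrightarrow> pencil_det L \<noteq> 0"

datatype eigval = Finite complex | Infinite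

fun pencil_eigenvalue :: "pencil \<Rightarrow> eigval \<Rightarrow> bool" where
  "pencil_eigenvalue L (Finite \<mu>) \<longleftrightarrow> poly (pencil_det L) \<mu> = 0"
| "pencil_eigenvalue L Infinite \<longleftrightarrow> poly (pencil_det (pencil_rev L)) 0 = 0"

section \<open>Weierstrass canonical form and partial multiplicities\<close>

text \<open>
  The pencil is strictly equivalent to the direct sum of \<open>\<lambda> I - J\<close> and \<open>\<lambda> N - I\<close>, where \<open>J\<close> is
  in Jordan form with blocks \<open>fs\<close> (pairs of size and eigenvalue), and \<open>N\<close> is nilpotent in Jordan
  form with block sizes \<open>ks\<close>.
  The form is unique up to the order of the blocks.
\<close>

definition weierstrass_form :: "pencil \<Rightarrow> (nat \<times> complex) list \<Rightarrow> nat list \<Rightarrow> bool" where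
  "weierstrass_form L fs ks \<longleftrightarrow>
     0 \<notin> fst ` set fs \<and> 0 \<notin> set ks \<and>
     (\<exists>n P Q. L \<in> pencil_carrier n \<and> P \<in> carrier_mat n n \<and> Q \<in> carrier_mat n n \<and>
        invertible_mat P \<and> invertible_mat Q \<and>
        P * fst L * Q = - diag_block_mat [jordan_matrix fs, 1\<^sub>m (sum_list ks)] \<and>
        P * snd L * Q =
          diag_block_mat [1\<^sub>m (sum_list (map fst fs)), jordan_matrix (map (\<lambda>k. (k, 0)) ks)])"

definition finite_partial_mults :: "pencil \<Rightarrow> complex \<Rightarrow> nat list \<Rightarrow> bool" where
  "finite_partial_mults L \<mu> ns \<longleftrightarrow>
     (\<exists>fs ks. weierstrass_form L fs ks \<and>
        ns = rev (sort (map fst (filter (\<lambda>(k, a). a = \<mu>) fs))))"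

text \<open>
  \<open>has_partial_mults L \<mu> ns\<close>: the partial multiplicities of \<open>L\<close> at \<open>\<mu>\<close>, in decreasing order, are
  \<open>ns\<close>. For regular \<open>L\<close> there is exactly one such list, and it is empty iff \<open>\<mu>\<close> is not an
  eigenvalue.
\<close>

fun has_partial_mults :: "pencil \<Rightarrow> eigval \<Rightarrow> nat list \<Rightarrow> bool" where
  "has_partial_mults L (Finite \<mu>) ns \<longleftrightarrow> finite_partial_mults L \<mu> ns"
| "has_partial_mults L Infinite ns \<longleftrightarrow> finite_partial_mults (pencil_rev L) 0 ns"

definition has_alg_mult :: "pencil \<Rightarrow> eigval \<Rightarrow> nat \<Rightarrow> bool" where
  "has_alg_mult L \<mu> m \<longleftrightarrow> (\<exists>ns. has_partial_mults L \<mu> ns \<and> m = sum_list ns)"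

definition simple_eigenvalue :: "pencil \<Rightarrow> eigval \<Rightarrow> bool" where
  "simple_eigenvalue L \<mu> \<longleftrightarrow> pencil_eigenvalue L \<mu> \<and> has_alg_mult L \<mu> 1"

section \<open>Generic sets\<close>

text \<open>
  A polynomial is a finitely supported map from monomials to coefficients, a monomial being a
  finitely supported map from variable indices to exponents.
\<close>

type_synonym 'a mvpoly = "(nat \<Rightarrow>\<^sub>0 nat) \<Rightarrow>\<^sub>0 'a"

definition mvpoly_vars :: "'a::zero mvpoly \<Rightarrow> nat set" where
  "mvpoly_vars p = (\<Union>m\<in>Poly_Mapping.keys p. Poly_Mapping.keys m)"

definition mvpoly_eval :: "'a::comm_semiring_1 mvpoly \<Rightarrow> 'a vec \<Rightarrow> 'a" where
  "mvpoly_eval p x =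
     (\<Sum>m\<in>Poly_Mapping.keys p. Poly_Mapping.lookup p m *
        (\<Prod>i\<in>Poly_Mapping.keys m. (x $ i) ^ Poly_Mapping.lookup m i))"

definition algebraic_set :: "nat \<Rightarrow> 'a::field vec set \<Rightarrow> bool" where
  "algebraic_set d Z \<longleftrightarrow>
     (\<exists>F. finite F \<and> (\<forall>p\<in>F. mvpoly_vars p \<subseteq> {..<d}) \<and>
        Z = {x \<in> carrier_vec d. \<forall>p\<in>F. mvpoly_eval p x = 0})"

definition generic_set :: "nat \<Rightarrow> 'a::field vec set \<Rightarrow> bool" where
  "generic_set d G \<longleftrightarrow> G \<subseteq> carrier_vec d \<and>
     (\<exists>Z. algebraic_set d Z \<and> Z \<noteq> carrier_vec d \<and> carrier_vec d - G \<subseteq> Z)"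

text \<open>The identification of \<open>\<real>\<^sup>p \<times> \<complex>\<^sup>q\<close> with \<open>\<real>\<^sup>p\<^sup>+\<^sup>2\<^sup>q\<close>.\<close>

definition realify :: "real vec \<times> complex vec \<Rightarrow> real vec" where
  "realify = (\<lambda>(x, z). x @\<^sub>v map_vec Re z @\<^sub>v map_vec Im z)"

definition generic_real_complex ::
    "nat \<Rightarrow> nat \<Rightarrow> (real vec \<times> complex vec) set \<Rightarrow> bool" where
  "generic_real_complex p q G \<longleftrightarrow>
     G \<subseteq> carrier_vec p \<times> carrier_vec q \<and> generic_set (p + 2 * q) (realify ` G)"

section \<open>The parametrization of Hermitian pencils\<close>

definition block_vec :: "nat \<Rightarrow> complex vec \<Rightarrow> nat \<Rightarrow> complex vec" where
  "block_vec n z i = vec n (\<lambda>k. z $ (i * n + k))"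

text \<open>
  With \<open>l = r - 2 * s\<close>, the real vector is \<open>(a\<^sub>1, b\<^sub>1, \<dots>, a\<^sub>l, b\<^sub>l)\<close>, and the complex vector is
  the stack of the \<open>u\<^sub>i\<close>, \<open>v\<^sub>j\<close>, \<open>\<gamma>\<^sub>j\<close>, \<open>\<delta>\<^sub>j\<close>, in this order (all indices are shifted to start
  at 0). Since conjugation is not applied to \<open>\<lambda>\<close>, the coefficients of
  \<open>v\<^sub>j w\<^sub>j\<^sup>* + w\<^sub>j v\<^sub>j\<^sup>*\<close> for \<open>w\<^sub>j = \<gamma>\<^sub>j + \<lambda> \<delta>\<^sub>j\<close> are \<open>v\<^sub>j \<gamma>\<^sub>j\<^sup>* + \<gamma>\<^sub>j v\<^sub>j\<^sup>*\<close> and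
  \<open>v\<^sub>j \<delta>\<^sub>j\<^sup>* + \<delta>\<^sub>j v\<^sub>j\<^sup>*\<close>.
\<close>

definition Phi :: "nat \<Rightarrow> nat \<Rightarrow> nat \<Rightarrow> real vec \<times> complex vec \<Rightarrow> pencil" where
  "Phi n r s = (\<lambda>(x, z).
     let l = r - 2 * s;
         a = (\<lambda>i. complex_of_real (x $ (2 * i)));
         b = (\<lambda>i. complex_of_real (x $ (2 * i + 1)));
         u = (\<lambda>i. block_vec n z i);
         v = (\<lambda>j. block_vec n z (l + j));
         \<gamma> = (\<lambda>j. block_vec n z (l + s + j));
         \<delta> = (\<lambda>j. block_vec n z (l + 2 * s + j))
     in (mat n n (\<lambda>(p, q).
           (\<Sum>i<l. a i * (u i $ p * cnj (u i $ q))) +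
           (\<Sum>j<s. v j $ p * cnj (\<gamma> j $ q) + \<gamma> j $ p * cnj (v j $ q))),
         mat n n (\<lambda>(p, q).
           (\<Sum>i<l. b i * (u i $ p * cnj (u i $ q))) +
           (\<Sum>j<s. v j $ p * cnj (\<delta> j $ q) + \<delta> j $ p * cnj (v j $ q)))))"

end

theory Submission
  imports Defs "Jordan_Normal_Form.Jordan_Normal_Form_Existence"
begin

text \<open>In the real coordinates of the perturbation \<open>E\<close>, the coefficients of \<open>det (L + E)\<close> are polynomials. So the
theorem needs two facts: a factor \<open>h\<close> that no perturbation can remove from the determinant, and one
perturbation for which nothing worse than \<open>h\<close> remains.

The factor \<open>h\<close>. A root vector of order \<open>k\<close> at \<open>\<mu>\<close> is a polynomial vector \<open>y\<close> such that
\<open>(\<lambda> - \<mu>)\<^sup>k\<close> divides \<open>L(\<lambda>) y(\<lambda>)\<close>. The maximal number of root vectors with linearly independent values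
at \<open>\<mu>\<close> is the number of partial multiplicities that are at least \<open>k\<close>
(\<open>max_root_rank_bidiagonal_blocks\<close>; this also shows that the partial multiplicities do not depend on
the canonical form, \<open>has_partial_mults_iff\<close>). A perturbation of rank \<open>r\<close> acts as zero on the common kernel
of \<open>r\<close> linear functionals over the polynomials, and each of these costs at most one root vector
(\<open>max_root_rank_interlacing\<close>). Hence the \<open>j\<close>-th partial multiplicity of \<open>L + E\<close> is at least the
\<open>(j + r)\<close>-th of \<open>L\<close>, so that \<open>det (L + E)\<close> is divisible by the product \<open>h\<close> of the powers of
\<open>\<lambda> - \<lambda>\<^sub>i\<close>, for finite \<open>\<lambda>\<^sub>i\<close>, with exponents \<open>n\<^sub>i\<^sub>,\<^sub>r\<^sub>+\<^sub>1 + n\<^sub>i\<^sub>,\<^sub>r\<^sub>+\<^sub>2 + \<dots>\<close>.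
If an algebraic multiplicity equals this lower bound, all the inequalities behind it are equalities
(\<open>eq_drop_of_count_ge\<close>). The point infinity is the point 0 of the reversal.

Reduction to one example. Write \<open>det (L + E) = h q\<close>. The conclusion holds when \<open>q\<close> has the largest
possible degree, no multiple root, and no root at an eigenvalue of \<open>L\<close>. All this says that one polynomial
function \<open>F\<close> of the parameters does not vanish. A polynomial function that vanishes at all real points vanishes
at all complex points (\<open>polyfun_nonzero_at_real_point\<close>), so a complex parameter point with \<open>F \<noteq> 0\<close>
suffices. At complex points the vectors and their conjugates become independent variables, and the
parametrization reaches every pencil \<open>(\<lambda> - c) U V\<close> where \<open>U\<close> has \<open>r\<close> columns and \<open>V\<close> has \<open>r\<close> rows
(\<open>Phi_complexified_surj_low_rank\<close>).

The example. If \<open>c\<close> is not an eigenvalue, \<open>L\<close> is strictly equivalent to \<open>I + (\<lambda> - c) J\<close> with a Jordan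
matrix \<open>J\<close>, and adding \<open>(\<lambda> - c) U V\<close> just changes \<open>J\<close> to \<open>J + U V\<close>. The blocks of \<open>J\<close> are
arranged in layers, each consisting of one largest remaining block for every eigenvalue. A rank one term
turns the characteristic polynomial \<open>m\<close> of a layer into \<open>m - \<epsilon> g\<close> with \<open>g\<close> coprime to \<open>m\<close>, and for
all but finitely many \<open>\<epsilon>\<close> this has simple roots outside any given finite set. With \<open>r\<close> such terms the
\<open>r\<close> first layers are replaced by new simple eigenvalues (\<open>jordan_matrix_low_rank_perturbation\<close>).\<close>

section \<open>Polynomial functions of several variables\<close>

lemma mvpoly_eval_superset:
  assumes "finite K" "Poly_Mapping.keys p \<subseteq> K"
  shows "mvpoly_eval p x = (\<Sum>m\<in>K. Poly_Mapping.lookup p m *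
        (\<Prod>i\<in>Poly_Mapping.keys m. (x $ i) ^ Poly_Mapping.lookup m i))"
  unfolding mvpoly_eval_def
  by (rule sum.mono_neutral_left) (use assms in \<open>auto simp: in_keys_iff\<close>)

lemma mvpoly_eval_add: "mvpoly_eval (p + q) x = mvpoly_eval p x + mvpoly_eval q x"
proof -
  let ?K = "Poly_Mapping.keys p \<union> Poly_Mapping.keys q"
  have "Poly_Mapping.keys (p + q) \<subseteq> ?K" by (rule Poly_Mapping.keys_add)
  then show ?thesis
    by (subst (1 2 3) mvpoly_eval_superset[of ?K])
       (auto simp: lookup_add distrib_right sum.distrib)
qed

lemma mvpoly_eval_0: "mvpoly_eval 0 x = 0"
  by (simp add: mvpoly_eval_def)

lemma mvpoly_eval_single:
  "mvpoly_eval (Poly_Mapping.single m c) x =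
     c * (\<Prod>i\<in>Poly_Mapping.keys m. (x $ i) ^ Poly_Mapping.lookup m i)"
  by (subst mvpoly_eval_superset[of "{m}"]) (auto simp: lookup_single)

lemma monomial_value_add:
  fixes x :: "'a::comm_semiring_1 vec"
  shows "(\<Prod>i\<in>Poly_Mapping.keys (m + m'). (x $ i) ^ Poly_Mapping.lookup (m + m') i) =
     (\<Prod>i\<in>Poly_Mapping.keys m. (x $ i) ^ Poly_Mapping.lookup m i) *
     (\<Prod>i\<in>Poly_Mapping.keys m'. (x $ i) ^ Poly_Mapping.lookup m' i)"
proof -
  let ?K = "Poly_Mapping.keys m \<union> Poly_Mapping.keys m'"
  have ext: "(\<Prod>i\<in>Poly_Mapping.keys l. (x $ i) ^ Poly_Mapping.lookup l i) =
     (\<Prod>i\<in>?K. (x $ i) ^ Poly_Mapping.lookup l i)" if "Poly_Mapping.keys l \<subseteq> ?K" for l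
    by (rule prod.mono_neutral_left) (use that in \<open>auto simp: in_keys_iff\<close>)
  have "Poly_Mapping.keys (m + m') \<subseteq> ?K" by (rule Poly_Mapping.keys_add)
  then show ?thesis
    by (subst (1 2 3) ext) (auto simp: lookup_add power_add prod.distrib)
qed

text \<open>Induction over single terms; it makes evaluation multiplicative by bilinearity.\<close>

lemma poly_mapping_induct_single:
  assumes "P 0" "\<And>m c p. P p \<Longrightarrow> P (Poly_Mapping.single m c + p)"
  shows "P (p :: 'a \<Rightarrow>\<^sub>0 'b::comm_monoid_add)"
proof (induct p rule: update_induct)
  case const
  then show ?case by (rule assms(1))
next
  case (update f a b)
  have "Poly_Mapping.update a b f = Poly_Mapping.single a b + f"
    using update by (intro poly_mapping_eqI)
      (auto simp: lookup_update lookup_add lookup_single in_keys_iff when_def)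
  with assms(2) update show ?case by auto
qed

lemma mvpoly_eval_mult:
  fixes p q :: "'a::comm_semiring_1 mvpoly"
  shows "mvpoly_eval (p * q) x = mvpoly_eval p x * mvpoly_eval q x"
proof (induct p rule: poly_mapping_induct_single)
  case (2 m c p)
  have "mvpoly_eval (Poly_Mapping.single m c * q) x =
     mvpoly_eval (Poly_Mapping.single m c) x * mvpoly_eval q x"
  proof (induct q rule: poly_mapping_induct_single)
    case (2 m' c' q)
    then show ?case
      by (simp add: distrib_left mvpoly_eval_add mult_single mvpoly_eval_single
          monomial_value_add algebra_simps)
  qed (simp add: mvpoly_eval_0)
  with 2 show ?case by (simp add: distrib_right mvpoly_eval_add)
qed (simp add: mvpoly_eval_0)

lemma mvpoly_vars_add:
  "mvpoly_vars p \<subseteq> A \<Longrightarrow> mvpoly_vars q \<subseteq> A \<Longrightarrow> mvpoly_vars (p + q) \<subseteq> A"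
  using Poly_Mapping.keys_add[of p q] unfolding mvpoly_vars_def by blast

lemma mvpoly_vars_mult:
  assumes "mvpoly_vars p \<subseteq> A" "mvpoly_vars q \<subseteq> A"
  shows "mvpoly_vars (p * q :: 'a::comm_semiring_1 mvpoly) \<subseteq> A"
proof
  fix i assume "i \<in> mvpoly_vars (p * q)"
  then obtain m where m: "m \<in> Poly_Mapping.keys (p * q)" "i \<in> Poly_Mapping.keys m"
    by (auto simp: mvpoly_vars_def)
  then obtain a b where "m = a + b" "a \<in> Poly_Mapping.keys p" "b \<in> Poly_Mapping.keys q"
    using Poly_Mapping.keys_mult[of p q] by blast
  with m Poly_Mapping.keys_add[of a b] have "i \<in> mvpoly_vars p \<union> mvpoly_vars q"
    by (auto simp: mvpoly_vars_def)
  with assms show "i \<in> A" by auto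
qed

lemma mvpoly_vars_uminus: "mvpoly_vars (- p :: 'a::ring_1 mvpoly) = mvpoly_vars p"
  by (simp add: mvpoly_vars_def)

lemma mvpoly_eval_uminus: "mvpoly_eval (- p) x = - mvpoly_eval (p :: 'a::comm_ring_1 mvpoly) x"
  by (simp add: mvpoly_eval_def sum_negf)

text \<open>Functions of complex variables that are polynomial in the first \<open>N\<close> of them. They are described by closure
properties, because the arguments below use only restrictions to lines and, at the end, real and
imaginary parts as formal polynomials.\<close>

inductive_set polyfun :: "nat \<Rightarrow> ((nat \<Rightarrow> complex) \<Rightarrow> complex) set" for N :: nat where
  const: "(\<lambda>y. c) \<in> polyfun N"
| var: "i < N \<Longrightarrow> (\<lambda>y. y i) \<in> polyfun N"
| add: "f \<in> polyfun N \<Longrightarrow> g \<in> polyfun N \<Longrightarrow> (\<lambda>y. f y + g y) \<in> polyfun N"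
| mult: "f \<in> polyfun N \<Longrightarrow> g \<in> polyfun N \<Longrightarrow> (\<lambda>y. f y * g y) \<in> polyfun N"

lemma polyfun_sum:
  "(\<And>i. i \<in> I \<Longrightarrow> f i \<in> polyfun N) \<Longrightarrow> (\<lambda>y. \<Sum>i\<in>I. f i y) \<in> polyfun N"
  by (induct I rule: infinite_finite_induct) (auto intro: polyfun.intros)

lemma polyfun_prod:
  "(\<And>i. i \<in> I \<Longrightarrow> f i \<in> polyfun N) \<Longrightarrow> (\<lambda>y. \<Prod>i\<in>I. f i y) \<in> polyfun N"
  by (induct I rule: infinite_finite_induct) (auto intro: polyfun.intros)

lemma polyfun_on_line:
  assumes "f \<in> polyfun N"
  shows "\<exists>p. \<forall>t. f (\<lambda>i. x i + t * d i) = poly p t"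
  using assms
proof induct
  case (const c)
  show ?case by (intro exI[of _ "[:c:]"]) simp
next
  case (var i)
  show ?case by (intro exI[of _ "[:x i, d i:]"]) simp
next
  case (add f g)
  then show ?case by (metis poly_add)
next
  case (mult f g)
  then show ?case by (metis poly_mult)
qed

text \<open>A polynomial function that vanishes at all real points vanishes everywhere: on the complex
  line through \<open>Re y\<close> in direction \<open>Im y\<close> it is a univariate polynomial with infinitely many
  roots, and \<open>y\<close> is the point of this line with parameter \<open>\<i>\<close>.\<close>

lemma polyfun_nonzero_at_real_point:
  assumes "f \<in> polyfun N" "f y \<noteq> 0"
  obtains x :: "nat \<Rightarrow> real" where "f (\<lambda>i. of_real (x i)) \<noteq> 0"
proof -
  obtain p where p: "\<And>t. f (\<lambda>i. of_real (Re (y i)) + t * of_real (Im (y i))) = poly p t"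
    using polyfun_on_line[OF assms(1), of "\<lambda>i. of_real (Re (y i))" "\<lambda>i. of_real (Im (y i))"] by blast
  have "poly p \<i> = f y"
    by (subst p[symmetric]) (simp add: complex_eq[symmetric])
  with assms have "p \<noteq> 0" by auto
  then have "finite {t. poly p t = 0}" by (rule poly_roots_finite)
  moreover have "infinite (range complex_of_real)"
    using infinite_UNIV_char_0 by (simp add: finite_image_iff inj_of_real)
  ultimately obtain t :: real where "poly p (of_real t) \<noteq> 0"
    by (metis (mono_tags, lifting) finite_subset mem_Collect_eq rangeE subsetI)
  then have "f (\<lambda>i. of_real (Re (y i) + t * Im (y i))) \<noteq> 0"
    by (subst (asm) p[symmetric]) simp
  then show ?thesis by (rule that)
qed

lemma polyfun_real_imaginary_part:
  assumes "f \<in> polyfun N"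
  shows "\<exists>p q :: real mvpoly. mvpoly_vars p \<subseteq> {..<N} \<and> mvpoly_vars q \<subseteq> {..<N} \<and>
    (\<forall>v. f (\<lambda>i. of_real (v $ i)) = Complex (mvpoly_eval p v) (mvpoly_eval q v))"
  using assms
proof induct
  case (const c)
  have "mvpoly_eval (Poly_Mapping.single 0 a) v = a \<and>
      mvpoly_vars (Poly_Mapping.single 0 a) \<subseteq> {..<N}" for a :: real and v
    by (auto simp: mvpoly_eval_single mvpoly_vars_def)
  then show ?case
    by (intro exI[of _ "Poly_Mapping.single 0 (Re c)"] exI[of _ "Poly_Mapping.single 0 (Im c)"])
       auto
next
  case (var i)
  then show ?case
    by (intro exI[of _ "Poly_Mapping.single (Poly_Mapping.single i 1) 1"] exI[of _ 0])
       (auto simp: mvpoly_eval_single mvpoly_vars_def mvpoly_eval_0 lookup_single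
         complex_of_real_def)
next
  case (add f g)
  then obtain p q p' q' :: "real mvpoly" where *:
    "mvpoly_vars p \<subseteq> {..<N}" "mvpoly_vars q \<subseteq> {..<N}"
    "mvpoly_vars p' \<subseteq> {..<N}" "mvpoly_vars q' \<subseteq> {..<N}"
    "\<forall>v. f (\<lambda>i. of_real (v $ i)) = Complex (mvpoly_eval p v) (mvpoly_eval q v)"
    "\<forall>v. g (\<lambda>i. of_real (v $ i)) = Complex (mvpoly_eval p' v) (mvpoly_eval q' v)" by blast
  show ?case
    by (rule exI[of _ "p + p'"], rule exI[of _ "q + q'"], intro conjI mvpoly_vars_add)
       (use * in \<open>auto simp: mvpoly_eval_add complex_eq_iff\<close>)
next
  case (mult f g)
  then obtain p q p' q' :: "real mvpoly" where *:
    "mvpoly_vars p \<subseteq> {..<N}" "mvpoly_vars q \<subseteq> {..<N}"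
    "mvpoly_vars p' \<subseteq> {..<N}" "mvpoly_vars q' \<subseteq> {..<N}"
    "\<forall>v. f (\<lambda>i. of_real (v $ i)) = Complex (mvpoly_eval p v) (mvpoly_eval q v)"
    "\<forall>v. g (\<lambda>i. of_real (v $ i)) = Complex (mvpoly_eval p' v) (mvpoly_eval q' v)" by blast
  show ?case
    by (rule exI[of _ "p * p' + - (q * q')"], rule exI[of _ "p * q' + q * p'"],
        intro conjI mvpoly_vars_add mvpoly_vars_mult)
       (use * in \<open>auto simp: mvpoly_vars_uminus mvpoly_vars_mult mvpoly_eval_add mvpoly_eval_mult
          mvpoly_eval_uminus complex_eq_iff simp del: add_uminus_conv_diff\<close>)
qed

lemma realify_carrier:
  "x \<in> carrier_vec p \<Longrightarrow> z \<in> carrier_vec q \<Longrightarrow> realify (x, z) \<in> carrier_vec (p + 2 * q)"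
  unfolding realify_def carrier_vec_def by simp

lemma realify_index:
  assumes "x \<in> carrier_vec p" "z \<in> carrier_vec q"
  shows "i < p \<Longrightarrow> realify (x, z) $ i = x $ i"
    and "i < q \<Longrightarrow> realify (x, z) $ (p + i) = Re (z $ i)"
    and "i < q \<Longrightarrow> realify (x, z) $ (p + q + i) = Im (z $ i)"
  using assms by (auto simp: realify_def)

lemma realify_surj:
  assumes "y \<in> carrier_vec (p + 2 * q)"
  obtains x z where "x \<in> carrier_vec p" "z \<in> carrier_vec q" "realify (x, z) = y"
proof
  let ?x = "vec p (\<lambda>i. y $ i)" and ?z = "vec q (\<lambda>i. Complex (y $ (p + i)) (y $ (p + q + i)))"
  show "?x \<in> carrier_vec p" "?z \<in> carrier_vec q" by auto
  show "realify (?x, ?z) = y"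
    by (rule eq_vecI) (use assms in \<open>auto simp: realify_def\<close>)
qed

text \<open>The real and the imaginary part of \<open>F\<close> are two real polynomials, whose common zeros are the real points
with \<open>F = 0\<close>. The witness \<open>y\<close> may be complex.\<close>

lemma generic_real_complex_nonvanishing:
  assumes F: "F \<in> polyfun (p + 2 * q)" and y: "F y \<noteq> 0"
  shows "generic_real_complex p q {(x, z) \<in> carrier_vec p \<times> carrier_vec q.
     F (\<lambda>i. of_real (realify (x, z) $ i)) \<noteq> 0}" (is "generic_real_complex p q ?G")
proof -
  let ?N = "p + 2 * q"
  obtain f g :: "real mvpoly" where fg: "mvpoly_vars f \<subseteq> {..<?N}" "mvpoly_vars g \<subseteq> {..<?N}"
    and eq: "\<And>v. F (\<lambda>i. of_real (v $ i)) = Complex (mvpoly_eval f v) (mvpoly_eval g v)"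
    using polyfun_real_imaginary_part[OF F] by blast
  define Z where "Z = {v \<in> carrier_vec ?N. \<forall>p\<in>{f, g}. mvpoly_eval p v = 0}"
  have Z: "Z = {v \<in> carrier_vec ?N. F (\<lambda>i. of_real (v $ i)) = 0}"
    unfolding Z_def eq by (auto simp: complex_eq_iff)
  have "algebraic_set ?N Z"
    unfolding algebraic_set_def Z_def using fg by (intro exI[of _ "{f, g}"]) auto
  moreover have "Z \<noteq> carrier_vec ?N"
  proof -
    obtain x :: "nat \<Rightarrow> real" where x: "F (\<lambda>i. of_real (x i)) \<noteq> 0"
      using polyfun_nonzero_at_real_point[OF F y] by blast
    have *: "h u = h v" if "h \<in> polyfun ?N" "\<And>i. i < ?N \<Longrightarrow> u i = v i" for h u v
      using that(1) by induct (use that(2) in auto)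
    have "F (\<lambda>i. of_real (vec ?N x $ i)) = F (\<lambda>i. of_real (x i))"
      by (rule *[OF F]) simp
    with x have "vec ?N x \<notin> Z" unfolding Z by auto
    then show ?thesis by (metis vec_carrier)
  qed
  moreover have "carrier_vec ?N - realify ` ?G \<subseteq> Z"
  proof
    fix v assume v: "v \<in> carrier_vec ?N - realify ` ?G"
    then obtain x z where "x \<in> carrier_vec p" "z \<in> carrier_vec q" "realify (x, z) = v"
      using realify_surj[of v p q] by auto
    with v show "v \<in> Z" unfolding Z by (auto simp: image_iff)
  qed
  moreover have "realify ` ?G \<subseteq> carrier_vec ?N" using realify_carrier by auto
  ultimately show ?thesis unfolding generic_real_complex_def generic_set_def by blast
qed

section \<open>Families of univariate polynomials\<close>

definition polyfun_poly :: "nat \<Rightarrow> ((nat \<Rightarrow> complex) \<Rightarrow> complex poly) set" where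
  "polyfun_poly N = {g. \<forall>k. (\<lambda>y. coeff (g y) k) \<in> polyfun N}"

lemma polyfun_poly_const: "(\<lambda>y. p) \<in> polyfun_poly N"
  by (auto simp: polyfun_poly_def intro: polyfun.intros)

lemma polyfun_poly_linear:
  "f \<in> polyfun N \<Longrightarrow> g \<in> polyfun N \<Longrightarrow> (\<lambda>y. [:f y, g y:]) \<in> polyfun_poly N"
  unfolding polyfun_poly_def mem_Collect_eq
proof
  fix k assume "f \<in> polyfun N" "g \<in> polyfun N"
  then show "(\<lambda>y. coeff [:f y, g y:] k) \<in> polyfun N"
    by (cases k; cases "k - 1") (auto intro: polyfun.intros)
qed

lemma polyfun_poly_mult:
  "f \<in> polyfun_poly N \<Longrightarrow> g \<in> polyfun_poly N \<Longrightarrow> (\<lambda>y. f y * g y) \<in> polyfun_poly N"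
  by (auto simp: polyfun_poly_def coeff_mult intro!: polyfun_sum polyfun.intros)

lemma polyfun_poly_sum:
  "(\<And>i. i \<in> I \<Longrightarrow> f i \<in> polyfun_poly N) \<Longrightarrow> (\<lambda>y. \<Sum>i\<in>I. f i y) \<in> polyfun_poly N"
  by (auto simp: polyfun_poly_def coeff_sum intro!: polyfun_sum)

lemma polyfun_poly_prod:
  "(\<And>i. i \<in> I \<Longrightarrow> f i \<in> polyfun_poly N) \<Longrightarrow> (\<lambda>y. \<Prod>i\<in>I. f i y) \<in> polyfun_poly N"
  by (induct I rule: infinite_finite_induct)
     (auto intro: polyfun_poly_mult polyfun_poly_const)

lemma polyfun_poly_det:
  assumes "\<And>y. M y \<in> carrier_mat n n"
    and "\<And>i j. i < n \<Longrightarrow> j < n \<Longrightarrow> (\<lambda>y. M y $$ (i, j)) \<in> polyfun_poly N"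
  shows "(\<lambda>y. det (M y)) \<in> polyfun_poly N"
  unfolding det_def'[OF assms(1)]
  by (intro polyfun_poly_sum polyfun_poly_mult polyfun_poly_const polyfun_poly_prod assms(2))
     (use permutes_in_image in fastforce)+

lemma polyfun_det:
  assumes "\<And>y. M y \<in> carrier_mat n n"
    and "\<And>i j. i < n \<Longrightarrow> j < n \<Longrightarrow> (\<lambda>y. M y $$ (i, j)) \<in> polyfun N"
  shows "(\<lambda>y. det (M y)) \<in> polyfun N"
  unfolding det_def'[OF assms(1)]
  by (intro polyfun_sum polyfun.mult polyfun.const polyfun_prod assms(2))
     (use permutes_in_image in fastforce)+

lemma polyfun_poly_pderiv:
  "f \<in> polyfun_poly N \<Longrightarrow> (\<lambda>y. pderiv (f y)) \<in> polyfun_poly N"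
  by (auto simp: polyfun_poly_def coeff_pderiv intro: polyfun.intros simp del: of_nat_Suc)

lemma poly_div_sum_left:
  "(\<Sum>i\<in>I. f i) div (h :: 'a::field poly) = (\<Sum>i\<in>I. f i div h)"
  by (induct I rule: infinite_finite_induct) (auto simp: poly_div_add_left)

text \<open>For fixed \<open>h\<close>, the quotient \<open>p div h\<close> depends linearly on \<open>p\<close>.\<close>

lemma polyfun_poly_div:
  assumes f: "f \<in> polyfun_poly N" and deg: "\<And>y. degree (f y) \<le> n"
  shows "(\<lambda>y. f y div h) \<in> polyfun_poly N"
proof -
  have "f y div h = (\<Sum>k\<le>n. [:coeff (f y) k:] * (monom 1 k div h))" for y
  proof -
    have "f y = (\<Sum>k\<le>n. Polynomial.smult (coeff (f y) k) (monom 1 k))"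
      using poly_as_sum_of_monoms'[OF deg[of y]] by (simp add: smult_monom)
    then have "f y div h = (\<Sum>k\<le>n. Polynomial.smult (coeff (f y) k) (monom 1 k)) div h" by simp
    then show ?thesis by (simp add: poly_div_sum_left div_smult_left)
  qed
  moreover have "(\<lambda>y. [:coeff (f y) k:]) \<in> polyfun_poly N" for k
    using f polyfun_poly_linear[of "\<lambda>y. coeff (f y) k" N "\<lambda>y. 0"]
    by (auto simp: polyfun_poly_def intro: polyfun.const)
  ultimately show ?thesis
    by (simp only:) (intro polyfun_poly_sum polyfun_poly_mult polyfun_poly_const)
qed

lemma polyfun_poly_eval:
  assumes f: "f \<in> polyfun_poly N" and deg: "\<And>y. degree (f y) \<le> n"
  shows "(\<lambda>y. poly (f y) \<mu>) \<in> polyfun N"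
proof -
  have "poly (f y) \<mu> = (\<Sum>k\<le>n. coeff (f y) k * \<mu> ^ k)" for y
    unfolding poly_altdef
    by (rule sum.mono_neutral_left) (use deg[of y] in \<open>auto simp: coeff_eq_0\<close>)
  then show ?thesis using f by (auto simp: polyfun_poly_def intro!: polyfun_sum polyfun.intros)
qed

section \<open>Root vectors of polynomial matrices\<close>

text \<open>If \<open>y\<close> is a root vector of order \<open>k\<close> at \<open>\<mu>\<close>, its Taylor coefficients of order less than
  \<open>k\<close> form a Jordan chain of \<open>W\<close> at \<open>\<mu>\<close> (possibly with leading zeros).\<close>

definition root_vector :: "complex poly mat \<Rightarrow> nat \<Rightarrow> complex \<Rightarrow> nat \<Rightarrow> complex poly vec \<Rightarrow> bool" where
  "root_vector W n \<mu> k y \<longleftrightarrow> y \<in> carrier_vec n \<and> (\<forall>i<n. [:-\<mu>, 1:] ^ k dvd (W *\<^sub>v y) $ i)"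

text \<open>Only the values at \<open>\<mu>\<close> count: this excludes trivial root vectors like multiples of \<open>(\<lambda> - \<mu>)\<^sup>k\<close>.\<close>

definition independent_at :: "complex \<Rightarrow> nat \<Rightarrow> 'j set \<Rightarrow> ('j \<Rightarrow> complex poly vec) \<Rightarrow> bool" where
  "independent_at \<mu> n J x \<longleftrightarrow>
     (\<forall>a. (\<forall>i<n. (\<Sum>j\<in>J. a j * poly (x j $ i) \<mu>) = 0) \<longrightarrow> (\<forall>j\<in>J. a j = 0))"

definition max_root_rank :: "complex poly mat \<Rightarrow> nat \<Rightarrow> complex \<Rightarrow> nat \<Rightarrow> nat \<Rightarrow> bool" where
  "max_root_rank W n \<mu> k g \<longleftrightarrow>
     (\<exists>(J :: nat set) x. finite J \<and> card J = g \<and> (\<forall>j\<in>J. root_vector W n \<mu> k (x j)) \<and>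
        independent_at \<mu> n J x) \<and>
     (\<forall>(J :: nat set) x. finite J \<longrightarrow> (\<forall>j\<in>J. root_vector W n \<mu> k (x j)) \<longrightarrow>
        independent_at \<mu> n J x \<longrightarrow> card J \<le> g)"

lemma max_root_rank_unique:
  "max_root_rank W n \<mu> k g \<Longrightarrow> max_root_rank W n \<mu> k g' \<Longrightarrow> g = g'"
  unfolding max_root_rank_def by (meson le_antisym)

lemma root_vector_combination:
  assumes W: "W \<in> carrier_mat n n" and y: "root_vector W n \<mu> k y" and z: "root_vector W n \<mu> k z"
  shows "root_vector W n \<mu> k (p \<cdot>\<^sub>v y + q \<cdot>\<^sub>v z)"
proof -
  have c: "y \<in> carrier_vec n" "z \<in> carrier_vec n" using y z by (auto simp: root_vector_def)
  have "W *\<^sub>v (p \<cdot>\<^sub>v y + q \<cdot>\<^sub>v z) = p \<cdot>\<^sub>v (W *\<^sub>v y) + q \<cdot>\<^sub>v (W *\<^sub>v z)"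
    by (rule eq_vecI) (use W c in \<open>auto simp: scalar_prod_add_distrib[of _ n]\<close>)
  with W c y z show ?thesis by (auto simp: root_vector_def)
qed

text \<open>One linear condition costs at most one vector. Eliminating with a vector on which the
  functional vanishes to the least order at \<open>\<mu>\<close> needs no denominator that vanishes at \<open>\<mu>\<close>, so that
  the values at \<open>\<mu>\<close> stay independent.\<close>

lemma independent_at_kill_functional:
  fixes x :: "'j \<Rightarrow> complex poly vec"
  assumes J: "finite J" and x: "\<And>j. j \<in> J \<Longrightarrow> x j \<in> S" and S: "S \<subseteq> carrier_vec n"
    and closed: "\<And>p q y z. y \<in> S \<Longrightarrow> z \<in> S \<Longrightarrow> p \<cdot>\<^sub>v y + q \<cdot>\<^sub>v z \<in> S"
    and v: "v \<in> carrier_vec n" and indep: "independent_at \<mu> n J x"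
  shows "\<exists>J' x'. finite J' \<and> card J \<le> card (J' :: 'j set) + 1 \<and>
    (\<forall>j\<in>J'. x' j \<in> S \<and> v \<bullet> x' j = 0) \<and> independent_at \<mu> n J' x'"
proof -
  define f where "f j = v \<bullet> x j" for j
  define J0 where "J0 = {j \<in> J. f j \<noteq> 0}"
  show ?thesis
  proof (cases "J0 = {}")
    case True
    with J x indep show ?thesis by (intro exI[of _ J] exI[of _ x]) (auto simp: J0_def f_def)
  next
    case False
    define e where "e = Min ((\<lambda>j. Polynomial.order \<mu> (f j)) ` J0)"
    have fin: "finite J0" using J by (auto simp: J0_def)
    have "e \<in> (\<lambda>j. Polynomial.order \<mu> (f j)) ` J0" unfolding e_def using fin False by (intro Min_in) auto
    then obtain j0 where j0: "j0 \<in> J" "f j0 \<noteq> 0" "Polynomial.order \<mu> (f j0) = e" by (auto simp: J0_def)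
    have "[:-\<mu>, 1:] ^ e dvd f j" if "j \<in> J" for j
    proof (cases "f j = 0")
      case False
      with that fin have "e \<le> Polynomial.order \<mu> (f j)" unfolding e_def by (intro Min_le) (auto simp: J0_def)
      then show ?thesis by (meson dvd_trans le_imp_power_dvd order_1)
    qed auto
    then have "\<exists>g. f j = [:-\<mu>, 1:] ^ e * g" if "j \<in> J" for j using that by (auto elim: dvdE)
    then obtain g where g: "\<And>j. j \<in> J \<Longrightarrow> f j = [:-\<mu>, 1:] ^ e * g j" by metis
    have g0: "poly (g j0) \<mu> \<noteq> 0"
    proof
      assume "poly (g j0) \<mu> = 0"
      then have "[:-\<mu>, 1:] dvd g j0" by (simp add: poly_eq_0_iff_dvd)
      then have "[:-\<mu>, 1:] ^ Suc e dvd f j0" unfolding g[OF j0(1)]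
        by (simp only: power_Suc2) (rule mult_dvd_mono, auto)
      with order_2[OF j0(2), of \<mu>] j0(3) show False by simp
    qed
    define J' where "J' = J - {j0}"
    define x' where "x' j = g j0 \<cdot>\<^sub>v x j + (- g j) \<cdot>\<^sub>v x j0" for j
    have c: "x j \<in> carrier_vec n" if "j \<in> J" for j using x S that by auto
    have v0: "v \<bullet> x' j = 0" if "j \<in> J'" for j
    proof -
      have j: "j \<in> J" using that by (auto simp: J'_def)
      have "v \<bullet> x' j = g j0 * f j + (- g j) * f j0"
        unfolding x'_def f_def using v c[OF j] c[OF j0(1)]
        by (simp add: scalar_prod_add_distrib[of _ n])
      also have "\<dots> = 0" unfolding g[OF j] g[OF j0(1)] by simp
      finally show ?thesis .
    qed
    have "independent_at \<mu> n J' x'"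
      unfolding independent_at_def
    proof (intro allI impI ballI)
      fix a j assume a: "\<forall>i<n. (\<Sum>j\<in>J'. a j * poly (x' j $ i) \<mu>) = 0" and j: "j \<in> J'"
      define b where "b j = (if j = j0 then - (\<Sum>j\<in>J'. a j * poly (g j) \<mu>)
        else a j * poly (g j0) \<mu>)" for j
      have "(\<Sum>j\<in>J. b j * poly (x j $ i) \<mu>) = 0" if i: "i < n" for i
      proof -
        have "(\<Sum>j\<in>J. b j * poly (x j $ i) \<mu>) =
          b j0 * poly (x j0 $ i) \<mu> + (\<Sum>j\<in>J'. b j * poly (x j $ i) \<mu>)"
          unfolding J'_def using J j0(1) by (simp add: sum.remove)
        also have "(\<Sum>j\<in>J'. b j * poly (x j $ i) \<mu>) =
          (\<Sum>j\<in>J'. a j * poly (g j0) \<mu> * poly (x j $ i) \<mu>)"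
          by (rule sum.cong) (auto simp: b_def J'_def)
        also have "b j0 * poly (x j0 $ i) \<mu> + \<dots> =
          (\<Sum>j\<in>J'. a j * (poly (g j0) \<mu> * poly (x j $ i) \<mu> - poly (g j) \<mu> * poly (x j0 $ i) \<mu>))"
          by (simp add: b_def sum_distrib_right sum_subtractf right_diff_distrib mult.assoc)
        also have "\<dots> = (\<Sum>j\<in>J'. a j * poly (x' j $ i) \<mu>)"
        proof (rule sum.cong)
          fix j assume "j \<in> J'"
          then have "dim_vec (x j) = n" "dim_vec (x j0) = n" using c j0 by (auto simp: J'_def)
          with i show "a j * (poly (g j0) \<mu> * poly (x j $ i) \<mu> - poly (g j) \<mu> * poly (x j0 $ i) \<mu>)
            = a j * poly (x' j $ i) \<mu>" by (simp add: x'_def)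
        qed simp
        finally show ?thesis using a i by simp
      qed
      with indep j have "b j = 0" by (auto simp: independent_at_def J'_def)
      with g0 j show "a j = 0" by (auto simp: b_def J'_def split: if_splits)
    qed
    moreover have "\<forall>j\<in>J'. x' j \<in> S" using closed x j0 by (auto simp: x'_def J'_def)
    moreover have "card J = card J' + 1" unfolding J'_def using J j0
      by (metis Suc_eq_plus1 card.remove)
    ultimately show ?thesis using v0 J by (intro exI[of _ J'] exI[of _ x']) (auto simp: J'_def)
  qed
qed

lemma independent_at_kill_functionals:
  fixes x :: "'j \<Rightarrow> complex poly vec"
  assumes J: "finite J" and x: "\<And>j. j \<in> J \<Longrightarrow> x j \<in> S" and S: "S \<subseteq> carrier_vec n"
    and closed: "\<And>p q y z. y \<in> S \<Longrightarrow> z \<in> S \<Longrightarrow> p \<cdot>\<^sub>v y + q \<cdot>\<^sub>v z \<in> S"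
    and vs: "set vs \<subseteq> carrier_vec n" and indep: "independent_at \<mu> n J x"
  shows "\<exists>J' x'. finite J' \<and> card J \<le> card (J' :: 'j set) + length vs \<and>
    (\<forall>j\<in>J'. x' j \<in> S \<and> (\<forall>v\<in>set vs. v \<bullet> x' j = 0)) \<and> independent_at \<mu> n J' x'"
  using vs
proof (induct vs)
  case Nil
  then show ?case using J x indep by (intro exI[of _ J] exI[of _ x]) auto
next
  case (Cons v vs)
  then obtain J' :: "'j set" and x' where IH: "finite J'" "card J \<le> card J' + length vs"
    "\<forall>j\<in>J'. x' j \<in> S \<and> (\<forall>v\<in>set vs. v \<bullet> x' j = 0)" "independent_at \<mu> n J' x'" by auto
  let ?S = "{y \<in> S. \<forall>v\<in>set vs. v \<bullet> y = 0}"
  have "p \<cdot>\<^sub>v y + q \<cdot>\<^sub>v z \<in> ?S" if "y \<in> ?S" "z \<in> ?S" for p q y z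
  proof -
    have "w \<bullet> (p \<cdot>\<^sub>v y + q \<cdot>\<^sub>v z) = p * (w \<bullet> y) + q * (w \<bullet> z)" if "w \<in> set vs" for w
    proof -
      have "w \<in> carrier_vec n" "y \<in> carrier_vec n" "z \<in> carrier_vec n"
        using that Cons.prems S \<open>y \<in> ?S\<close> \<open>z \<in> ?S\<close> by auto
      then show ?thesis by (simp add: scalar_prod_add_distrib[of _ n])
    qed
    then show ?thesis using that closed by auto
  qed
  moreover have "?S \<subseteq> carrier_vec n" "v \<in> carrier_vec n" using S Cons.prems by auto
  moreover have "x' j \<in> ?S" if "j \<in> J'" for j using IH(3) that by auto
  ultimately have "\<exists>J'' x''. finite J'' \<and> card J' \<le> card (J'' :: 'j set) + 1 \<and>
    (\<forall>j\<in>J''. x'' j \<in> ?S \<and> v \<bullet> x'' j = 0) \<and> independent_at \<mu> n J'' x''"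
    by (intro independent_at_kill_functional[of J' x' ?S n v \<mu>] IH(1,4))
  then obtain J'' :: "'j set" and x'' where "finite J''" "card J' \<le> card J'' + 1"
    "\<forall>j\<in>J''. x'' j \<in> ?S \<and> v \<bullet> x'' j = 0" "independent_at \<mu> n J'' x''" by blast
  with IH show ?case by (intro exI[of _ J''] exI[of _ x'']) auto
qed

text \<open>A perturbation of rank \<open>r\<close> is given here by \<open>r\<close> linear functionals on whose common kernel
  the two matrices agree.\<close>

lemma max_root_rank_interlacing:
  assumes W: "W \<in> carrier_mat n n" and g: "max_root_rank W n \<mu> k g"
    and g': "max_root_rank W' n \<mu> k g'" and vs: "set vs \<subseteq> carrier_vec n"
    and eq: "\<And>y. y \<in> carrier_vec n \<Longrightarrow> (\<And>v. v \<in> set vs \<Longrightarrow> v \<bullet> y = 0) \<Longrightarrow> W' *\<^sub>v y = W *\<^sub>v y"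
  shows "g \<le> g' + length vs"
proof -
  obtain J :: "nat set" and x where J: "finite J" "card J = g" "\<forall>j\<in>J. root_vector W n \<mu> k (x j)"
    "independent_at \<mu> n J x" using g unfolding max_root_rank_def by blast
  let ?S = "{y. root_vector W n \<mu> k y}"
  obtain J' :: "nat set" and x' where J': "finite J'" "card J \<le> card J' + length vs"
    "\<forall>j\<in>J'. x' j \<in> ?S \<and> (\<forall>v\<in>set vs. v \<bullet> x' j = 0)" "independent_at \<mu> n J' x'"
    using independent_at_kill_functionals[of J x ?S n vs \<mu>] J vs root_vector_combination[OF W]
    by (auto simp: root_vector_def)
  have "root_vector W' n \<mu> k (x' j)" if "j \<in> J'" for j
    using J'(3) that eq[of "x' j"] by (auto simp: root_vector_def)
  with g' J' have "card J' \<le> g'" unfolding max_root_rank_def by blast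
  with J J' show ?thesis by simp
qed

lemma homogeneous_system_nontrivial:
  fixes t :: "'i \<Rightarrow> 'j \<Rightarrow> 'a::field"
  assumes "finite I" "finite J" "card I < card J"
  shows "\<exists>a. (\<forall>i\<in>I. (\<Sum>j\<in>J. t i j * a j) = 0) \<and> (\<exists>j\<in>J. a j \<noteq> 0)"
  using assms
proof (induct I arbitrary: J t rule: finite_induct)
  case empty
  then have "J \<noteq> {}" by auto
  then show ?case by (intro exI[of _ "\<lambda>_. 1"]) auto
next
  case (insert i I)
  show ?case
  proof (cases "\<forall>j\<in>J. t i j = 0")
    case True
    with insert.hyps(3)[OF insert.prems(1), of t] insert.hyps insert.prems show ?thesis by auto
  next
    case False
    then obtain j0 where j0: "j0 \<in> J" "t i j0 \<noteq> 0" by auto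
    let ?J = "J - {j0}"
    let ?t = "\<lambda>i' j. t i' j - t i' j0 * t i j / t i j0"
    have "card I < card ?J" using insert j0 by simp
    then obtain a where a: "\<forall>i'\<in>I. (\<Sum>j\<in>?J. ?t i' j * a j) = 0" "\<exists>j\<in>?J. a j \<noteq> 0"
      using insert.hyps(3)[of ?J ?t] insert.prems by auto
    define s where "s = (\<Sum>j\<in>?J. t i j * a j)"
    define b where "b j = (if j = j0 then - s / t i j0 else a j)" for j
    have split: "(\<Sum>j\<in>J. t i' j * b j) = - (t i' j0 * s / t i j0) + (\<Sum>j\<in>?J. t i' j * a j)" for i'
    proof -
      have "(\<Sum>j\<in>J. t i' j * b j) = t i' j0 * b j0 + (\<Sum>j\<in>?J. t i' j * b j)"
        using insert.prems j0 by (simp add: sum.remove)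
      also have "(\<Sum>j\<in>?J. t i' j * b j) = (\<Sum>j\<in>?J. t i' j * a j)"
        by (rule sum.cong) (auto simp: b_def)
      finally show ?thesis by (simp add: b_def)
    qed
    have "(\<Sum>j\<in>J. t i' j * b j) = 0" if "i' \<in> insert i I" for i'
    proof (cases "i' = i")
      case True
      then show ?thesis using j0 by (simp add: split s_def)
    next
      case False
      with that a have "(\<Sum>j\<in>?J. ?t i' j * a j) = 0" by auto
      moreover have "(\<Sum>j\<in>?J. ?t i' j * a j) = (\<Sum>j\<in>?J. t i' j * a j) - t i' j0 * s / t i j0"
        unfolding s_def by (simp add: left_diff_distrib sum_subtractf sum_distrib_left
            sum_divide_distrib mult.assoc)
      ultimately show ?thesis unfolding split by simp
    qed
    with a show ?thesis by (intro exI[of _ b]) (auto simp: b_def)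
  qed
qed

section \<open>Root vectors of a block diagonal matrix\<close>

text \<open>The values at \<open>\<mu>\<close> of the root vectors of order \<open>k\<close> fill the coordinate subspace indexed
  by \<open>I\<close>.\<close>

definition coordinate_roots :: "complex poly mat \<Rightarrow> nat \<Rightarrow> complex \<Rightarrow> nat \<Rightarrow> nat set \<Rightarrow> bool" where
  "coordinate_roots W n \<mu> k I \<longleftrightarrow> I \<subseteq> {..<n} \<and>
     (\<forall>y. root_vector W n \<mu> k y \<longrightarrow> (\<forall>i<n. i \<notin> I \<longrightarrow> poly (y $ i) \<mu> = 0)) \<and>
     (\<forall>i\<in>I. \<exists>y. root_vector W n \<mu> k y \<and> poly (y $ i) \<mu> \<noteq> 0 \<and>
        (\<forall>j<n. j \<noteq> i \<longrightarrow> poly (y $ j) \<mu> = 0))"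

abbreviation const_mat :: "complex mat \<Rightarrow> complex poly mat" where
  "const_mat A \<equiv> map_mat (\<lambda>a. [:a:]) A"

lemma const_mat_mult:
  assumes "A \<in> carrier_mat n m" "B \<in> carrier_mat m l"
  shows "const_mat (A * B) = const_mat A * const_mat B"
proof -
  interpret semiring_hom "\<lambda>a::complex. [:a:]" by unfold_locales auto
  show ?thesis by (rule mat_hom_mult[OF assms])
qed

lemma const_mat_one: "const_mat (1\<^sub>m n) = 1\<^sub>m n"
  by (rule eq_matI) (auto simp: one_pCons)

lemma root_vector_mult_left:
  assumes W: "W \<in> carrier_mat n n" and P: "P \<in> carrier_mat n n" and y: "root_vector W n \<mu> k y"
  shows "root_vector (P * W) n \<mu> k y"
proof -
  have c: "y \<in> carrier_vec n" using y by (simp add: root_vector_def)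
  have "(P * W *\<^sub>v y) $ i = (\<Sum>l = 0..<n. P $$ (i, l) * (W *\<^sub>v y) $ l)" if "i < n" for i
    using W P c that by (simp add: assoc_mult_mat_vec[of _ n n _ n] scalar_prod_def)
  with y show ?thesis by (auto simp: root_vector_def intro!: dvd_sum dvd_mult)
qed

lemma root_vector_mult_right:
  assumes "W \<in> carrier_mat n n" "Q \<in> carrier_mat n n" "y \<in> carrier_vec n"
  shows "root_vector (W * Q) n \<mu> k y \<longleftrightarrow> root_vector W n \<mu> k (Q *\<^sub>v y)"
  using assms by (simp add: root_vector_def assoc_mult_mat_vec[of _ n n _ n])

lemma independent_at_invertible:
  assumes Q: "Q \<in> carrier_mat n n" "Q' \<in> carrier_mat n n" "Q' * Q = 1\<^sub>m n"
    and y: "\<And>j. j \<in> J \<Longrightarrow> y j \<in> carrier_vec n" and indep: "independent_at \<mu> n J y"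
  shows "independent_at \<mu> n J (\<lambda>j. const_mat Q *\<^sub>v y j)"
  unfolding independent_at_def
proof (intro allI impI)
  fix a assume a: "\<forall>i<n. (\<Sum>j\<in>J. a j * poly ((const_mat Q *\<^sub>v y j) $ i) \<mu>) = 0"
  define u where "u = vec n (\<lambda>m. \<Sum>j\<in>J. a j * poly (y j $ m) \<mu>)"
  have u: "u \<in> carrier_vec n" by (simp add: u_def)
  have "Q *\<^sub>v u = 0\<^sub>v n"
  proof (rule eq_vecI)
    fix i assume "i < dim_vec (0\<^sub>v n :: complex vec)"
    then have i: "i < n" by simp
    have "(Q *\<^sub>v u) $ i = (\<Sum>m = 0..<n. \<Sum>j\<in>J. a j * (Q $$ (i, m) * poly (y j $ m) \<mu>))"
      using Q i by (simp add: u_def scalar_prod_def sum_distrib_left mult.left_commute)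
    also have "\<dots> = (\<Sum>j\<in>J. a j * (\<Sum>m = 0..<n. Q $$ (i, m) * poly (y j $ m) \<mu>))"
      by (subst sum.swap) (simp add: sum_distrib_left)
    also have "\<dots> = (\<Sum>j\<in>J. a j * poly ((const_mat Q *\<^sub>v y j) $ i) \<mu>)"
    proof (rule sum.cong)
      fix j assume "j \<in> J"
      with y have "dim_vec (y j) = n" by auto
      with Q i show "a j * (\<Sum>m = 0..<n. Q $$ (i, m) * poly (y j $ m) \<mu>) =
          a j * poly ((const_mat Q *\<^sub>v y j) $ i) \<mu>"
        by (simp add: scalar_prod_def poly_sum)
    qed simp
    finally show "(Q *\<^sub>v u) $ i = 0\<^sub>v n $ i" using a i by simp
  qed (use Q in auto)
  then have "(Q' * Q) *\<^sub>v u = Q' *\<^sub>v 0\<^sub>v n"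
    using assoc_mult_mat_vec[OF Q(2,1) u] by simp
  moreover have "Q' *\<^sub>v 0\<^sub>v n = 0\<^sub>v n" using Q by (intro eq_vecI) auto
  ultimately have "u = 0\<^sub>v n" using Q u by simp
  then have "u $ i = 0" if "i < n" for i using that by simp
  then have "(\<Sum>j\<in>J. a j * poly (y j $ i) \<mu>) = 0" if "i < n" for i
    using that by (simp add: u_def)
  with indep show "\<forall>j\<in>J. a j = 0" by (simp add: independent_at_def)
qed

text \<open>Constant invertible factors preserve both the order of root vectors and the independence of their values. More
than \<open>card I\<close> vectors supported on the coordinates in \<open>I\<close> are dependent.\<close>

lemma max_root_rank_coordinate_roots:
  assumes W: "W \<in> carrier_mat n n" and P: "P \<in> carrier_mat n n" "invertible_mat P"
    and Q: "Q \<in> carrier_mat n n" "invertible_mat Q"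
    and eq: "const_mat P * W * const_mat Q = W'" and I: "coordinate_roots W' n \<mu> k I"
  shows "max_root_rank W n \<mu> k (card I)"
proof -
  obtain P' where P': "P' \<in> carrier_mat n n" "P' * P = 1\<^sub>m n"
    using P unfolding invertible_mat_def inverts_mat_def
    by (metis carrier_matD carrier_matI index_mult_mat(2,3) index_one_mat(2,3))
  obtain Q' where Q': "Q' \<in> carrier_mat n n" "Q' * Q = 1\<^sub>m n" "Q * Q' = 1\<^sub>m n"
    using Q unfolding invertible_mat_def inverts_mat_def
    by (metis carrier_matD carrier_matI index_mult_mat(2,3) index_one_mat(2,3))
  have finI: "finite I" using I finite_subset by (auto simp: coordinate_roots_def)
  have c: "const_mat P \<in> carrier_mat n n" "const_mat P' \<in> carrier_mat n n"
    "const_mat Q \<in> carrier_mat n n" "const_mat Q' \<in> carrier_mat n n" using P P' Q Q' by auto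
  have PW: "const_mat P * W \<in> carrier_mat n n" and W': "W' \<in> carrier_mat n n" 
    using c W eq by auto
  have W'_W: "root_vector W n \<mu> k (const_mat Q *\<^sub>v y)" if y: "root_vector W' n \<mu> k y" for y
  proof -
    have yc: "y \<in> carrier_vec n" using y by (simp add: root_vector_def)
    have "root_vector (const_mat P' * W') n \<mu> k y"
      by (rule root_vector_mult_left[OF W' c(2) y])
    moreover have "const_mat P' * W' = const_mat (P' * P) * (W * const_mat Q)"
      unfolding eq[symmetric] const_mat_mult[OF P'(1) P(1)] using c W
      by (simp add: assoc_mult_mat[of _ n n _ n _ n])
    ultimately have "root_vector (W * const_mat Q) n \<mu> k y"
      using P' W c by (simp add: const_mat_one)
    then show ?thesis using root_vector_mult_right[OF W c(3) yc] by simp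
  qed
  have W_W': "root_vector W' n \<mu> k (const_mat Q' *\<^sub>v x)" if x: "root_vector W n \<mu> k x" for x
  proof -
    have xc: "x \<in> carrier_vec n" using x by (simp add: root_vector_def)
    have "const_mat Q *\<^sub>v (const_mat Q' *\<^sub>v x) = const_mat (Q * Q') *\<^sub>v x"
      unfolding const_mat_mult[OF Q(1) Q'(1)] using c xc by (simp add: assoc_mult_mat_vec[of _ n n _ n])
    then have "root_vector (const_mat P * W) n \<mu> k (const_mat Q *\<^sub>v (const_mat Q' *\<^sub>v x))"
      using root_vector_mult_left[OF W c(1) x] Q' xc by (simp add: const_mat_one)
    then show ?thesis unfolding eq[symmetric]
      using root_vector_mult_right[OF PW c(3)] c xc by simp
  qed
  have "\<forall>i\<in>I. \<exists>y. root_vector W' n \<mu> k y \<and> poly (y $ i) \<mu> \<noteq> 0 \<and>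
      (\<forall>j<n. j \<noteq> i \<longrightarrow> poly (y $ j) \<mu> = 0)" using I by (simp add: coordinate_roots_def)
  then obtain y where y: "\<forall>i\<in>I. root_vector W' n \<mu> k (y i) \<and> poly (y i $ i) \<mu> \<noteq> 0 \<and>
      (\<forall>j<n. j \<noteq> i \<longrightarrow> poly (y i $ j) \<mu> = 0)" by metis
  have "independent_at \<mu> n I y" unfolding independent_at_def
  proof (intro allI impI ballI)
    fix a i assume a: "\<forall>i<n. (\<Sum>j\<in>I. a j * poly (y j $ i) \<mu>) = 0" and i: "i \<in> I"
    have "i < n" using i I by (auto simp: coordinate_roots_def)
    then have "(\<Sum>j\<in>I. a j * poly (y j $ i) \<mu>) = (\<Sum>j\<in>I. if j = i then a i * poly (y i $ i) \<mu> else 0)"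
      using y by (intro sum.cong) auto
    with a \<open>i < n\<close> finI i have "a i * poly (y i $ i) \<mu> = 0" by simp
    with y i show "a i = 0" by auto
  qed
  then have "independent_at \<mu> n I (\<lambda>i. const_mat Q *\<^sub>v y i)"
    using y by (intro independent_at_invertible[OF Q(1) Q'(1,2)]) (auto simp: root_vector_def)
  then have ex: "\<exists>(J :: nat set) x. finite J \<and> card J = card I \<and>
      (\<forall>j\<in>J. root_vector W n \<mu> k (x j)) \<and> independent_at \<mu> n J x"
    using y W'_W finI by (intro exI[of _ I] exI[of _ "\<lambda>i. const_mat Q *\<^sub>v y i"]) auto
  have "card J \<le> card I" if J: "finite J" "\<forall>j\<in>J. root_vector W n \<mu> k (x j)"
      "independent_at \<mu> n J x" for J :: "nat set" and x
  proof (rule ccontr)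
    assume "\<not> card J \<le> card I"
    then obtain a where a: "\<forall>i\<in>I. (\<Sum>j\<in>J. poly ((const_mat Q' *\<^sub>v x j) $ i) \<mu> * a j) = 0"
      "\<exists>j\<in>J. a j \<noteq> 0"
      using homogeneous_system_nontrivial[OF finI J(1), of "\<lambda>i j. poly ((const_mat Q' *\<^sub>v x j) $ i) \<mu>"]
      by auto
    have "(\<Sum>j\<in>J. a j * poly ((const_mat Q' *\<^sub>v x j) $ i) \<mu>) = 0" if "i < n" for i
    proof (cases "i \<in> I")
      case True
      then show ?thesis using a by (simp add: mult.commute)
    next
      case False
      then have "poly ((const_mat Q' *\<^sub>v x j) $ i) \<mu> = 0" if "j \<in> J" for j
        using I W_W' J(2) that \<open>i < n\<close> by (auto simp: coordinate_roots_def)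
      then show ?thesis by simp
    qed
    moreover have "independent_at \<mu> n J (\<lambda>j. const_mat Q' *\<^sub>v x j)"
      by (rule independent_at_invertible[OF Q'(1) Q(1) Q'(3) _ J(3)])
         (use J in \<open>auto simp: root_vector_def\<close>)
    ultimately have "\<forall>j\<in>J. a j = 0" unfolding independent_at_def by blast
    with a show False by blast
  qed
  with ex show ?thesis unfolding max_root_rank_def by blast
qed

definition bidiagonal :: "nat \<Rightarrow> 'a::zero \<Rightarrow> 'a \<Rightarrow> 'a mat" where
  "bidiagonal m a b = mat m m (\<lambda>(i, j). if j = i then a else if j = Suc i then b else 0)"

lemma bidiagonal_carrier[simp]: "bidiagonal m a b \<in> carrier_mat m m"
  by (simp add: bidiagonal_def)

lemma bidiagonal_dim[simp]: "dim_row (bidiagonal m a b) = m" "dim_col (bidiagonal m a b) = m"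
  by (simp_all add: bidiagonal_def)

lemma bidiagonal_mult_vec:
  fixes a :: "'a::comm_ring_1"
  assumes "y \<in> carrier_vec m" "i < m"
  shows "(bidiagonal m a b *\<^sub>v y) $ i = a * y $ i + (if Suc i < m then b * y $ Suc i else 0)"
proof -
  have "(bidiagonal m a b *\<^sub>v y) $ i =
      (\<Sum>j = 0..<m. (if j = i then a * y $ j else 0) + (if j = Suc i then b * y $ j else 0))"
  proof -
    have "(bidiagonal m a b *\<^sub>v y) $ i =
        (\<Sum>j = 0..<m. (if j = i then a else if j = Suc i then b else 0) * y $ j)"
      using assms by (simp add: bidiagonal_def scalar_prod_def)
    also have "\<dots> = (\<Sum>j = 0..<m. (if j = i then a * y $ j else 0) +
        (if j = Suc i then b * y $ j else 0))"
      by (rule sum.cong) auto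
    finally show ?thesis .
  qed
  then show ?thesis using assms by (simp add: sum.distrib)
qed

lemma linear_power_dvd_mult_cancel:
  assumes "poly p \<mu> \<noteq> (0 :: 'a::idom)" "[:-\<mu>, 1:] ^ k dvd p * q"
  shows "[:-\<mu>, 1:] ^ k dvd q"
proof (cases "q = 0")
  case False
  with assms(1) have "p * q \<noteq> 0" by auto
  with assms have "k \<le> Polynomial.order \<mu> p + Polynomial.order \<mu> q"
    by (simp add: order_divides order_mult)
  with assms(1) show ?thesis by (simp add: order_divides order_0I)
qed auto

text \<open>If \<open>a\<close> has a simple zero at \<open>\<mu>\<close> and \<open>b\<close> does not vanish there, the rows \<open>a y\<^sub>i + b y\<^sub>i\<^sub>+\<^sub>1\<close> force all entries after the first to
vanish at \<open>\<mu>\<close>. Eliminating them leaves the condition that \<open>(\<lambda> - \<mu>)\<^sup>k\<close> divides \<open>a\<^sup>m y\<^sub>0\<close>, so the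
first entry may be nonzero at \<open>\<mu>\<close> exactly for \<open>k \<le> m\<close>.\<close>

lemma coordinate_roots_bidiagonal:
  assumes k: "k > 0" and m: "m > 0"
    and a: "poly a \<mu> = 0 \<Longrightarrow> poly b \<mu> \<noteq> 0 \<and> (\<exists>a'. a = [:-\<mu>, 1:] * a' \<and> poly a' \<mu> \<noteq> 0)"
  shows "coordinate_roots (bidiagonal m a b) m \<mu> k (if poly a \<mu> = 0 \<and> k \<le> m then {0} else {})"
proof -
  let ?l = "[:-\<mu>, 1:]" and ?B = "bidiagonal m a b"
  have dvd0: "poly p \<mu> = 0" if "?l ^ k dvd p" for p
    using that k by (metis dvd_power dvd_trans poly_eq_0_iff_dvd zero_less_iff_neq_zero)
  have row: "?l ^ k dvd a * y $ i + (if Suc i < m then b * y $ Suc i else 0)"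
    if "root_vector ?B m \<mu> k y" "i < m" for y i
    using that bidiagonal_mult_vec[of y m i a b] by (auto simp: root_vector_def)
  show ?thesis
  proof (cases "poly a \<mu> = 0")
    case False
    \<comment> \<open>Back substitution: the rows determine the entries from the last one upwards.\<close>
    have "?l ^ k dvd y $ (m - 1 - i)" if y: "root_vector ?B m \<mu> k y" and "i < m" for y i
      using that(2)
    proof (induct i)
      case 0
      have "?l ^ k dvd a * y $ (m - 1)" using row[OF y, of "m - 1"] m by simp
      with False show ?case by (simp only: diff_zero) (rule linear_power_dvd_mult_cancel)
    next
      case (Suc i)
      have s: "Suc (m - 1 - Suc i) = m - 1 - i" using Suc.prems by simp
      have "?l ^ k dvd a * y $ (m - 1 - Suc i) + b * y $ (m - 1 - i)"
        using row[OF y, of "m - 1 - Suc i"] Suc.prems m unfolding s by (simp split: if_splits)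
      then have "?l ^ k dvd a * y $ (m - 1 - Suc i)"
        using Suc by (simp add: dvd_add_left_iff dvd_mult)
      with False show ?case by (rule linear_power_dvd_mult_cancel)
    qed
    note * = this
    have "poly (y $ i) \<mu> = 0" if y: "root_vector ?B m \<mu> k y" and "i < m" for y i
      using *[OF y, of "m - 1 - i"] that dvd0 by simp
    with False show ?thesis by (auto simp: coordinate_roots_def)
  next
    case True
    with a obtain a' where b: "poly b \<mu> \<noteq> 0" and a': "a = ?l * a'" "poly a' \<mu> \<noteq> 0" by auto
    have below: "poly (y $ i) \<mu> = 0" if y: "root_vector ?B m \<mu> k y" and i: "i < m" "i \<noteq> 0" for y i
    proof -
      have "?l ^ k dvd a * y $ (i - 1) + b * y $ i"
        using row[OF y, of "i - 1"] i by simp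
      from dvd0[OF this] True b show ?thesis by simp
    qed
    show ?thesis
    proof (cases "k \<le> m")
      case km: True
      define y where "y = vec m (\<lambda>i. b ^ (m - 1 - i) * (- a) ^ i)"
      have "?l ^ k dvd (?B *\<^sub>v y) $ i" if i: "i < m" for i
      proof (cases "Suc i < m")
        case True
        then have "b ^ (m - 1 - i) = b * b ^ (m - 1 - Suc i)"
          by (metis Suc_diff_Suc diff_Suc_1 diff_Suc_eq_diff_pred less_diff_conv plus_1_eq_Suc add.commute power_Suc)
        then have "(?B *\<^sub>v y) $ i = 0"
          using True i by (subst bidiagonal_mult_vec) (auto simp: y_def)
        then show ?thesis by simp
      next
        case False
        with i have im: "i = m - 1" by simp
        have "(?B *\<^sub>v y) $ i = a * (- a) ^ i"
          using False i im by (subst bidiagonal_mult_vec) (auto simp: y_def)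
        also have "\<dots> = - ((- a) ^ m)" using m im by (cases m) auto
        also have "\<dots> = - (?l ^ m * (- a') ^ m)" unfolding a' power_mult_distrib[symmetric] by simp
        finally show ?thesis using le_imp_power_dvd[OF km, of ?l] by simp
      qed
      then have y: "root_vector ?B m \<mu> k y" by (auto simp: root_vector_def y_def)
      moreover have "poly (y $ 0) \<mu> \<noteq> 0" using m b by (simp add: y_def)
      ultimately show ?thesis using True km m below
        by (auto simp: coordinate_roots_def intro!: exI[of _ y])
    next
      case km: False
      have "poly (y $ 0) \<mu> = 0" if y: "root_vector ?B m \<mu> k y" for y
      proof -
        have "?l ^ k dvd b ^ i * y $ i - (- a) ^ i * y $ 0" if "i < m" for i
          using that
        proof (induct i)
          case (Suc i)
          have h: "?l ^ k dvd a * y $ i + b * y $ Suc i" using row[OF y, of i] Suc by simp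
          have IH: "?l ^ k dvd b ^ i * y $ i - (- a) ^ i * y $ 0" using Suc by simp
          have "?l ^ k dvd b ^ i * (a * y $ i + b * y $ Suc i)
              - a * (b ^ i * y $ i - (- a) ^ i * y $ 0)"
            by (rule dvd_diff[OF dvd_mult[OF h] dvd_mult[OF IH]])
          then show ?case by (simp add: algebra_simps)
        qed simp
        then have h: "?l ^ k dvd b ^ (m - 1) * y $ (m - 1) - (- a) ^ (m - 1) * y $ 0" using m by simp
        have h': "?l ^ k dvd a * y $ (m - 1)" using row[OF y, of "m - 1"] m by simp
        have "?l ^ k dvd b ^ (m - 1) * (a * y $ (m - 1))
            - a * (b ^ (m - 1) * y $ (m - 1) - (- a) ^ (m - 1) * y $ 0)"
          by (rule dvd_diff[OF dvd_mult[OF h'] dvd_mult[OF h]])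
        also have "\<dots> = - ((- a) * (- a) ^ (m - 1)) * y $ 0" by (simp add: algebra_simps)
        also have "(- a) * (- a) ^ (m - 1) = (- a) ^ m" using m by (cases m) auto
        also have "- ((- a) ^ m) * y $ 0 = ?l ^ m * (- ((- a') ^ m) * y $ 0)"
          unfolding a' by (simp add: power_mult_distrib[symmetric])
        finally have "?l ^ m * ?l ^ (k - m) dvd ?l ^ m * (- ((- a') ^ m) * y $ 0)"
          using km by (simp add: power_add[symmetric])
        then have "?l ^ (k - m) dvd - ((- a') ^ m) * y $ 0"
          by (subst (asm) dvd_mult_cancel_left) auto
        moreover have "?l dvd ?l ^ (k - m)" using km by (intro dvd_power) auto
        ultimately have "poly (- ((- a') ^ m) * y $ 0) \<mu> = 0"
          using poly_eq_0_iff_dvd dvd_trans by blast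
        with a' show ?thesis by simp
      qed
      with below have "poly (y $ i) \<mu> = 0" if "root_vector ?B m \<mu> k y" "i < m" for y i
        using that by (cases "i = 0") auto
      with km show ?thesis by (auto simp: coordinate_roots_def)
    qed
  qed
qed

lemma root_vector_direct_sum:
  assumes W: "W1 \<in> carrier_mat n1 n1" "W2 \<in> carrier_mat n2 n2"
    and y: "y1 \<in> carrier_vec n1" "y2 \<in> carrier_vec n2"
  shows "root_vector (four_block_mat W1 (0\<^sub>m n1 n2) (0\<^sub>m n2 n1) W2) (n1 + n2) \<mu> k (y1 @\<^sub>v y2) \<longleftrightarrow>
    root_vector W1 n1 \<mu> k y1 \<and> root_vector W2 n2 \<mu> k y2" (is "?L \<longleftrightarrow> ?R1 \<and> ?R2")
proof -
  have "?L \<longleftrightarrow> (\<forall>i<n1 + n2. [:-\<mu>, 1:] ^ k dvd (W1 *\<^sub>v y1 @\<^sub>v W2 *\<^sub>v y2) $ i)"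
    using y by (simp add: root_vector_def mult_mat_vec_split[OF W y])
  also have "\<dots> \<longleftrightarrow> (\<forall>i<n1. [:-\<mu>, 1:] ^ k dvd (W1 *\<^sub>v y1) $ i) \<and>
      (\<forall>i<n2. [:-\<mu>, 1:] ^ k dvd (W2 *\<^sub>v y2) $ i)" (is "?A \<longleftrightarrow> ?B \<and> ?C")
  proof
    assume A: ?A
    have "[:-\<mu>, 1:] ^ k dvd (W1 *\<^sub>v y1) $ i" if "i < n1" for i
      using A[rule_format, of i] that W by (simp del: index_mult_mat_vec)
    moreover have "[:-\<mu>, 1:] ^ k dvd (W2 *\<^sub>v y2) $ i" if "i < n2" for i
      using A[rule_format, of "n1 + i"] that W by (simp del: index_mult_mat_vec)
    ultimately show "?B \<and> ?C" by blast
  next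
    assume "?B \<and> ?C"
    then show ?A using W by (auto simp del: index_mult_mat_vec)
  qed
  finally show ?thesis using y by (simp add: root_vector_def)
qed

lemma coordinate_roots_direct_sum:
  assumes W: "W1 \<in> carrier_mat n1 n1" "W2 \<in> carrier_mat n2 n2"
    and I1: "coordinate_roots W1 n1 \<mu> k I1" and I2: "coordinate_roots W2 n2 \<mu> k I2"
  shows "coordinate_roots (four_block_mat W1 (0\<^sub>m n1 n2) (0\<^sub>m n2 n1) W2) (n1 + n2) \<mu> k
    (I1 \<union> (+) n1 ` I2)" (is "coordinate_roots ?W _ _ _ ?I")
proof -
  have I: "I1 \<subseteq> {..<n1}" "I2 \<subseteq> {..<n2}" using I1 I2 by (auto simp: coordinate_roots_def)
  note sum = root_vector_direct_sum[OF W]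
  have "poly (y $ i) \<mu> = 0" if y: "root_vector ?W (n1 + n2) \<mu> k y" and i: "i < n1 + n2" "i \<notin> ?I" for y i
  proof -
    define y1 y2 where "y1 = vec_first y n1" and "y2 = vec_last y n2"
    have c: "y1 \<in> carrier_vec n1" "y2 \<in> carrier_vec n2" by (simp_all add: y1_def y2_def)
    have "y = y1 @\<^sub>v y2" using y by (simp add: y1_def y2_def root_vector_def)
    with y sum[OF c] have R: "root_vector W1 n1 \<mu> k y1" "root_vector W2 n2 \<mu> k y2" by auto
    show ?thesis
    proof (cases "i < n1")
      case True
      with I1 R i c show ?thesis unfolding \<open>y = _\<close> by (auto simp: coordinate_roots_def)
    next
      case False
      with i have "i - n1 \<notin> I2" by (metis UnI2 image_eqI le_add_diff_inverse not_less)
      with I2 R i c False show ?thesis unfolding \<open>y = _\<close> by (auto simp: coordinate_roots_def)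
    qed
  qed
  moreover have "\<exists>y. root_vector ?W (n1 + n2) \<mu> k y \<and> poly (y $ i) \<mu> \<noteq> 0 \<and>
        (\<forall>j<n1 + n2. j \<noteq> i \<longrightarrow> poly (y $ j) \<mu> = 0)" if "i \<in> ?I" for i
  proof (cases "i \<in> I1")
    case True
    with I1 obtain y1 where y1: "root_vector W1 n1 \<mu> k y1" "poly (y1 $ i) \<mu> \<noteq> 0"
      "\<forall>j<n1. j \<noteq> i \<longrightarrow> poly (y1 $ j) \<mu> = 0" by (auto simp: coordinate_roots_def)
    have "root_vector W2 n2 \<mu> k (0\<^sub>v n2)" using W by (auto simp: root_vector_def)
    with y1 sum[of y1 "0\<^sub>v n2"] have "root_vector ?W (n1 + n2) \<mu> k (y1 @\<^sub>v 0\<^sub>v n2)"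
      by (auto simp: root_vector_def)
    moreover have "dim_vec y1 = n1" using y1 by (auto simp: root_vector_def)
    ultimately show ?thesis using y1 True I by (intro exI[of _ "y1 @\<^sub>v 0\<^sub>v n2"]) auto
  next
    case False
    with that obtain l where l: "i = n1 + l" "l \<in> I2" by auto
    with I2 obtain y2 where y2: "root_vector W2 n2 \<mu> k y2" "poly (y2 $ l) \<mu> \<noteq> 0"
      "\<forall>j<n2. j \<noteq> l \<longrightarrow> poly (y2 $ j) \<mu> = 0" by (auto simp: coordinate_roots_def)
    have "root_vector W1 n1 \<mu> k (0\<^sub>v n1)" using W by (auto simp: root_vector_def)
    with y2 sum[of "0\<^sub>v n1" y2] have "root_vector ?W (n1 + n2) \<mu> k (0\<^sub>v n1 @\<^sub>v y2)"
      by (auto simp: root_vector_def)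
    moreover have "dim_vec y2 = n2" using y2 by (auto simp: root_vector_def)
    ultimately show ?thesis using y2 l I by (intro exI[of _ "0\<^sub>v n1 @\<^sub>v y2"]) auto
  qed
  ultimately show ?thesis using I unfolding coordinate_roots_def by (auto 4 3)
qed

text \<open>All the canonical forms below are of this shape, with affine \<open>a\<close> and \<open>b\<close>: the blocks of \<open>\<lambda> I - J\<close>,
of \<open>\<lambda> N - I\<close> and of \<open>I + (\<lambda> - c) J\<close>.\<close>

definition bidiagonal_blocks :: "(nat \<times> 'a::zero \<times> 'a) list \<Rightarrow> 'a mat" where
  "bidiagonal_blocks bs = diag_block_mat (map (\<lambda>(m, a, b). bidiagonal m a b) bs)"

lemma diag_block_mat_Cons:
  assumes "A \<in> carrier_mat n n" "diag_block_mat As \<in> carrier_mat m m"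
  shows "diag_block_mat (A # As) = four_block_mat A (0\<^sub>m n m) (0\<^sub>m m n) (diag_block_mat As)"
  using assms by (simp add: Let_def)

lemma bidiagonal_blocks_carrier[simp]:
  "bidiagonal_blocks bs \<in> carrier_mat (sum_list (map fst bs)) (sum_list (map fst bs))"
  by (rule carrier_matI)
     (auto simp: bidiagonal_blocks_def dim_diag_block_mat o_def case_prod_unfold)

lemma bidiagonal_blocks_Cons:
  "bidiagonal_blocks ((m, a, b) # bs) = four_block_mat (bidiagonal m a b)
     (0\<^sub>m m (sum_list (map fst bs))) (0\<^sub>m (sum_list (map fst bs)) m) (bidiagonal_blocks bs)"
  using bidiagonal_blocks_carrier[of bs] unfolding bidiagonal_blocks_def
  by (simp add: diag_block_mat_Cons[of _ m _ "sum_list (map fst bs)"] del: diag_block_mat.simps)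

definition simple_block_at :: "complex \<Rightarrow> nat \<times> complex poly \<times> complex poly \<Rightarrow> bool" where
  "simple_block_at \<mu> = (\<lambda>(m, a, b). m > 0 \<and> (poly a \<mu> = 0 \<longrightarrow>
     poly b \<mu> \<noteq> 0 \<and> (\<exists>a'. a = [:-\<mu>, 1:] * a' \<and> poly a' \<mu> \<noteq> 0)))"

lemma coordinate_roots_bidiagonal_blocks:
  assumes k: "k > 0" and bs: "\<forall>b\<in>set bs. simple_block_at \<mu> b"
  shows "\<exists>I. coordinate_roots (bidiagonal_blocks bs) (sum_list (map fst bs)) \<mu> k I \<and>
    card I = length (filter (\<lambda>(m, a, b). poly a \<mu> = 0 \<and> k \<le> m) bs)"
  using bs
proof (induct bs)
  case Nil
  then show ?case by (auto simp: coordinate_roots_def)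
next
  case (Cons t bs)
  obtain m a b where t: "t = (m, a, b)" by (cases t)
  let ?n = "sum_list (map fst bs)"
  from Cons obtain I where I: "coordinate_roots (bidiagonal_blocks bs) ?n \<mu> k I"
    "card I = length (filter (\<lambda>(m, a, b). poly a \<mu> = 0 \<and> k \<le> m) bs)" by auto
  let ?I0 = "if poly a \<mu> = 0 \<and> k \<le> m then {0::nat} else {}"
  have I0: "coordinate_roots (bidiagonal m a b) m \<mu> k ?I0"
    using Cons.prems t by (intro coordinate_roots_bidiagonal[OF k]) (auto simp: simple_block_at_def)
  have "coordinate_roots (bidiagonal_blocks (t # bs)) (m + ?n) \<mu> k (?I0 \<union> (+) m ` I)"
    unfolding t bidiagonal_blocks_Cons by (rule coordinate_roots_direct_sum[OF _ _ I0 I(1)]) auto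
  moreover have "card (?I0 \<union> (+) m ` I) = card ?I0 + card ((+) m ` I)"
  proof (rule card_Un_disjoint)
    show "finite ((+) m ` I)" using I(1) finite_subset by (fastforce simp: coordinate_roots_def)
    show "?I0 \<inter> (+) m ` I = {}" using Cons.prems t by (auto simp: simple_block_at_def)
  qed auto
  moreover have "card ((+) m ` I) = card I" by (simp add: card_image)
  ultimately show ?case using I(2) t by (intro exI[of _ "?I0 \<union> (+) m ` I"]) auto
qed

lemma max_root_rank_bidiagonal_blocks:
  assumes "W \<in> carrier_mat n n" "P \<in> carrier_mat n n" "invertible_mat P"
    and "Q \<in> carrier_mat n n" "invertible_mat Q"
    and eq: "const_mat P * W * const_mat Q = bidiagonal_blocks bs"
    and k: "k > 0" and bs: "\<forall>b\<in>set bs. simple_block_at \<mu> b"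
  shows "max_root_rank W n \<mu> k (length (filter (\<lambda>(m, a, b). poly a \<mu> = 0 \<and> k \<le> m) bs))"
proof -
  have "sum_list (map fst bs) = n"
    using arg_cong[OF eq, of dim_row] bidiagonal_blocks_carrier[of bs] assms(2) by simp
  with coordinate_roots_bidiagonal_blocks[OF k bs] obtain I where
    "coordinate_roots (bidiagonal_blocks bs) n \<mu> k I"
    "card I = length (filter (\<lambda>(m, a, b). poly a \<mu> = 0 \<and> k \<le> m) bs)" by auto
  with max_root_rank_coordinate_roots[OF assms(1-6)] show ?thesis by metis
qed

section \<open>Decreasing lists of multiplicities\<close>

definition count_ge :: "nat \<Rightarrow> nat list \<Rightarrow> nat" where
  "count_ge k xs = length (filter (\<lambda>m. k \<le> m) xs)"

lemma count_ge_Cons: "count_ge k (x # xs) = (if k \<le> x then 1 else 0) + count_ge k xs"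
  by (simp add: count_ge_def)

lemma count_ge_mset: "count_ge k xs = size (filter_mset (\<lambda>m. k \<le> m) (mset xs))"
proof -
  have "count_ge k xs = size (mset (filter (\<lambda>m. k \<le> m) xs))" unfolding count_ge_def by (simp only: size_mset)
  then show ?thesis by (simp only: mset_filter)
qed

lemma sum_list_eq_sum_count_ge:
  assumes "\<forall>x\<in>set xs. x \<le> N"
  shows "sum_list xs = (\<Sum>k\<in>{1..N}. count_ge k xs)"
  using assms
proof (induct xs)
  case Nil
  then show ?case by (simp add: count_ge_def)
next
  case (Cons x xs)
  have "(\<Sum>k\<in>{1..N}. if k \<le> x then 1 else 0) = card ({1..N} \<inter> {k. k \<le> x})"
    by (simp add: sum.If_cases)
  also have "{1..N} \<inter> {k. k \<le> x} = {1..x}" using Cons.prems by auto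
  finally show ?case using Cons by (simp add: count_ge_Cons sum.distrib)
qed

lemma count_ge_drop:
  assumes "sorted (rev xs)"
  shows "count_ge k (drop r xs) = count_ge k xs - r"
  using assms
proof (induct xs arbitrary: r)
  case Nil
  then show ?case by (simp add: count_ge_def)
next
  case (Cons x xs)
  have le: "\<forall>y\<in>set xs. y \<le> x" using Cons.prems by (auto simp: sorted_append)
  show ?case
  proof (cases r)
    case (Suc r')
    have "count_ge k (drop r' xs) = count_ge k xs - r'"
      using Cons by (auto simp: sorted_append)
    moreover have "count_ge k xs = 0" if "\<not> k \<le> x"
      using le that by (auto simp: count_ge_def filter_empty_conv)
    ultimately show ?thesis using Suc by (auto simp: count_ge_Cons)
  qed simp
qed

lemma eq_of_count_ge_eq:
  assumes "sorted (rev xs)" "sorted (rev ys)" "0 \<notin> set xs" "0 \<notin> set ys"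
    and eq: "\<And>k. k > 0 \<Longrightarrow> count_ge k xs = count_ge k ys"
  shows "xs = ys"
proof -
  have c: "count (mset zs) m + count_ge (Suc m) zs = count_ge m zs" for zs :: "nat list" and m
    by (induct zs) (auto simp: count_ge_def)
  have "mset xs = mset ys"
  proof (rule multiset_eqI)
    fix m
    show "count (mset xs) m = count (mset ys) m"
    proof (cases "m = 0")
      case True
      with assms show ?thesis by (simp add: count_eq_zero_iff[THEN iffD2])
    next
      case False
      with c[of xs m] c[of ys m] eq[of m] eq[of "Suc m"] show ?thesis by simp
    qed
  qed
  then have "rev xs = rev ys" using assms by (metis mset_rev properties_for_sort)
  then show ?thesis by simp
qed

text \<open>Summing the counts over all \<open>k\<close> gives the sum of a list, and dropping the \<open>r\<close> largest entries lowers every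
count by \<open>r\<close> or to 0.\<close>

lemma sum_list_drop_le_of_count_ge:
  assumes ns: "sorted (rev ns)" and le: "\<And>k. k > 0 \<Longrightarrow> count_ge k ns \<le> count_ge k ms + r"
  shows "sum_list (drop r ns) \<le> sum_list ms"
proof -
  obtain N where N: "\<forall>x\<in>set ns \<union> set ms. x \<le> N"
    by (metis List.finite_set finite_nat_set_iff_bounded_le set_append)
  have "sum_list (drop r ns) = (\<Sum>k\<in>{1..N}. count_ge k (drop r ns))"
    using N by (intro sum_list_eq_sum_count_ge) (auto dest: in_set_dropD)
  also have "\<dots> \<le> (\<Sum>k\<in>{1..N}. count_ge k ms)"
  proof (rule sum_mono)
    fix k assume "k \<in> {1..N}"
    with le[of k] show "count_ge k (drop r ns) \<le> count_ge k ms"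
      by (simp add: count_ge_drop[OF ns])
  qed
  also have "\<dots> = sum_list ms" using N by (intro sum_list_eq_sum_count_ge[symmetric]) auto
  finally show ?thesis .
qed

text \<open>Since all counts can only exceed those of \<open>drop r ns\<close>, equality of the sums forces equality
  of every count.\<close>

lemma eq_drop_of_count_ge:
  assumes ns: "sorted (rev ns)" "0 \<notin> set ns" and ms: "sorted (rev ms)" "0 \<notin> set ms"
    and le: "\<And>k. k > 0 \<Longrightarrow> count_ge k ns \<le> count_ge k ms + r"
    and sum: "sum_list ms \<le> sum_list (drop r ns)"
  shows "ms = drop r ns"
proof (rule eq_of_count_ge_eq)
  have le': "count_ge k (drop r ns) \<le> count_ge k ms" if "k > 0" for k
    using le[OF that] by (simp add: count_ge_drop[OF ns(1)])
  fix k :: nat assume k: "k > 0"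
  show "count_ge k ms = count_ge k (drop r ns)"
  proof (rule ccontr)
    assume ne: "count_ge k ms \<noteq> count_ge k (drop r ns)"
    obtain N where N: "\<forall>x\<in>set ns \<union> set ms \<union> {k}. x \<le> N"
      by (metis List.finite_set finite.emptyI finite.insertI finite_UnI finite_nat_set_iff_bounded_le)
    have "sum_list (drop r ns) = (\<Sum>k\<in>{1..N}. count_ge k (drop r ns))"
      using N by (intro sum_list_eq_sum_count_ge) (auto dest: in_set_dropD)
    also have "\<dots> < (\<Sum>k\<in>{1..N}. count_ge k ms)"
    proof (rule sum_strict_mono_ex1)
      show "\<forall>x\<in>{1..N}. count_ge x (drop r ns) \<le> count_ge x ms" using le' by auto
      have "k \<in> {1..N}" using N k by auto
      then show "\<exists>a\<in>{1..N}. count_ge a (drop r ns) < count_ge a ms" using le'[OF k] ne by force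
    qed simp
    also have "\<dots> = sum_list ms" using N by (intro sum_list_eq_sum_count_ge[symmetric]) auto
    finally show False using sum by simp
  qed
next
  have "sorted (take (length ns - r) (rev ns))" using ns(1) by (rule sorted_wrt_take)
  then show "sorted (rev (drop r ns))" by (simp add: rev_drop)
  show "0 \<notin> set (drop r ns)" using ns(2) by (auto dest: in_set_dropD)
qed (use ms in auto)

definition block_sizes :: "('b \<Rightarrow> bool) \<Rightarrow> (nat \<times> 'b) list \<Rightarrow> nat list" where
  "block_sizes P bs = rev (sort (map fst (filter (\<lambda>(k, a). P a) bs)))"

lemma block_sizes_sorted: "sorted (rev (block_sizes P bs))"
  by (simp add: block_sizes_def)

lemma block_sizes_nonzero: "0 \<notin> fst ` set bs \<Longrightarrow> 0 \<notin> set (block_sizes P bs)"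
  by (auto simp: block_sizes_def image_iff)

lemma count_ge_block_sizes:
  "count_ge k (block_sizes P bs) = length (filter (\<lambda>(m, a). P a \<and> k \<le> m) bs)"
proof -
  have "count_ge k (block_sizes P bs) = count_ge k (map fst (filter (\<lambda>(k, a). P a) bs))"
    by (simp add: count_ge_mset block_sizes_def)
  also have "\<dots> = length (filter (\<lambda>(m, a). P a \<and> k \<le> m) bs)"
    by (induct bs) (auto simp: count_ge_def)
  finally show ?thesis .
qed

lemma sum_list_block_sizes:
  "sum_list (block_sizes P bs) = (\<Sum>(m, a)\<leftarrow>bs. if P a then m else 0)"
proof -
  have "sum_list (block_sizes P bs) = sum_list (map fst (filter (\<lambda>(k, a). P a) bs))"
    unfolding block_sizes_def by (simp flip: sum_mset_sum_list)
  also have "\<dots> = (\<Sum>(m, a)\<leftarrow>bs. if P a then m else 0)" by (induct bs) auto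
  finally show ?thesis .
qed

section \<open>Strict equivalence of pencils\<close>

lemma const_mat_zero[simp]: "const_mat (0\<^sub>m n m) = 0\<^sub>m n m"
  by (rule eq_matI) auto

definition pencil_mat :: "pencil \<Rightarrow> complex poly mat" where
  "pencil_mat L = const_mat (fst L) + [:0, 1:] \<cdot>\<^sub>m const_mat (snd L)"

lemma pencil_det_eq: "pencil_det L = det (pencil_mat L)"
  by (simp add: pencil_det_def pencil_mat_def)

lemma pencil_mat_carrier[simp]: "L \<in> pencil_carrier n \<Longrightarrow> pencil_mat L \<in> carrier_mat n n"
  by (auto simp: pencil_mat_def pencil_carrier_def)

lemma inverse_matE:
  assumes "P \<in> carrier_mat n n" "invertible_mat P"
  obtains P' where "P' \<in> carrier_mat n n" "P' * P = 1\<^sub>m n" "P * P' = 1\<^sub>m n"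
  using assms unfolding invertible_mat_def inverts_mat_def
  by (metis carrier_matD carrier_matI index_mult_mat(2,3) index_one_mat(2,3))

lemma invertible_matI:
  assumes "P \<in> carrier_mat n n" "P' \<in> carrier_mat n n" "P' * P = 1\<^sub>m n" "P * P' = 1\<^sub>m n"
  shows "invertible_mat P"
  using assms unfolding invertible_mat_def inverts_mat_def square_mat.simps by (metis carrier_matD)

lemma invertible_mat_det_nonzero:
  assumes "(P :: complex mat) \<in> carrier_mat n n" "invertible_mat P" shows "det P \<noteq> 0"
proof
  assume "det P = 0"
  obtain P' where P': "P' \<in> carrier_mat n n" "P' * P = 1\<^sub>m n"
    using inverse_matE[OF assms] by metis
  have "det P' * det P = 1" using det_mult[OF P'(1) assms(1)] P'(2) by simp
  with \<open>det P = 0\<close> show False by simp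
qed

lemma invertible_mat_of_det:
  assumes "(P :: complex mat) \<in> carrier_mat n n" "det P \<noteq> 0" shows "invertible_mat P"
proof -
  have "P \<in> Units (ring_mat TYPE(complex) n ())" using assms by (rule det_non_zero_imp_unit)
  then obtain P' where "P' \<in> carrier_mat n n" "P' * P = 1\<^sub>m n" "P * P' = 1\<^sub>m n"
    unfolding Units_def ring_mat_def by auto
  with assms show ?thesis by (intro invertible_matI)
qed

lemma invertible_mat_mult:
  assumes "P \<in> carrier_mat n n" "invertible_mat P" "Q \<in> carrier_mat n n" "invertible_mat Q"
  shows "invertible_mat (P * Q :: complex mat)"
  using assms invertible_mat_det_nonzero[of _ n]
  by (intro invertible_mat_of_det[of _ n]) (auto simp: det_mult[of _ n])

lemma invertible_mat_direct_sum:
  assumes P: "P \<in> carrier_mat n n" "invertible_mat P" and Q: "Q \<in> carrier_mat m m" "invertible_mat Q"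
  shows "invertible_mat (four_block_mat P (0\<^sub>m n m) (0\<^sub>m m n) Q :: complex mat)"
  using invertible_mat_det_nonzero[OF P] invertible_mat_det_nonzero[OF Q] P Q
  by (intro invertible_mat_of_det[of _ "n + m"])
     (auto simp: det_four_block_mat_upper_right_zero[OF P(1) refl zero_carrier_mat Q(1)])

definition pencil_equiv :: "nat \<Rightarrow> pencil \<Rightarrow> pencil \<Rightarrow> bool" where
  "pencil_equiv n L L' \<longleftrightarrow> L \<in> pencil_carrier n \<and> (\<exists>P Q. P \<in> carrier_mat n n \<and> Q \<in> carrier_mat n n \<and>
     invertible_mat P \<and> invertible_mat Q \<and> P * fst L * Q = fst L' \<and> P * snd L * Q = snd L')"

lemma pencil_equivI:
  assumes "A \<in> carrier_mat n n" "B \<in> carrier_mat n n" "P \<in> carrier_mat n n" "Q \<in> carrier_mat n n"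
    "invertible_mat P" "invertible_mat Q" "P * A * Q = A'" "P * B * Q = B'"
  shows "pencil_equiv n (A, B) (A', B')"
  unfolding pencil_equiv_def using assms
  by (intro conjI exI[of _ P] exI[of _ Q]) (simp_all add: pencil_carrier_def)

lemma pencil_mat_equiv:
  assumes L: "L \<in> pencil_carrier n" and c: "P \<in> carrier_mat n n" "Q \<in> carrier_mat n n"
    and "P * fst L * Q = fst L'" "P * snd L * Q = snd L'"
  shows "const_mat P * pencil_mat L * const_mat Q = pencil_mat L'"
proof -
  have L: "fst L \<in> carrier_mat n n" "snd L \<in> carrier_mat n n" using L by (auto simp: pencil_carrier_def)
  have eq: "const_mat P * const_mat X * const_mat Q = const_mat (P * X * Q)"
    if X: "X \<in> carrier_mat n n" for X
    using const_mat_mult[OF mult_carrier_mat[OF c(1) X] c(2)] const_mat_mult[OF c(1) X] by simp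
  have "const_mat P * pencil_mat L * const_mat Q =
      const_mat P * const_mat (fst L) * const_mat Q +
      [:0, 1:] \<cdot>\<^sub>m (const_mat P * const_mat (snd L) * const_mat Q)"
    unfolding pencil_mat_def using L c
    by (simp add: mult_add_distrib_mat[of _ n n _ n] add_mult_distrib_mat[of _ n n _ _ n]
        mult_smult_distrib[of _ n n _ n] mult_smult_assoc_mat[of _ n n _ n])
  with assms(4,5) show ?thesis by (simp add: eq L pencil_mat_def)
qed

lemma pencil_equiv_trans:
  assumes "pencil_equiv n L1 L2" "pencil_equiv n L2 L3" shows "pencil_equiv n L1 L3"
proof -
  obtain P Q where 1: "L1 \<in> pencil_carrier n" "P \<in> carrier_mat n n" "Q \<in> carrier_mat n n"
    "invertible_mat P" "invertible_mat Q" "P * fst L1 * Q = fst L2" "P * snd L1 * Q = snd L2"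
    using assms(1) by (auto simp: pencil_equiv_def)
  obtain R S where 2: "R \<in> carrier_mat n n" "S \<in> carrier_mat n n"
    "invertible_mat R" "invertible_mat S" "R * fst L2 * S = fst L3" "R * snd L2 * S = snd L3"
    using assms(2) by (auto simp: pencil_equiv_def)
  have "R * P * X * (Q * S) = R * (P * X * Q) * S" if "X \<in> carrier_mat n n" for X :: "complex mat"
    using that 1 2 by (simp add: assoc_mult_mat[of _ n n _ n _ n])
  with 1 2 show ?thesis unfolding pencil_equiv_def
    by (intro conjI exI[of _ "R * P"] exI[of _ "Q * S"])
       (auto simp: pencil_carrier_def intro: invertible_mat_mult)
qed

definition pencil_sum :: "nat \<Rightarrow> nat \<Rightarrow> pencil \<Rightarrow> pencil \<Rightarrow> pencil" where
  "pencil_sum n m L M =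
     (four_block_mat (fst L) (0\<^sub>m n m) (0\<^sub>m m n) (fst M), four_block_mat (snd L) (0\<^sub>m n m) (0\<^sub>m m n) (snd M))"

lemma four_block_diag_mult:
  assumes "A \<in> carrier_mat n n" "B \<in> carrier_mat m m" "C \<in> carrier_mat n n" "D \<in> carrier_mat m m"
  shows "four_block_mat A (0\<^sub>m n m) (0\<^sub>m m n) B * four_block_mat C (0\<^sub>m n m) (0\<^sub>m m n) D =
    four_block_mat (A * C) (0\<^sub>m n m) (0\<^sub>m m n) (B * D :: 'a::comm_ring_1 mat)"
  using assms by (subst mult_four_block_mat[of _ n n _ m _ m _ _ n _ m]) auto

lemma pencil_equiv_sum:
  assumes "pencil_equiv n L L'" "pencil_equiv m M M'"
  shows "pencil_equiv (n + m) (pencil_sum n m L M) (pencil_sum n m L' M')"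
proof -
  obtain P Q where 1: "L \<in> pencil_carrier n" "P \<in> carrier_mat n n" "Q \<in> carrier_mat n n"
    "invertible_mat P" "invertible_mat Q" "P * fst L * Q = fst L'" "P * snd L * Q = snd L'"
    using assms(1) by (auto simp: pencil_equiv_def)
  obtain R S where 2: "M \<in> pencil_carrier m" "R \<in> carrier_mat m m" "S \<in> carrier_mat m m"
    "invertible_mat R" "invertible_mat S" "R * fst M * S = fst M'" "R * snd M * S = snd M'"
    using assms(2) by (auto simp: pencil_equiv_def)
  let ?d = "\<lambda>A B. four_block_mat A (0\<^sub>m n m) (0\<^sub>m m n) B"
  have "?d P R * ?d X Y * ?d Q S = ?d (P * X * Q) (R * Y * S)"
    if "X \<in> carrier_mat n n" "Y \<in> carrier_mat m m" for X Y
    using that 1 2 by (simp add: four_block_diag_mult)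
  with 1 2 show ?thesis unfolding pencil_sum_def
    by (intro pencil_equivI[of _ _ _ "?d P R" "?d Q S"] invertible_mat_direct_sum)
       (auto simp: pencil_carrier_def)
qed

lemma four_block_diag_swap:
  assumes A: "A \<in> carrier_mat n n" and B: "B \<in> carrier_mat m m"
  shows "four_block_mat (0\<^sub>m m n) (1\<^sub>m m) (1\<^sub>m n) (0\<^sub>m n m) *
      four_block_mat A (0\<^sub>m n m) (0\<^sub>m m n) B * four_block_mat (0\<^sub>m n m) (1\<^sub>m n) (1\<^sub>m m) (0\<^sub>m m n) =
    four_block_mat B (0\<^sub>m m n) (0\<^sub>m n m) (A :: 'a::comm_ring_1 mat)"
  using A B
  by (subst mult_four_block_mat[of _ m n _ m _ n _ _ n _ m], simp_all,
      subst mult_four_block_mat[of _ m n _ m _ n _ _ m _ n], simp_all)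

lemma four_block_swap_inverse:
  "four_block_mat (0\<^sub>m m n) (1\<^sub>m m) (1\<^sub>m n) (0\<^sub>m n m) *
     four_block_mat (0\<^sub>m n m) (1\<^sub>m n) (1\<^sub>m m) (0\<^sub>m m n) = (1\<^sub>m (n + m) :: 'a::comm_ring_1 mat)"
proof -
  have "four_block_mat (0\<^sub>m m n) (1\<^sub>m m) (1\<^sub>m n) (0\<^sub>m n m) *
     four_block_mat (0\<^sub>m n m) (1\<^sub>m n) (1\<^sub>m m) (0\<^sub>m m n) =
     four_block_mat (1\<^sub>m m) (0\<^sub>m m n) (0\<^sub>m n m) (1\<^sub>m n :: 'a mat)"
    by (subst mult_four_block_mat[of _ m n _ m _ n _ _ m _ n]) simp_all
  also have "\<dots> = 1\<^sub>m (m + n)" by (rule four_block_one_mat)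
  finally show ?thesis by (simp add: add.commute)
qed

lemma pencil_equiv_swap:
  assumes L: "L \<in> pencil_carrier n" and M: "M \<in> pencil_carrier m"
  shows "pencil_equiv (n + m) (pencil_sum n m L M) (pencil_sum m n M L)"
proof -
  let ?P = "four_block_mat (0\<^sub>m m n) (1\<^sub>m m) (1\<^sub>m n) (0\<^sub>m n m) :: complex mat"
  let ?Q = "four_block_mat (0\<^sub>m n m) (1\<^sub>m n) (1\<^sub>m m) (0\<^sub>m m n) :: complex mat"
  have c: "?P \<in> carrier_mat (n + m) (n + m)" "?Q \<in> carrier_mat (n + m) (n + m)"
    by (rule carrier_matI; simp)+
  have i1: "?P * ?Q = 1\<^sub>m (n + m)" by (rule four_block_swap_inverse)
  have i2: "?Q * ?P = 1\<^sub>m (n + m)"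
    by (subst add.commute) (rule four_block_swap_inverse)
  have LM: "fst L \<in> carrier_mat n n" "snd L \<in> carrier_mat n n" "fst M \<in> carrier_mat m m"
    "snd M \<in> carrier_mat m m" using L M by (auto simp: pencil_carrier_def)
  show ?thesis unfolding pencil_sum_def
  proof (rule pencil_equivI[OF _ _ c])
    show "invertible_mat ?P" by (rule invertible_matI[OF c i2 i1])
    show "invertible_mat ?Q" by (rule invertible_matI[OF c(2,1) i1 i2])
  qed (use LM in \<open>auto simp only: intro!: four_block_diag_swap four_block_carrier_mat\<close>)
qed

section \<open>The Weierstrass form of a regular pencil\<close>

lemma jordan_block_affine:
  "p \<cdot>\<^sub>m 1\<^sub>m k + q \<cdot>\<^sub>m const_mat (jordan_block k \<nu>) = bidiagonal k (p + [:\<nu>:] * q) q"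
  by (rule eq_matI) (auto simp: bidiagonal_def jordan_block_def)

lemma jordan_matrix_affine:
  "p \<cdot>\<^sub>m 1\<^sub>m (sum_list (map fst bs)) + q \<cdot>\<^sub>m const_mat (jordan_matrix bs) =
     bidiagonal_blocks (map (\<lambda>(k, \<nu>). (k, p + [:\<nu>:] * q, q)) bs)"
proof (induct bs)
  case Nil
  show ?case by (rule eq_matI) (auto simp: bidiagonal_blocks_def jordan_matrix_def)
next
  case (Cons t bs)
  obtain k \<nu> where t: "t = (k, \<nu>)" by (cases t)
  let ?n = "sum_list (map fst bs)"
  let ?d = "\<lambda>A B. four_block_mat A (0\<^sub>m k ?n) (0\<^sub>m ?n k) B"
  have one: "1\<^sub>m (k + ?n) = ?d (1\<^sub>m k) (1\<^sub>m ?n)" by (rule four_block_one_mat[symmetric])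
  have J: "const_mat (jordan_matrix (t # bs)) =
      ?d (const_mat (jordan_block k \<nu>)) (const_mat (jordan_matrix bs))"
    unfolding t jordan_matrix_Cons
    by (subst map_four_block_mat[of _ k k _ ?n _ ?n]) auto
  have "p \<cdot>\<^sub>m 1\<^sub>m (k + ?n) + q \<cdot>\<^sub>m const_mat (jordan_matrix (t # bs)) =
    ?d (p \<cdot>\<^sub>m 1\<^sub>m k + q \<cdot>\<^sub>m const_mat (jordan_block k \<nu>))
       (p \<cdot>\<^sub>m 1\<^sub>m ?n + q \<cdot>\<^sub>m const_mat (jordan_matrix bs))"
    unfolding one J
    by (subst (1 2) smult_four_block_mat[of _ k k _ ?n _ ?n], simp_all,
        subst add_four_block_mat[of _ k k _ ?n _ ?n], auto)
  also have "\<dots> = bidiagonal_blocks (map (\<lambda>(k, \<nu>). (k, p + [:\<nu>:] * q, q)) (t # bs))"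
    unfolding jordan_block_affine Cons t
    by (simp add: bidiagonal_blocks_Cons o_def case_prod_unfold)
  finally show ?case using t by simp
qed

lemma similar_jordan_matrix:
  assumes M: "(M :: complex mat) \<in> carrier_mat k k"
  obtains fs P Q where "jordan_nf M fs" "sum_list (map fst fs) = k"
    "P \<in> carrier_mat k k" "Q \<in> carrier_mat k k" "invertible_mat P" "invertible_mat Q" "P * Q = 1\<^sub>m k"
    "P * M * Q = jordan_matrix fs"
proof -
  obtain as where "char_poly M = (\<Prod>a\<leftarrow>as. [:- a, 1:])" using char_poly_factorized[OF M] by blast
  then obtain fs where fs: "jordan_nf M fs" using jordan_nf_exists[OF M] by blast
  then obtain S T where "similar_mat_wit M (jordan_matrix fs) S T"
    unfolding jordan_nf_def similar_mat_def by blast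
  note w = similar_mat_witD2[OF M similar_mat_wit_sym[OF this, THEN similar_mat_wit_sym]]
  have k: "sum_list (map fst fs) = k" using w(5) jordan_matrix_dim(1)[of fs] by auto
  have "T * M * S = (T * S) * jordan_matrix fs * (T * S)"
    unfolding w(3) using w(4-) by (simp add: assoc_mult_mat[of _ k k _ k _ k])
  also have "\<dots> = jordan_matrix fs"
    by (simp only: w(2) left_mult_one_mat[OF w(5)] right_mult_one_mat[OF w(5)])
  finally have eq: "T * M * S = jordan_matrix fs" .
  show ?thesis
    by (rule that[OF fs k w(7,6) _ _ w(2) eq])
       (rule invertible_matI[OF w(7,6,1,2)], rule invertible_matI[OF w(6,7,2,1)])
qed

lemma mat_conj_one_minus:
  assumes "P \<in> carrier_mat n n" "Q \<in> carrier_mat n n" "X \<in> carrier_mat n n"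
  shows "P * (1\<^sub>m n - c \<cdot>\<^sub>m X) * Q = P * 1\<^sub>m n * Q - c \<cdot>\<^sub>m (P * X * Q :: complex mat)"
proof -
  have "P * (1\<^sub>m n - c \<cdot>\<^sub>m X) = P * 1\<^sub>m n - c \<cdot>\<^sub>m (P * X)"
    using assms by (subst mult_minus_distrib_mat[of _ n n]) (auto simp: mult_smult_distrib[of _ n n _ n])
  moreover have "(P * 1\<^sub>m n - c \<cdot>\<^sub>m (P * X)) * Q = P * 1\<^sub>m n * Q - c \<cdot>\<^sub>m (P * X) * Q"
    using assms by (subst minus_mult_distrib_mat[of _ n n]) auto
  moreover have "c \<cdot>\<^sub>m (P * X) * Q = c \<cdot>\<^sub>m (P * X * Q)"
    using assms by (intro mult_smult_assoc_mat[of _ n n]) auto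
  ultimately show ?thesis by simp
qed

text \<open>This form exists for every \<open>c\<close> that is not an eigenvalue, and it treats finite and infinite eigenvalues
alike: a block of \<open>J\<close> with eigenvalue \<open>\<nu>\<close> belongs to the eigenvalue \<open>c - 1 / \<nu>\<close>, and to infinity
if \<open>\<nu> = 0\<close>.\<close>

definition jordan_pencil_form :: "nat \<Rightarrow> pencil \<Rightarrow> complex \<Rightarrow> (nat \<times> complex) list \<Rightarrow> bool" where
  "jordan_pencil_form n L c bs \<longleftrightarrow> 0 \<notin> fst ` set bs \<and> sum_list (map fst bs) = n \<and>
     pencil_equiv n L (1\<^sub>m n - c \<cdot>\<^sub>m jordan_matrix bs, jordan_matrix bs)"

lemma jordan_pencil_form_exists:
  assumes L: "L \<in> pencil_carrier n" and reg: "regular_pencil L"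
  shows "\<exists>c bs. jordan_pencil_form n L c bs"
proof -
  obtain A B where AB: "L = (A, B)" "A \<in> carrier_mat n n" "B \<in> carrier_mat n n"
    using L by (auto simp: pencil_carrier_def)
  have "finite {c. poly (pencil_det L) c = 0}" using reg poly_roots_finite by (auto simp: regular_pencil_def)
  then obtain c where c: "poly (pencil_det L) c \<noteq> 0"
    using infinite_UNIV_char_0[where 'a=complex] by (metis (mono_tags) UNIV_I ex_new_if_finite mem_Collect_eq)
  define M where "M = A + c \<cdot>\<^sub>m B"
  have M: "M \<in> carrier_mat n n" using AB by (simp add: M_def)
  have "poly (pencil_det L) c = det M" unfolding pencil_det_eq
    by (rule poly_det_cong[OF M pencil_mat_carrier[OF L]]) (use AB in \<open>auto simp: pencil_mat_def M_def\<close>)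
  then have "invertible_mat M" using c by (intro invertible_mat_of_det[OF M]) simp
  then obtain Mi where Mi: "Mi \<in> carrier_mat n n" "Mi * M = 1\<^sub>m n" "M * Mi = 1\<^sub>m n"
    using inverse_matE[OF M] by metis
  have K: "Mi * B \<in> carrier_mat n n" using Mi AB by simp
  obtain bs P Q where J: "jordan_nf (Mi * B) bs" "sum_list (map fst bs) = n"
    "P \<in> carrier_mat n n" "Q \<in> carrier_mat n n" "invertible_mat P" "invertible_mat Q" "P * Q = 1\<^sub>m n"
    "P * (Mi * B) * Q = jordan_matrix bs" using similar_jordan_matrix[OF K] .
  have "A = M - c \<cdot>\<^sub>m B" using AB by (intro eq_matI) (auto simp: M_def)
  then have "Mi * A = 1\<^sub>m n - c \<cdot>\<^sub>m (Mi * B)"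
    using mult_minus_distrib_mat[OF Mi(1) M, of "c \<cdot>\<^sub>m B"] AB Mi by (simp add: mult_smult_distrib[of _ n n _ n])
  then have "P * (Mi * A) * Q = P * 1\<^sub>m n * Q - c \<cdot>\<^sub>m (P * (Mi * B) * Q)"
    using mat_conj_one_minus[OF J(3,4) K] by simp
  then have A': "P * (Mi * A) * Q = 1\<^sub>m n - c \<cdot>\<^sub>m jordan_matrix bs" using J by simp
  have "pencil_equiv n (A, B) (1\<^sub>m n - c \<cdot>\<^sub>m jordan_matrix bs, jordan_matrix bs)"
  proof (rule pencil_equivI[OF AB(2,3) mult_carrier_mat[OF J(3) Mi(1)] J(4)])
    have "invertible_mat Mi" using Mi M by (intro invertible_matI[of Mi n M])
    then show "invertible_mat (P * Mi)" by (intro invertible_mat_mult[of _ n] J Mi)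
    show "P * Mi * A * Q = 1\<^sub>m n - c \<cdot>\<^sub>m jordan_matrix bs"
      using A' J Mi AB by (simp add: assoc_mult_mat[of _ n n _ n _ n])
    show "P * Mi * B * Q = jordan_matrix bs"
      using J(3-8) Mi AB by (simp add: assoc_mult_mat[of _ n n _ n _ n])
  qed (rule J)
  with J(1,2) AB(1) show ?thesis unfolding jordan_pencil_form_def jordan_nf_def by blast
qed

definition weierstrass_pencil :: "(nat \<times> complex) list \<Rightarrow> nat list \<Rightarrow> pencil" where
  "weierstrass_pencil fs ks = pencil_sum (sum_list (map fst fs)) (sum_list ks)
     (- jordan_matrix fs, 1\<^sub>m (sum_list (map fst fs)))
     (- 1\<^sub>m (sum_list ks), jordan_matrix (map (\<lambda>k. (k, 0)) ks))"

lemma jordan_nilpotent_carrier[simp]: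
  "jordan_matrix (map (\<lambda>k. (k, 0)) ks) \<in> carrier_mat (sum_list ks) (sum_list ks)"
  using jordan_matrix_carrier[of "map (\<lambda>k. (k, 0)) ks"] by (simp add: o_def)

lemma weierstrass_pencil_eq:
  "weierstrass_pencil fs ks =
     (- diag_block_mat [jordan_matrix fs, 1\<^sub>m (sum_list ks)],
      diag_block_mat [1\<^sub>m (sum_list (map fst fs)), jordan_matrix (map (\<lambda>k. (k, 0)) ks)])"
proof -
  let ?l = "sum_list (map fst fs)" and ?m = "sum_list ks"
  have two: "diag_block_mat [X, Y] = four_block_mat X (0\<^sub>m ?l ?m) (0\<^sub>m ?m ?l) Y"
    if "X \<in> carrier_mat ?l ?l" "Y \<in> carrier_mat ?m ?m" for X Y :: "complex mat"
    using that diag_block_mat_Cons[of X ?l "[Y]" ?m] by (simp only: diag_block_mat_singleton)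
  have "- four_block_mat X (0\<^sub>m ?l ?m) (0\<^sub>m ?m ?l) Y = four_block_mat (- X) (0\<^sub>m ?l ?m) (0\<^sub>m ?m ?l) (- Y)"
    if "X \<in> carrier_mat ?l ?l" "Y \<in> carrier_mat ?m ?m" for X Y :: "complex mat"
    using that by (intro eq_matI) auto
  then show ?thesis unfolding weierstrass_pencil_def pencil_sum_def by (subst (1 2) two) auto
qed

lemma weierstrass_form_iff:
  "weierstrass_form L fs ks \<longleftrightarrow> 0 \<notin> fst ` set fs \<and> 0 \<notin> set ks \<and>
     (\<exists>n. pencil_equiv n L (weierstrass_pencil fs ks))"
  unfolding weierstrass_form_def pencil_equiv_def weierstrass_pencil_eq by auto

lemma jordan_matrix_append:
  "jordan_matrix (xs @ ys) = four_block_mat (jordan_matrix xs)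
     (0\<^sub>m (sum_list (map fst xs)) (sum_list (map fst ys)))
     (0\<^sub>m (sum_list (map fst ys)) (sum_list (map fst xs))) (jordan_matrix ys)"
  using jordan_matrix_dim[of xs] jordan_matrix_dim[of ys]
  unfolding jordan_matrix_def map_append diag_block_mat_append Let_def by simp

lemma pencil_sum_assoc:
  assumes "L \<in> pencil_carrier l" "M \<in> pencil_carrier m" "N \<in> pencil_carrier n"
  shows "pencil_sum l (m + n) L (pencil_sum m n M N) = pencil_sum (l + m) n (pencil_sum l m L M) N"
proof -
  have "four_block_mat A (0\<^sub>m l (m + n)) (0\<^sub>m (m + n) l) (four_block_mat B (0\<^sub>m m n) (0\<^sub>m n m) C) =
    four_block_mat (four_block_mat A (0\<^sub>m l m) (0\<^sub>m m l) B) (0\<^sub>m (l + m) n) (0\<^sub>m n (l + m)) C"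
    if "A \<in> carrier_mat l l" "B \<in> carrier_mat m m" "C \<in> carrier_mat n n" for A B C :: "complex mat"
    using assoc_four_block_mat[of A B C] that by simp
  with assms show ?thesis by (auto simp: pencil_sum_def pencil_carrier_def)
qed

lemma pencil_sum_carrier:
  "L \<in> pencil_carrier l \<Longrightarrow> M \<in> pencil_carrier m \<Longrightarrow> pencil_sum l m L M \<in> pencil_carrier (l + m)"
  by (auto simp: pencil_sum_def pencil_carrier_def)

lemma finite_part_sum:
  "pencil_sum (sum_list (map fst fs)) (sum_list (map fst gs))
     (- jordan_matrix fs, 1\<^sub>m (sum_list (map fst fs))) (- jordan_matrix gs, 1\<^sub>m (sum_list (map fst gs))) =
   (- jordan_matrix (fs @ gs), 1\<^sub>m (sum_list (map fst (fs @ gs))))"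
  unfolding pencil_sum_def jordan_matrix_append by (auto intro!: eq_matI)

lemma infinite_part_sum:
  "pencil_sum (sum_list ks) (sum_list ls) (- 1\<^sub>m (sum_list ks), jordan_matrix (map (\<lambda>k. (k, 0)) ks))
     (- 1\<^sub>m (sum_list ls), jordan_matrix (map (\<lambda>k. (k, 0)) ls)) =
   (- 1\<^sub>m (sum_list (ks @ ls)), jordan_matrix (map (\<lambda>k. (k, 0)) (ks @ ls)))"
  unfolding pencil_sum_def map_append jordan_matrix_append by (auto intro!: eq_matI simp: o_def)

text \<open>For \<open>\<nu> \<noteq> 0\<close> the block \<open>X\<close> is invertible, and \<open>I + (\<lambda> - c) X\<close> is strictly equivalent to
  \<open>\<lambda> I - (c I - X\<^sup>-\<^sup>1)\<close>.\<close>

lemma invertible_block_weierstrass: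
  assumes \<nu>: "\<nu> \<noteq> 0"
  shows "\<exists>fs. 0 \<notin> fst ` set fs \<and> sum_list (map fst fs) = k \<and>
    pencil_equiv k (1\<^sub>m k - c \<cdot>\<^sub>m jordan_block k \<nu>, jordan_block k \<nu>) (- jordan_matrix fs, 1\<^sub>m k)"
proof -
  let ?X = "jordan_block k \<nu>"
  have X: "?X \<in> carrier_mat k k" by simp
  have "det ?X = prod_list (diag_mat ?X)"
    by (rule det_upper_triangular[OF _ X]) (auto simp: jordan_block_def)
  then have "det ?X \<noteq> 0" using \<nu> by (auto simp: diag_mat_def prod_list_zero_iff)
  then obtain Xi where Xi: "Xi \<in> carrier_mat k k" "Xi * ?X = 1\<^sub>m k" "?X * Xi = 1\<^sub>m k"
    using inverse_matE[OF X invertible_mat_of_det[OF X]] by metis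
  let ?M = "c \<cdot>\<^sub>m 1\<^sub>m k - Xi"
  have M: "?M \<in> carrier_mat k k" by (rule minus_carrier_mat[OF Xi(1)])
  obtain fs P Q where J: "jordan_nf ?M fs" "sum_list (map fst fs) = k"
    "P \<in> carrier_mat k k" "Q \<in> carrier_mat k k" "invertible_mat P" "invertible_mat Q" "P * Q = 1\<^sub>m k"
    "P * ?M * Q = jordan_matrix fs" using similar_jordan_matrix[OF M] .
  have "Xi * (1\<^sub>m k - c \<cdot>\<^sub>m ?X) = - ?M"
    using Xi by (subst mult_minus_distrib_mat[of _ k k]) (auto simp: mult_smult_distrib[of _ k k _ k])
  then have "pencil_equiv k (1\<^sub>m k - c \<cdot>\<^sub>m ?X, ?X) (- ?M, 1\<^sub>m k)"
    using Xi M by (intro pencil_equivI[of _ _ _ Xi "1\<^sub>m k"] invertible_matI[of Xi k ?X]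
        invertible_matI[of "1\<^sub>m k" k "1\<^sub>m k"]) auto
  moreover have "pencil_equiv k (- ?M, 1\<^sub>m k) (- jordan_matrix fs, 1\<^sub>m k)"
  proof (rule pencil_equivI[OF _ _ J(3,4,5,6)])
    have "P * - ?M = - (P * ?M)" using J(3) M by (intro uminus_mult_right_mat) auto
    moreover have "- (P * ?M) * Q = - (P * ?M * Q)"
      using J(3,4) M by (intro uminus_mult_left_mat) auto
    ultimately show "P * - ?M * Q = - jordan_matrix fs" using J(8) by metis
  qed (use J(3,4,7) M in \<open>auto simp: right_mult_one_mat[OF J(3)]\<close>)
  ultimately show ?thesis using J pencil_equiv_trans unfolding jordan_nf_def by blast
qed

text \<open>For \<open>\<nu> = 0\<close> the matrix \<open>Y = I - c X\<close> is invertible, and the pencil is strictly equivalent to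
  \<open>\<lambda> M - I\<close> with \<open>M = - Y\<^sup>-\<^sup>1 X\<close>; an eigenvector of \<open>M\<close> is one of the nilpotent matrix \<open>X\<close>.\<close>

lemma nilpotent_block_weierstrass:
  "\<exists>ks. 0 \<notin> set ks \<and> sum_list ks = k \<and>
    pencil_equiv k (1\<^sub>m k - c \<cdot>\<^sub>m jordan_block k 0, jordan_block k 0)
      (- 1\<^sub>m k, jordan_matrix (map (\<lambda>k. (k, 0)) ks))"
proof -
  let ?X = "jordan_block k (0::complex)"
  let ?Y = "1\<^sub>m k - c \<cdot>\<^sub>m ?X"
  have X: "?X \<in> carrier_mat k k" and Y: "?Y \<in> carrier_mat k k" by (auto intro: minus_carrier_mat)
  have "det ?Y = prod_list (diag_mat ?Y)"
    by (rule det_upper_triangular[OF _ Y]) (auto simp: jordan_block_def)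
  also have "diag_mat ?Y = replicate k 1"
    by (rule nth_equalityI) (auto simp: diag_mat_def)
  finally have "det ?Y \<noteq> 0" by simp
  then obtain Yi where Yi: "Yi \<in> carrier_mat k k" "Yi * ?Y = 1\<^sub>m k" "?Y * Yi = 1\<^sub>m k"
    using inverse_matE[OF Y invertible_mat_of_det[OF Y]] by metis
  let ?M = "- Yi * ?X"
  have M: "?M \<in> carrier_mat k k" using Yi by simp
  obtain fs P Q where J: "jordan_nf ?M fs" "sum_list (map fst fs) = k"
    "P \<in> carrier_mat k k" "Q \<in> carrier_mat k k" "invertible_mat P" "invertible_mat Q" "P * Q = 1\<^sub>m k"
    "P * ?M * Q = jordan_matrix fs" using similar_jordan_matrix[OF M] .
  have zero: "a = 0" if ma: "(m, a) \<in> set fs" for m a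
  proof (rule ccontr)
    assume a: "a \<noteq> 0"
    have "m \<noteq> 0" using J(1) ma by (force simp: jordan_nf_def)
    then have "poly (char_poly ?M) a = 0"
      unfolding jordan_nf_char_poly[OF J(1)] poly_prod_list prod_list_zero_iff
      using ma by (force simp: image_iff)
    then obtain v where v: "v \<in> carrier_vec k" "v \<noteq> 0\<^sub>v k" "?M *\<^sub>v v = a \<cdot>\<^sub>v v"
      using eigenvalue_root_char_poly[OF M, of a] M unfolding eigenvalue_def eigenvector_def by auto
    have Xvc: "?X *\<^sub>v v \<in> carrier_vec k" by (rule mult_mat_vec_carrier[OF X v(1)])
    have w: "Yi *\<^sub>v (?X *\<^sub>v v) \<in> carrier_vec k" by (rule mult_mat_vec_carrier[OF Yi(1) Xvc])
    have "?M *\<^sub>v v = - (Yi *\<^sub>v (?X *\<^sub>v v))"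
      using Yi(1) X v(1) by (simp add: assoc_mult_mat_vec[of _ k k _ k])
    moreover have "?Y *\<^sub>v (- (Yi *\<^sub>v (?X *\<^sub>v v))) = - (?Y *\<^sub>v (Yi *\<^sub>v (?X *\<^sub>v v)))"
      using Y w Yi(1) by (intro eq_vecI) auto
    moreover have "?Y *\<^sub>v (Yi *\<^sub>v (?X *\<^sub>v v)) = ?X *\<^sub>v v"
      using assoc_mult_mat_vec[OF Y Yi(1) Xvc] one_mult_mat_vec[OF Xvc] Yi(3) by simp
    ultimately have "?X *\<^sub>v v = - (?Y *\<^sub>v (?M *\<^sub>v v))" by simp
    also have "\<dots> = - (?Y *\<^sub>v (a \<cdot>\<^sub>v v))" by (simp add: v(3))
    also have "\<dots> = (- a) \<cdot>\<^sub>v v + (a * c) \<cdot>\<^sub>v (?X *\<^sub>v v)"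
      using v(1) X by (intro eq_vecI) (auto simp: minus_mult_distrib_mat_vec[of _ k k] algebra_simps)
    finally have Xv: "?X *\<^sub>v v = (- a) \<cdot>\<^sub>v v + (a * c) \<cdot>\<^sub>v (?X *\<^sub>v v)" .
    have comp: "(1 - a * c) * (?X *\<^sub>v v) $ i = - a * v $ i" if "i < k" for i
      using arg_cong[OF Xv, of "\<lambda>w. w $ i"] that v(1) by (simp add: algebra_simps)
    obtain i where i: "i < k" "v $ i \<noteq> 0" using v(1,2) by (metis carrier_vecD eq_vecI index_zero_vec)
    have ac: "1 - a * c \<noteq> 0" using comp[OF i(1)] i a by auto
    have "?X *\<^sub>v v = (- a / (1 - a * c)) \<cdot>\<^sub>v v"
      using comp ac v(1) by (intro eq_vecI) (auto simp: field_simps)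
    then have "eigenvalue ?X (- a / (1 - a * c))" unfolding eigenvalue_def eigenvector_def
      using v X by auto
    then have "poly (char_poly ?X) (- a / (1 - a * c)) = 0" using eigenvalue_root_char_poly[OF X] by simp
    then show False using a ac by (auto simp: jordan_block_char_poly)
  qed
  define ks where "ks = map fst fs"
  have fs: "fs = map (\<lambda>k. (k, 0)) ks"
    unfolding ks_def map_map by (rule map_idI[symmetric]) (auto dest: zero)
  have "- Yi * ?Y = - 1\<^sub>m k" using Yi Y by simp
  then have "pencil_equiv k (?Y, ?X) (- 1\<^sub>m k, ?M)"
    using Yi M by (intro pencil_equivI[of _ _ _ "- Yi" "1\<^sub>m k"] invertible_matI[of "- Yi" k "- ?Y"]
        invertible_matI[of "1\<^sub>m k" k "1\<^sub>m k"]) auto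
  moreover have "pencil_equiv k (- 1\<^sub>m k, ?M) (- 1\<^sub>m k, jordan_matrix fs)"
    using J M by (intro pencil_equivI[of _ _ _ P Q]) auto
  ultimately have "pencil_equiv k (?Y, ?X) (- 1\<^sub>m k, jordan_matrix fs)" by (rule pencil_equiv_trans)
  then show ?thesis using J(1,2) unfolding jordan_nf_def fs
    by (intro exI[of _ ks]) (auto simp: o_def image_iff)
qed

text \<open>Each block of the Jordan matrix is brought into Weierstrass form on its own, and the infinite part of a new block is moved
past the finite parts of the others.\<close>

lemma jordan_pencil_weierstrass:
  assumes "0 \<notin> fst ` set bs"
  shows "\<exists>fs ks. 0 \<notin> fst ` set fs \<and> 0 \<notin> set ks \<and>
    sum_list (map fst bs) = sum_list (map fst fs) + sum_list ks \<and>
    pencil_equiv (sum_list (map fst bs))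
      (1\<^sub>m (sum_list (map fst bs)) - c \<cdot>\<^sub>m jordan_matrix bs, jordan_matrix bs) (weierstrass_pencil fs ks)"
  using assms
proof (induct bs)
  case Nil
  have "pencil_equiv 0 (1\<^sub>m 0 - c \<cdot>\<^sub>m jordan_matrix [], jordan_matrix []) (weierstrass_pencil [] [])"
    unfolding weierstrass_pencil_def pencil_sum_def
    by (auto intro!: pencil_equivI[of _ _ _ "1\<^sub>m 0" "1\<^sub>m 0"] eq_matI invertible_matI[of "1\<^sub>m 0" 0 "1\<^sub>m 0"]
        simp: jordan_matrix_def)
  then show ?case by (intro exI[of _ "[]"]) auto
next
  case (Cons t bs)
  obtain k \<nu> where t: "t = (k, \<nu>)" by (cases t)
  let ?n = "sum_list (map fst bs)"
  from Cons obtain fs ks where IH: "0 \<notin> fst ` set fs" "0 \<notin> set ks"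
    "?n = sum_list (map fst fs) + sum_list ks"
    "pencil_equiv ?n (1\<^sub>m ?n - c \<cdot>\<^sub>m jordan_matrix bs, jordan_matrix bs) (weierstrass_pencil fs ks)" by auto
  let ?l = "sum_list (map fst fs)" and ?m = "sum_list ks"
  let ?F = "(- jordan_matrix fs, 1\<^sub>m ?l)" and ?K = "(- 1\<^sub>m ?m, jordan_matrix (map (\<lambda>k. (k, 0)) ks))"
  have FK: "?F \<in> pencil_carrier ?l" "?K \<in> pencil_carrier ?m" by (auto simp: pencil_carrier_def)
  have W: "weierstrass_pencil fs ks = pencil_sum ?l ?m ?F ?K" by (simp add: weierstrass_pencil_def)
  let ?T = "(1\<^sub>m k - c \<cdot>\<^sub>m jordan_block k \<nu>, jordan_block k \<nu>)"
  have split: "(1\<^sub>m (k + ?n) - c \<cdot>\<^sub>m jordan_matrix (t # bs), jordan_matrix (t # bs)) =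
      pencil_sum k ?n ?T (1\<^sub>m ?n - c \<cdot>\<^sub>m jordan_matrix bs, jordan_matrix bs)"
    unfolding pencil_sum_def t jordan_matrix_Cons by (auto intro!: eq_matI)
  show ?case
  proof (cases "\<nu> = 0")
    case False
    then obtain gs where gs: "0 \<notin> fst ` set gs" "sum_list (map fst gs) = k"
      "pencil_equiv k ?T (- jordan_matrix gs, 1\<^sub>m k)" using invertible_block_weierstrass by blast
    have G: "(- jordan_matrix gs, 1\<^sub>m k) \<in> pencil_carrier k" using gs by (auto simp: pencil_carrier_def)
    have "pencil_equiv (k + ?n) (1\<^sub>m (k + ?n) - c \<cdot>\<^sub>m jordan_matrix (t # bs), jordan_matrix (t # bs))
        (pencil_sum k ?n (- jordan_matrix gs, 1\<^sub>m k) (pencil_sum ?l ?m ?F ?K))"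
      unfolding split using pencil_equiv_sum[OF gs(3) IH(4)] by (simp only: W)
    also have "pencil_sum k ?n (- jordan_matrix gs, 1\<^sub>m k) (pencil_sum ?l ?m ?F ?K) =
        pencil_sum (k + ?l) ?m (pencil_sum k ?l (- jordan_matrix gs, 1\<^sub>m k) ?F) ?K"
      unfolding IH(3) by (rule pencil_sum_assoc[OF G FK])
    also have "\<dots> = weierstrass_pencil (gs @ fs) ks"
      using finite_part_sum[of gs fs] gs(2) by (simp add: weierstrass_pencil_def)
    finally show ?thesis using IH gs t by (intro exI[of _ "gs @ fs"] exI[of _ ks]) auto
  next
    case True
    then obtain ls where ls: "0 \<notin> set ls" "sum_list ls = k"
      "pencil_equiv k ?T (- 1\<^sub>m k, jordan_matrix (map (\<lambda>k. (k, 0)) ls))"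
      using nilpotent_block_weierstrass[of k c] by blast
    let ?S = "(- 1\<^sub>m k, jordan_matrix (map (\<lambda>k. (k, 0)) ls))"
    have S: "?S \<in> pencil_carrier k" using ls(2) jordan_nilpotent_carrier[of ls]
      by (simp add: pencil_carrier_def)
    have FKc: "pencil_sum ?l ?m ?F ?K \<in> pencil_carrier ?n"
      unfolding IH(3) by (rule pencil_sum_carrier[OF FK])
    have "pencil_equiv (k + ?n) (1\<^sub>m (k + ?n) - c \<cdot>\<^sub>m jordan_matrix (t # bs), jordan_matrix (t # bs))
        (pencil_sum k ?n ?S (pencil_sum ?l ?m ?F ?K))"
      unfolding split using pencil_equiv_sum[OF ls(3) IH(4)] by (simp only: W)
    from pencil_equiv_trans[OF this pencil_equiv_swap[OF S FKc]]
    have "pencil_equiv (k + ?n) (1\<^sub>m (k + ?n) - c \<cdot>\<^sub>m jordan_matrix (t # bs), jordan_matrix (t # bs))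
        (pencil_sum ?n k (pencil_sum ?l ?m ?F ?K) ?S)" .
    also have "pencil_sum ?n k (pencil_sum ?l ?m ?F ?K) ?S =
        pencil_sum ?l (?m + k) ?F (pencil_sum ?m k ?K ?S)"
      unfolding IH(3) by (rule pencil_sum_assoc[OF FK S, symmetric])
    also have "\<dots> = weierstrass_pencil fs (ks @ ls)"
      using infinite_part_sum[of ks ls] ls(2) by (simp add: weierstrass_pencil_def)
    finally show ?thesis using IH ls t by (intro exI[of _ fs] exI[of _ "ks @ ls"]) auto
  qed
qed

lemma weierstrass_form_exists:
  assumes "L \<in> pencil_carrier n" "regular_pencil L"
  shows "\<exists>fs ks. weierstrass_form L fs ks"
proof -
  obtain c bs where "jordan_pencil_form n L c bs" using jordan_pencil_form_exists[OF assms] by blast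
  then have L: "0 \<notin> fst ` set bs" "sum_list (map fst bs) = n"
    "pencil_equiv n L (1\<^sub>m n - c \<cdot>\<^sub>m jordan_matrix bs, jordan_matrix bs)"
    by (auto simp: jordan_pencil_form_def)
  with jordan_pencil_weierstrass[OF L(1), of c] show ?thesis
    unfolding weierstrass_form_iff using pencil_equiv_trans[OF L(3)] by blast
qed

section \<open>Partial multiplicities in terms of root vectors\<close>

lemma det_const_mat: "det (const_mat A) = [:det A:]"
proof -
  interpret comm_ring_hom "\<lambda>a::complex. [:a:]" by unfold_locales auto
  show ?thesis by (rule hom_det)
qed

lemma det_bidiagonal: "det (bidiagonal m a b :: complex poly mat) = a ^ m"
proof -
  have "det (bidiagonal m a b) = prod_list (diag_mat (bidiagonal m a b))"
    by (rule det_upper_triangular[of _ m]) (auto simp: bidiagonal_def)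
  also have "diag_mat (bidiagonal m a b) = replicate m a"
    by (rule nth_equalityI) (auto simp: diag_mat_def bidiagonal_def)
  finally show ?thesis by simp
qed

lemma det_bidiagonal_blocks:
  "det (bidiagonal_blocks bs :: complex poly mat) = (\<Prod>(m, a, b)\<leftarrow>bs. a ^ m)"
proof (induct bs)
  case Nil
  show ?case by (simp add: bidiagonal_blocks_def)
next
  case (Cons t bs)
  obtain m a b where t: "t = (m, a, b)" by (cases t)
  show ?case unfolding t bidiagonal_blocks_Cons
    by (subst det_four_block_mat_upper_right_zero[OF bidiagonal_carrier refl _ bidiagonal_blocks_carrier])
       (auto simp: Cons det_bidiagonal)
qed

lemma pencil_rev_carrier: "L \<in> pencil_carrier n \<Longrightarrow> pencil_rev L \<in> pencil_carrier n"
  by (auto simp: pencil_rev_def pencil_carrier_def)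

text \<open>With \<open>J\<close> the Jordan matrix, \<open>L\<close> is strictly equivalent to \<open>I + (\<lambda> - c) J\<close> and its reversal to
  \<open>\<lambda> I + (1 - c \<lambda>) J\<close>.\<close>

lemma jordan_pencil_form_blocks:
  assumes "jordan_pencil_form n L c bs"
  obtains P Q where "P \<in> carrier_mat n n" "invertible_mat P" "Q \<in> carrier_mat n n" "invertible_mat Q"
    "const_mat P * pencil_mat L * const_mat Q =
       bidiagonal_blocks (map (\<lambda>(k, \<nu>). (k, [:1 - c * \<nu>, \<nu>:], [:-c, 1:])) bs)"
    "const_mat P * pencil_mat (pencil_rev L) * const_mat Q =
       bidiagonal_blocks (map (\<lambda>(k, \<nu>). (k, [:\<nu>, 1 - c * \<nu>:], [:1, -c:])) bs)"
proof -
  let ?J = "jordan_matrix bs"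
  from assms have n: "sum_list (map fst bs) = n" and L: "L \<in> pencil_carrier n"
    unfolding jordan_pencil_form_def pencil_equiv_def by auto
  from assms obtain P Q where PQ: "P \<in> carrier_mat n n" "invertible_mat P" "Q \<in> carrier_mat n n"
    "invertible_mat Q" "P * fst L * Q = 1\<^sub>m n - c \<cdot>\<^sub>m ?J" "P * snd L * Q = ?J"
    unfolding jordan_pencil_form_def pencil_equiv_def by auto
  have J: "?J \<in> carrier_mat n n" using n by auto
  have "const_mat P * pencil_mat L * const_mat Q = pencil_mat (1\<^sub>m n - c \<cdot>\<^sub>m ?J, ?J)"
    using PQ by (intro pencil_mat_equiv[OF L]) auto
  also have "\<dots> = 1 \<cdot>\<^sub>m 1\<^sub>m n + [:-c, 1:] \<cdot>\<^sub>m const_mat ?J"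
    unfolding pencil_mat_def using J by (intro eq_matI) (auto simp: one_pCons)
  also have "\<dots> = bidiagonal_blocks (map (\<lambda>(k, \<nu>). (k, 1 + [:\<nu>:] * [:-c, 1:], [:-c, 1:])) bs)"
    using jordan_matrix_affine[of 1 bs "[:-c, 1:]"] n by simp
  also have "(\<lambda>(k::nat, \<nu>). (k, 1 + [:\<nu>:] * [:-c, 1:], [:-c, 1:])) =
      (\<lambda>(k, \<nu>). (k, [:1 - c * \<nu>, \<nu>:], [:-c, 1:]))"
    by (auto simp: one_pCons algebra_simps)
  finally have 1: "const_mat P * pencil_mat L * const_mat Q =
       bidiagonal_blocks (map (\<lambda>(k, \<nu>). (k, [:1 - c * \<nu>, \<nu>:], [:-c, 1:])) bs)" .
  have "const_mat P * pencil_mat (pencil_rev L) * const_mat Q = pencil_mat (?J, 1\<^sub>m n - c \<cdot>\<^sub>m ?J)"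
    using PQ by (intro pencil_mat_equiv[OF pencil_rev_carrier[OF L]]) (auto simp: pencil_rev_def)
  also have "\<dots> = [:0, 1:] \<cdot>\<^sub>m 1\<^sub>m n + [:1, -c:] \<cdot>\<^sub>m const_mat ?J"
    unfolding pencil_mat_def using J by (intro eq_matI) (auto simp: one_pCons)
  also have "\<dots> = bidiagonal_blocks (map (\<lambda>(k, \<nu>). (k, [:0, 1:] + [:\<nu>:] * [:1, -c:], [:1, -c:])) bs)"
    using jordan_matrix_affine[of "[:0, 1:]" bs "[:1, -c:]"] n by simp
  also have "(\<lambda>(k::nat, \<nu>). (k, [:0, 1:] + [:\<nu>:] * [:1, -c:], [:1, -c:])) =
      (\<lambda>(k, \<nu>). (k, [:\<nu>, 1 - c * \<nu>:], [:1, -c:]))"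
    by (auto simp: one_pCons algebra_simps)
  finally show ?thesis by (rule that[OF PQ(1-4) 1])
qed

lemma det_of_blocks:
  assumes W: "W \<in> carrier_mat n n" and P: "P \<in> carrier_mat n n" "invertible_mat P"
    and Q: "Q \<in> carrier_mat n n" "invertible_mat Q"
    and eq: "const_mat P * W * const_mat Q = bidiagonal_blocks bs"
  shows "\<exists>d. d \<noteq> 0 \<and> det W = Polynomial.smult d (\<Prod>(m, a, b)\<leftarrow>bs. a ^ m)"
proof -
  let ?d = "det P * det Q"
  have d: "?d \<noteq> 0" using invertible_mat_det_nonzero P Q by auto
  have "det (const_mat P * W * const_mat Q) = det (const_mat P) * det W * det (const_mat Q)"
    using W P Q by (simp add: det_mult[of _ n])
  then have "Polynomial.smult ?d (det W) = (\<Prod>(m, a, b)\<leftarrow>bs. a ^ m)"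
    unfolding eq det_bidiagonal_blocks det_const_mat by (simp add: mult.commute)
  then have "det W = Polynomial.smult (inverse ?d) (\<Prod>(m, a, b)\<leftarrow>bs. a ^ m)"
    using d by (metis left_inverse smult_1_left smult_smult)
  with d show ?thesis by (metis inverse_nonzero_iff_nonzero)
qed

lemma jordan_pencil_form_det:
  assumes "jordan_pencil_form n L c bs"
  shows "\<exists>d. d \<noteq> 0 \<and> pencil_det L = Polynomial.smult d (\<Prod>(k, \<nu>)\<leftarrow>bs. [:1 - c * \<nu>, \<nu>:] ^ k)"
    and "\<exists>d. d \<noteq> 0 \<and> pencil_det (pencil_rev L) =
      Polynomial.smult d (\<Prod>(k, \<nu>)\<leftarrow>bs. [:\<nu>, 1 - c * \<nu>:] ^ k)"
proof -
  have L: "L \<in> pencil_carrier n" using assms by (simp add: jordan_pencil_form_def pencil_equiv_def)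
  obtain P Q where *: "P \<in> carrier_mat n n" "invertible_mat P" "Q \<in> carrier_mat n n" "invertible_mat Q"
    "const_mat P * pencil_mat L * const_mat Q =
       bidiagonal_blocks (map (\<lambda>(k, \<nu>). (k, [:1 - c * \<nu>, \<nu>:], [:-c, 1:])) bs)"
    "const_mat P * pencil_mat (pencil_rev L) * const_mat Q =
       bidiagonal_blocks (map (\<lambda>(k, \<nu>). (k, [:\<nu>, 1 - c * \<nu>:], [:1, -c:])) bs)"
    using jordan_pencil_form_blocks[OF assms] .
  show "\<exists>d. d \<noteq> 0 \<and> pencil_det L = Polynomial.smult d (\<Prod>(k, \<nu>)\<leftarrow>bs. [:1 - c * \<nu>, \<nu>:] ^ k)"
    using det_of_blocks[OF pencil_mat_carrier[OF L] *(1-5)]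
    by (simp add: pencil_det_eq o_def case_prod_unfold)
  show "\<exists>d. d \<noteq> 0 \<and> pencil_det (pencil_rev L) =
      Polynomial.smult d (\<Prod>(k, \<nu>)\<leftarrow>bs. [:\<nu>, 1 - c * \<nu>:] ^ k)"
    using det_of_blocks[OF pencil_mat_carrier[OF pencil_rev_carrier[OF L]] *(1-4) *(6)]
    by (simp add: pencil_det_eq o_def case_prod_unfold)
qed

lemma linear_power_list_nonzero:
  "(\<And>k \<nu>. (k, \<nu>) \<in> set bs \<Longrightarrow> f \<nu> \<noteq> (0 :: complex poly)) \<Longrightarrow> (\<Prod>(k, \<nu>)\<leftarrow>bs. f \<nu> ^ k) \<noteq> 0"
  by (auto simp: prod_list_zero_iff)

lemma jordan_pencil_form_regular:
  assumes "jordan_pencil_form n L c bs"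
  shows "regular_pencil L" "regular_pencil (pencil_rev L)"
proof -
  have "[:1 - c * \<nu>, \<nu>:] \<noteq> 0" "[:\<nu>, 1 - c * \<nu>:] \<noteq> 0" for \<nu> by auto
  then have "(\<Prod>(k, \<nu>)\<leftarrow>bs. [:1 - c * \<nu>, \<nu>:] ^ k) \<noteq> 0" "(\<Prod>(k, \<nu>)\<leftarrow>bs. [:\<nu>, 1 - c * \<nu>:] ^ k) \<noteq> 0"
    by (intro linear_power_list_nonzero; blast)+
  with jordan_pencil_form_det[OF assms] show "regular_pencil L" "regular_pencil (pencil_rev L)"
    unfolding regular_pencil_def by auto
qed

lemma jordan_pencil_form_root_rank:
  assumes "jordan_pencil_form n L c bs" and k: "k > 0"
  shows "max_root_rank (pencil_mat L) n \<mu> k (count_ge k (block_sizes (\<lambda>\<nu>. 1 + (\<mu> - c) * \<nu> = 0) bs))"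
    and "max_root_rank (pencil_mat (pencil_rev L)) n 0 k (count_ge k (block_sizes (\<lambda>\<nu>. \<nu> = 0) bs))"
proof -
  have L: "L \<in> pencil_carrier n" and pos: "0 \<notin> fst ` set bs"
    using assms by (auto simp: jordan_pencil_form_def pencil_equiv_def)
  obtain P Q where *: "P \<in> carrier_mat n n" "invertible_mat P" "Q \<in> carrier_mat n n" "invertible_mat Q"
    "const_mat P * pencil_mat L * const_mat Q =
       bidiagonal_blocks (map (\<lambda>(k, \<nu>). (k, [:1 - c * \<nu>, \<nu>:], [:-c, 1:])) bs)"
    "const_mat P * pencil_mat (pencil_rev L) * const_mat Q =
       bidiagonal_blocks (map (\<lambda>(k, \<nu>). (k, [:\<nu>, 1 - c * \<nu>:], [:1, -c:])) bs)"
    using jordan_pencil_form_blocks[OF assms(1)] .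
  have pos': "m > 0" if "(m, \<nu>) \<in> set bs" for m \<nu> using pos that by force
  have s1: "simple_block_at \<mu> (m, [:1 - c * \<nu>, \<nu>:], [:-c, 1:])" if "(m, \<nu>) \<in> set bs" for m \<nu>
  proof -
    have "poly [:-c, 1:] \<mu> \<noteq> 0 \<and> (\<exists>a'. [:1 - c * \<nu>, \<nu>:] = [:-\<mu>, 1:] * a' \<and> poly a' \<mu> \<noteq> 0)"
      if "poly [:1 - c * \<nu>, \<nu>:] \<mu> = 0"
    proof -
      have z: "1 - c * \<nu> + \<mu> * \<nu> = 0" using that by simp
      have "1 + (\<mu> - c) * \<nu> = 0" using z by (simp add: algebra_simps)
      then have "\<mu> - c \<noteq> 0" "\<nu> \<noteq> 0" by auto
      moreover have "1 - c * \<nu> = - (\<mu> * \<nu>)" by (rule eq_neg_iff_add_eq_0[THEN iffD2, OF z])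
      ultimately show ?thesis by (intro conjI exI[of _ "[:\<nu>:]"]) auto
    qed
    then show ?thesis using pos'[OF that] unfolding simple_block_at_def by blast
  qed
  have s2: "simple_block_at 0 (m, [:\<nu>, 1 - c * \<nu>:], [:1, -c:])" if "(m, \<nu>) \<in> set bs" for m \<nu>
    using pos'[OF that] unfolding simple_block_at_def by (auto intro!: exI[of _ 1] simp: one_pCons)
  have "max_root_rank (pencil_mat L) n \<mu> k (length (filter (\<lambda>(m, a, b). poly a \<mu> = 0 \<and> k \<le> m)
      (map (\<lambda>(k, \<nu>). (k, [:1 - c * \<nu>, \<nu>:], [:-c, 1:])) bs)))"
    using s1 by (intro max_root_rank_bidiagonal_blocks[OF pencil_mat_carrier[OF L] *(1-5) k]) auto
  moreover have "length (filter (\<lambda>(m, a, b). poly a \<mu> = 0 \<and> k \<le> m)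
      (map (\<lambda>(k, \<nu>). (k, [:1 - c * \<nu>, \<nu>:], [:-c, 1:])) bs)) =
      count_ge k (block_sizes (\<lambda>\<nu>. 1 + (\<mu> - c) * \<nu> = 0) bs)"
    unfolding count_ge_block_sizes by (induct bs) (auto simp: algebra_simps)
  ultimately show "max_root_rank (pencil_mat L) n \<mu> k
      (count_ge k (block_sizes (\<lambda>\<nu>. 1 + (\<mu> - c) * \<nu> = 0) bs))" by simp
  have "max_root_rank (pencil_mat (pencil_rev L)) n 0 k (length (filter (\<lambda>(m, a, b). poly a 0 = 0 \<and> k \<le> m)
      (map (\<lambda>(k, \<nu>). (k, [:\<nu>, 1 - c * \<nu>:], [:1, -c:])) bs)))"
    using s2 by (intro max_root_rank_bidiagonal_blocks
        [OF pencil_mat_carrier[OF pencil_rev_carrier[OF L]] *(1-4) *(6) k]) auto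
  moreover have "length (filter (\<lambda>(m, a, b). poly a 0 = 0 \<and> k \<le> m)
      (map (\<lambda>(k, \<nu>). (k, [:\<nu>, 1 - c * \<nu>:], [:1, -c:])) bs)) =
      count_ge k (block_sizes (\<lambda>\<nu>. \<nu> = 0) bs)"
    unfolding count_ge_block_sizes by (induct bs) auto
  ultimately show "max_root_rank (pencil_mat (pencil_rev L)) n 0 k
      (count_ge k (block_sizes (\<lambda>\<nu>. \<nu> = 0) bs))" by simp
qed

lemma pencil_mat_sum:
  assumes "L \<in> pencil_carrier l" "M \<in> pencil_carrier m"
  shows "pencil_mat (pencil_sum l m L M) =
    four_block_mat (pencil_mat L) (0\<^sub>m l m) (0\<^sub>m m l) (pencil_mat M)"
  using assms unfolding pencil_carrier_def pencil_mat_def pencil_sum_def by (intro eq_matI) auto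

lemma weierstrass_pencil_mat:
  "pencil_mat (weierstrass_pencil fs ks) = bidiagonal_blocks
     (map (\<lambda>(k, \<nu>). (k, [:-\<nu>, 1:], -1)) fs @ map (\<lambda>k. (k, -1, [:0, 1:])) ks)"
proof -
  let ?l = "sum_list (map fst fs)" and ?m = "sum_list ks"
  let ?N = "jordan_matrix (map (\<lambda>k. (k, 0)) ks) :: complex mat"
  have "pencil_mat (weierstrass_pencil fs ks) =
    four_block_mat (pencil_mat (- jordan_matrix fs, 1\<^sub>m ?l)) (0\<^sub>m ?l ?m) (0\<^sub>m ?m ?l)
      (pencil_mat (- 1\<^sub>m ?m, ?N))"
    unfolding weierstrass_pencil_def by (rule pencil_mat_sum) (auto simp: pencil_carrier_def)
  also have "pencil_mat (- jordan_matrix fs, 1\<^sub>m ?l) =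
      [:0, 1:] \<cdot>\<^sub>m 1\<^sub>m ?l + (-1) \<cdot>\<^sub>m const_mat (jordan_matrix fs)"
    unfolding pencil_mat_def by (rule eq_matI) (auto simp: one_pCons)
  also have "pencil_mat (- 1\<^sub>m ?m, ?N) = (-1) \<cdot>\<^sub>m 1\<^sub>m ?m + [:0, 1:] \<cdot>\<^sub>m const_mat ?N"
  proof -
    have "pencil_mat (- 1\<^sub>m m, X) = (-1) \<cdot>\<^sub>m 1\<^sub>m m + [:0, 1:] \<cdot>\<^sub>m const_mat X"
      if "X \<in> carrier_mat m m" for X m
      unfolding pencil_mat_def using that by (intro eq_matI) (auto simp: one_pCons)
    then show ?thesis by simp
  qed
  also have "[:0, 1:] \<cdot>\<^sub>m 1\<^sub>m ?l + (-1) \<cdot>\<^sub>m const_mat (jordan_matrix fs) =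
      bidiagonal_blocks (map (\<lambda>(k, \<nu>). (k, [:-\<nu>, 1:], -1)) fs)"
    unfolding jordan_matrix_affine by (intro arg_cong[of _ _ bidiagonal_blocks] map_cong) auto
  also have "(-1) \<cdot>\<^sub>m 1\<^sub>m ?m + [:0, 1:] \<cdot>\<^sub>m const_mat ?N =
      bidiagonal_blocks (map (\<lambda>k. (k, -1, [:0, 1:])) ks)"
    using jordan_matrix_affine[of "-1" "map (\<lambda>k. (k, 0)) ks" "[:0, 1:]"] by (simp add: o_def)
  also have "four_block_mat (bidiagonal_blocks (map (\<lambda>(k, \<nu>). (k, [:-\<nu>, 1:], -1)) fs))
      (0\<^sub>m ?l ?m) (0\<^sub>m ?m ?l) (bidiagonal_blocks (map (\<lambda>k. (k, -1, [:0, 1:])) ks)) =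
      bidiagonal_blocks (map (\<lambda>(k, \<nu>). (k, [:-\<nu>, 1:], -1)) fs @ map (\<lambda>k. (k, -1, [:0, 1:])) ks)"
    (is "four_block_mat ?X _ _ ?Y = _")
  proof -
    have "?X \<in> carrier_mat ?l ?l" "?Y \<in> carrier_mat ?m ?m"
      using bidiagonal_blocks_carrier[of "map (\<lambda>(k, \<nu>). (k, [:-\<nu>, 1:], -1)) fs"]
        bidiagonal_blocks_carrier[of "map (\<lambda>k. (k, -1::complex poly, [:0, 1:])) ks"]
      by (simp_all add: o_def case_prod_unfold)
    then show ?thesis unfolding bidiagonal_blocks_def map_append diag_block_mat_append Let_def by simp
  qed
  finally show ?thesis .
qed

lemma weierstrass_form_root_rank:
  assumes w: "weierstrass_form L fs ks" and L: "L \<in> pencil_carrier n" and k: "k > 0"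
  shows "max_root_rank (pencil_mat L) n \<mu> k (count_ge k (block_sizes (\<lambda>\<nu>. \<nu> = \<mu>) fs))"
proof -
  let ?bs = "map (\<lambda>(k, \<nu>). (k, [:-\<nu>, 1:], -1 :: complex poly)) fs @ map (\<lambda>k. (k, -1, [:0, 1:] :: complex poly)) ks"
  have pos: "0 \<notin> fst ` set fs" "0 \<notin> set ks" using w by (simp_all add: weierstrass_form_iff)
  obtain n' P Q where L': "L \<in> pencil_carrier n'" and PQ: "P \<in> carrier_mat n' n'" "Q \<in> carrier_mat n' n'"
    "invertible_mat P" "invertible_mat Q" "P * fst L * Q = fst (weierstrass_pencil fs ks)"
    "P * snd L * Q = snd (weierstrass_pencil fs ks)"
    using w unfolding weierstrass_form_iff pencil_equiv_def by blast
  have "n' = n" using L L' by (auto simp: pencil_carrier_def)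
  note PQ = PQ[unfolded this]
  have eq: "const_mat P * pencil_mat L * const_mat Q = bidiagonal_blocks ?bs"
    using pencil_mat_equiv[OF L PQ(1,2,5,6)] by (simp only: weierstrass_pencil_mat)
  have pos': "m > 0" if "(m, \<nu>) \<in> set fs" for m \<nu> using pos that by force
  have "\<forall>b\<in>set ?bs. simple_block_at \<mu> b"
    using pos' pos(2) unfolding simple_block_at_def by (auto intro!: exI[of _ 1] Nat.gr0I)
  then have "max_root_rank (pencil_mat L) n \<mu> k
      (length (filter (\<lambda>(m, a, b). poly a \<mu> = 0 \<and> k \<le> m) ?bs))"
    by (rule max_root_rank_bidiagonal_blocks[OF pencil_mat_carrier[OF L] PQ(1,3,2,4) eq k])
  moreover have "length (filter (\<lambda>(m, a, b). poly a \<mu> = 0 \<and> k \<le> m) ?bs) =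
      count_ge k (block_sizes (\<lambda>\<nu>. \<nu> = \<mu>) fs)"
  proof -
    have "length (filter (\<lambda>(m, a, b). poly a \<mu> = 0 \<and> k \<le> m) (map (\<lambda>k. (k, -1, [:0, 1:] :: complex poly)) ks)) = 0"
      by (induct ks) auto
    moreover have "length (filter (\<lambda>(m, a, b). poly a \<mu> = 0 \<and> k \<le> m)
        (map (\<lambda>(k, \<nu>). (k, [:-\<nu>, 1:], -1 :: complex poly)) fs)) = count_ge k (block_sizes (\<lambda>\<nu>. \<nu> = \<mu>) fs)"
      unfolding count_ge_block_sizes by (induct fs) auto
    ultimately show ?thesis by simp
  qed
  ultimately show ?thesis by simp
qed

text \<open>Since the root ranks are invariants of the pencil, every Weierstrass form yields the same list.\<close>

lemma finite_partial_mults_iff: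
  assumes L: "L \<in> pencil_carrier n" "regular_pencil L"
    and xs: "sorted (rev xs)" "0 \<notin> set xs"
    and rank: "\<And>k. k > 0 \<Longrightarrow> max_root_rank (pencil_mat L) n \<mu> k (count_ge k xs)"
  shows "finite_partial_mults L \<mu> ns \<longleftrightarrow> ns = xs"
proof -
  have eq: "block_sizes (\<lambda>\<nu>. \<nu> = \<mu>) fs = xs" if w: "weierstrass_form L fs ks" for fs ks
  proof (rule eq_of_count_ge_eq)
    show "0 \<notin> set (block_sizes (\<lambda>\<nu>. \<nu> = \<mu>) fs)"
      using w by (intro block_sizes_nonzero) (auto simp: weierstrass_form_def)
    show "count_ge k (block_sizes (\<lambda>\<nu>. \<nu> = \<mu>) fs) = count_ge k xs" if "k > 0" for k
      using max_root_rank_unique[OF weierstrass_form_root_rank[OF w L(1) that] rank[OF that]] .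
  qed (use xs block_sizes_sorted in auto)
  have "finite_partial_mults L \<mu> ns \<longleftrightarrow>
      (\<exists>fs ks. weierstrass_form L fs ks \<and> ns = block_sizes (\<lambda>\<nu>. \<nu> = \<mu>) fs)"
    by (simp add: finite_partial_mults_def block_sizes_def)
  with eq weierstrass_form_exists[OF L] show ?thesis by blast
qed

text \<open>The blocks of \<open>J\<close> that make \<open>I + (\<lambda> - c) J\<close> singular at the given point. Writing the condition without
division also covers \<open>\<mu> = c\<close>, where there are none.\<close>

fun eigenblock :: "complex \<Rightarrow> eigval \<Rightarrow> complex \<Rightarrow> bool" where
  "eigenblock c (Finite \<mu>) \<nu> \<longleftrightarrow> 1 + (\<mu> - c) * \<nu> = 0"
| "eigenblock c Infinite \<nu> \<longleftrightarrow> \<nu> = 0"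

lemma eigenblock_eq:
  "eigenblock c (Finite \<mu>) = (\<lambda>\<nu>. 1 + (\<mu> - c) * \<nu> = 0)" "eigenblock c Infinite = (\<lambda>\<nu>. \<nu> = 0)"
  by auto

theorem has_partial_mults_iff:
  assumes "jordan_pencil_form n L c bs"
  shows "has_partial_mults L \<mu> ns \<longleftrightarrow> ns = block_sizes (eigenblock c \<mu>) bs"
proof -
  have L: "L \<in> pencil_carrier n" and pos: "0 \<notin> fst ` set bs"
    using assms by (auto simp: jordan_pencil_form_def pencil_equiv_def)
  note reg = jordan_pencil_form_regular[OF assms]
  note sz = block_sizes_sorted block_sizes_nonzero[OF pos]
  note rank = jordan_pencil_form_root_rank[OF assms]
  show ?thesis
  proof (cases \<mu>)
    case (Finite z)
    then show ?thesis using finite_partial_mults_iff[OF L reg(1) sz rank(1)] by (simp only: has_partial_mults.simps eigenblock_eq)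
  next
    case Infinite
    then show ?thesis using finite_partial_mults_iff[OF pencil_rev_carrier[OF L] reg(2) sz rank(2)] by (simp only: has_partial_mults.simps eigenblock_eq)
  qed
qed

text \<open>The root rank of \<open>pencil_rev L\<close> at 0 plays at infinity the role of that of \<open>L\<close> at a finite point.\<close>

lemma partial_mults_interlacing:
  assumes L: "jordan_pencil_form n L c bs" and M: "jordan_pencil_form n M c' bs'"
    and vs: "set vs \<subseteq> carrier_vec n" and vs': "set vs' \<subseteq> carrier_vec n"
    and len: "length vs \<le> r" "length vs' \<le> r"
    and eq: "\<And>y. y \<in> carrier_vec n \<Longrightarrow> (\<And>v. v \<in> set vs \<Longrightarrow> v \<bullet> y = 0) \<Longrightarrow>
      pencil_mat M *\<^sub>v y = pencil_mat L *\<^sub>v y"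
    and eq': "\<And>y. y \<in> carrier_vec n \<Longrightarrow> (\<And>v. v \<in> set vs' \<Longrightarrow> v \<bullet> y = 0) \<Longrightarrow>
      pencil_mat (pencil_rev M) *\<^sub>v y = pencil_mat (pencil_rev L) *\<^sub>v y"
    and k: "k > 0"
  shows "count_ge k (block_sizes (eigenblock c \<mu>) bs) \<le> count_ge k (block_sizes (eigenblock c' \<mu>) bs') + r"
proof -
  have Lc: "L \<in> pencil_carrier n" using L by (simp add: jordan_pencil_form_def pencil_equiv_def)
  show ?thesis
  proof (cases \<mu>)
    case (Finite z)
    have "count_ge k (block_sizes (eigenblock c \<mu>) bs) \<le>
        count_ge k (block_sizes (eigenblock c' \<mu>) bs') + length vs"
      unfolding Finite eigenblock_eq
      by (rule max_root_rank_interlacing[OF pencil_mat_carrier[OF Lc] jordan_pencil_form_root_rank(1)[OF L k]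
            jordan_pencil_form_root_rank(1)[OF M k] vs eq])
    with len show ?thesis by simp
  next
    case Infinite
    have "count_ge k (block_sizes (eigenblock c \<mu>) bs) \<le>
        count_ge k (block_sizes (eigenblock c' \<mu>) bs') + length vs'"
      unfolding Infinite eigenblock_eq
      by (rule max_root_rank_interlacing[OF pencil_mat_carrier[OF pencil_rev_carrier[OF Lc]]
            jordan_pencil_form_root_rank(2)[OF L k] jordan_pencil_form_root_rank(2)[OF M k] vs' eq'])
    with len show ?thesis by simp
  qed
qed

section \<open>Low rank perturbations of a Jordan matrix\<close>

text \<open>Permuting the blocks of a Jordan matrix allows a layer of blocks to be moved to the front.\<close>

lemma similar_mat_diag_swap:
  assumes A: "A \<in> carrier_mat n n" and B: "(B :: 'a::comm_ring_1 mat) \<in> carrier_mat m m"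
  shows "similar_mat (four_block_mat B (0\<^sub>m m n) (0\<^sub>m n m) A) (four_block_mat A (0\<^sub>m n m) (0\<^sub>m m n) B)"
proof -
  let ?P = "four_block_mat (0\<^sub>m m n) (1\<^sub>m m) (1\<^sub>m n) (0\<^sub>m n m) :: 'a mat"
  let ?Q = "four_block_mat (0\<^sub>m n m) (1\<^sub>m n) (1\<^sub>m m) (0\<^sub>m m n) :: 'a mat"
  have c: "?P \<in> carrier_mat (n + m) (n + m)" "?Q \<in> carrier_mat (n + m) (n + m)"
    by (rule carrier_matI; simp)+
  have i1: "?P * ?Q = 1\<^sub>m (n + m)" by (rule four_block_swap_inverse)
  have i2: "?Q * ?P = 1\<^sub>m (n + m)"
    by (subst add.commute) (rule four_block_swap_inverse)
  have "similar_mat_wit (four_block_mat B (0\<^sub>m m n) (0\<^sub>m n m) A) (four_block_mat A (0\<^sub>m n m) (0\<^sub>m m n) B) ?P ?Q"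
    by (rule similar_mat_witI[OF i1 i2 four_block_diag_swap[OF A B, symmetric] _ _ c])
       (use A B in \<open>auto simp: add.commute\<close>)
  then show ?thesis unfolding similar_mat_def by blast
qed

lemma similar_jordan_matrix_append:
  assumes "similar_mat (jordan_matrix xs) (jordan_matrix xs')" "similar_mat (jordan_matrix ys) (jordan_matrix ys')"
    and "sum_list (map fst xs) = sum_list (map fst xs')" "sum_list (map fst ys) = sum_list (map fst ys')"
  shows "similar_mat (jordan_matrix (xs @ ys)) (jordan_matrix (xs' @ ys') :: complex mat)"
  unfolding jordan_matrix_append assms(3,4)
  by (rule similar_mat_four_block_0_0[OF assms(1,2)]) (use assms(3,4) in \<open>metis jordan_matrix_carrier\<close>)+

lemma similar_jordan_matrix_perm:
  assumes "mset xs = mset ys"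
  shows "similar_mat (jordan_matrix xs) (jordan_matrix ys :: complex mat)"
  using assms
proof (induct xs arbitrary: ys)
  case Nil
  then show ?case by (auto intro: similar_mat_refl[of _ 0] simp: jordan_matrix_def)
next
  case (Cons x xs)
  then have "x \<in> set ys" by (metis list.set_intros(1) set_mset_mset)
  then obtain as bs where ys: "ys = as @ x # bs" by (metis split_list)
  with Cons.prems have m: "mset xs = mset (as @ bs)" by simp
  have sum: "sum_list (map fst zs) = sum_list (map fst zs')" if "mset zs = mset zs'" for zs zs' :: "(nat \<times> complex) list"
    by (metis that mset_map sum_mset_sum_list)
  have refl: "similar_mat (jordan_matrix zs) (jordan_matrix zs)" for zs :: "(nat \<times> complex) list"
    by (rule similar_mat_refl[OF jordan_matrix_carrier])
  have "similar_mat (jordan_matrix ([x] @ xs)) (jordan_matrix ([x] @ (as @ bs)))"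
    by (intro similar_jordan_matrix_append refl Cons.hyps m sum) simp
  also have "[x] @ (as @ bs) = ([x] @ as) @ bs" by simp
  finally have 1: "similar_mat (jordan_matrix ([x] @ xs)) (jordan_matrix (([x] @ as) @ bs))" .
  have "similar_mat (jordan_matrix ([x] @ as)) (jordan_matrix (as @ [x]))"
    unfolding jordan_matrix_append by (rule similar_mat_diag_swap) (rule jordan_matrix_carrier)+
  then have "similar_mat (jordan_matrix (([x] @ as) @ bs)) (jordan_matrix ((as @ [x]) @ bs))"
    by (rule similar_jordan_matrix_append[OF _ refl]) auto
  with 1 have "similar_mat (jordan_matrix ([x] @ xs)) (jordan_matrix ((as @ [x]) @ bs))"
    by (rule similar_mat_trans)
  then show ?case using ys by simp
qed

lemma det_one_plus_rank_one:
  assumes Y: "(Y :: complex mat) \<in> carrier_mat n 1" and V: "V \<in> carrier_mat 1 n"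
  shows "det (1\<^sub>m n + Y * V) = 1 + (V * Y) $$ (0, 0)"
proof -
  let ?A = "four_block_mat (1\<^sub>m n) (0\<^sub>m n 1) V (1\<^sub>m 1)"
  let ?M = "four_block_mat (1\<^sub>m n + Y * V) Y (0\<^sub>m 1 n) (1\<^sub>m 1)"
  let ?N = "four_block_mat (1\<^sub>m n) Y (0\<^sub>m 1 n) (1\<^sub>m 1 + V * Y)"
  have YV: "Y * V \<in> carrier_mat n n" and VY: "V * Y \<in> carrier_mat 1 1" using Y V by auto
  have VYV: "V * (Y * V) \<in> carrier_mat 1 n" using YV V by auto
  have VM: "V * (1\<^sub>m n + Y * V) = V + V * (Y * V)"
    using mult_add_distrib_mat[OF V one_carrier_mat YV] V by simp
  have VM': "(1\<^sub>m 1 + V * Y) * V = V + V * (Y * V)"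
    using add_mult_distrib_mat[OF one_carrier_mat VY V] V Y by (simp add: assoc_mult_mat[of _ 1 n _ 1 _ n])
  have comm: "V * Y + 1\<^sub>m 1 = 1\<^sub>m 1 + V * Y" by (rule comm_add_mat[OF VY one_carrier_mat])
  \<comment> \<open>The block triangular matrices \<open>?M\<close> and \<open>?N\<close> are similar by way of \<open>?A\<close>.\<close>
  have "?A * ?M = four_block_mat (1\<^sub>m n + Y * V) Y (V + V * (Y * V)) (1\<^sub>m 1 + V * Y)"
    using Y V YV VY VYV
    by (subst mult_four_block_mat[of _ n n _ 1 _ 1 _ _ n _ 1])
       (auto simp: VM comm[simplified])
  moreover have "?N * four_block_mat (1\<^sub>m n) (0\<^sub>m n 1) V (1\<^sub>m 1) =
      four_block_mat (1\<^sub>m n + Y * V) Y (V + V * (Y * V)) (1\<^sub>m 1 + V * Y)"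
    using Y V YV VY VYV
    by (subst mult_four_block_mat[of _ n n _ 1 _ 1 _ _ n _ 1])
       (auto simp: VM'[simplified])
  ultimately have eq: "?A * ?M = ?N * ?A" by simp
  have dA: "det ?A = 1" using V
    by (subst det_four_block_mat_upper_right_zero[of _ n _ 1]) auto
  have dM: "det ?M = det (1\<^sub>m n + Y * V)" using Y YV
    by (subst det_four_block_mat_lower_left_zero[of _ n _ 1]) auto
  have dN: "det ?N = det (1\<^sub>m 1 + V * Y)" using Y VY
    by (subst det_four_block_mat_lower_left_zero[of _ n _ 1]) auto
  have c: "?A \<in> carrier_mat (n + 1) (n + 1)" "?M \<in> carrier_mat (n + 1) (n + 1)"
    "?N \<in> carrier_mat (n + 1) (n + 1)" using Y V YV VY by auto
  have "det ?A * det ?M = det ?N * det ?A"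
    using eq det_mult[OF c(1,2)] det_mult[OF c(3,1)] by simp
  then have "det (1\<^sub>m n + Y * V) = det (1\<^sub>m 1 + V * Y)" by (simp only: dA dM dN mult_1_left mult_1_right)
  also have "\<dots> = 1 + (V * Y) $$ (0, 0)" using V Y by (simp add: det_single)
  finally show ?thesis .
qed

text \<open>For \<open>M y = u\<close> the perturbed matrix factors as \<open>M + u v\<^sup>T = M (I + y v\<^sup>T)\<close>.\<close>

lemma det_rank_one_update:
  assumes M: "(M :: complex mat) \<in> carrier_mat n n" and Y: "Y \<in> carrier_mat n 1" and V: "V \<in> carrier_mat 1 n"
  shows "det (M + M * Y * V) = det M * (1 + (V * Y) $$ (0, 0))"
proof -
  have "M + M * Y * V = M * (1\<^sub>m n + Y * V)"
    using M Y V by (subst mult_add_distrib_mat[of _ n n]) (auto simp: assoc_mult_mat[of _ n n _ 1 _ n])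
  then show ?thesis using M Y V det_one_plus_rank_one[OF Y V] by (simp add: det_mult[of _ n])
qed

text \<open>If \<open>e\<close> has a 1 at the last index of each block, \<open>(z I - J) y = e\<close> is solved explicitly by
\<open>resolvent_vec\<close>. A functional \<open>f\<close> that picks the first index of each block then gives the rational function
\<open>f \<bullet> y\<close>, the sum of the \<open>(z - \<nu>)\<^sup>-\<^sup>k\<close>. If the eigenvalues \<open>\<nu>\<close> are distinct, it has a pole of the full
order \<open>k\<close> at each of them.\<close>

fun first_entries :: "(nat \<times> complex) list \<Rightarrow> complex vec" where
  "first_entries [] = 0\<^sub>v 0"
| "first_entries ((k, \<nu>) # bs) = unit_vec k 0 @\<^sub>v first_entries bs"

fun last_entries :: "(nat \<times> complex) list \<Rightarrow> complex vec" where
  "last_entries [] = 0\<^sub>v 0"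
| "last_entries ((k, \<nu>) # bs) = unit_vec k (k - 1) @\<^sub>v last_entries bs"

fun resolvent_vec :: "complex \<Rightarrow> (nat \<times> complex) list \<Rightarrow> complex vec" where
  "resolvent_vec z [] = 0\<^sub>v 0"
| "resolvent_vec z ((k, \<nu>) # bs) = vec k (\<lambda>i. (1 / (z - \<nu>)) ^ (k - i)) @\<^sub>v resolvent_vec z bs"

lemma entries_carrier[simp]:
  "first_entries bs \<in> carrier_vec (sum_list (map fst bs))"
  "last_entries bs \<in> carrier_vec (sum_list (map fst bs))"
  "resolvent_vec z bs \<in> carrier_vec (sum_list (map fst bs))"
  by (induct bs, auto)

lemma resolvent_vec:
  assumes "\<forall>(k, \<nu>)\<in>set bs. k > 0 \<and> z \<noteq> \<nu>"
  shows "(z \<cdot>\<^sub>m 1\<^sub>m (sum_list (map fst bs)) - jordan_matrix bs) *\<^sub>v resolvent_vec z bs = last_entries bs"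
  using assms
proof (induct bs)
  case Nil
  show ?case by (rule eq_vecI) (auto simp: jordan_matrix_def)
next
  case (Cons t bs)
  obtain k \<nu> where t: "t = (k, \<nu>)" by (cases t)
  then have k: "k > 0" and z: "z - \<nu> \<noteq> 0" using Cons.prems by auto
  let ?n = "sum_list (map fst bs)"
  let ?A = "z \<cdot>\<^sub>m 1\<^sub>m k - jordan_block k \<nu>" and ?D = "z \<cdot>\<^sub>m 1\<^sub>m ?n - jordan_matrix bs"
  let ?y = "vec k (\<lambda>i. (1 / (z - \<nu>)) ^ (k - i))"
  have split: "z \<cdot>\<^sub>m 1\<^sub>m (k + ?n) - jordan_matrix (t # bs) = four_block_mat ?A (0\<^sub>m k ?n) (0\<^sub>m ?n k) ?D"
    unfolding t jordan_matrix_Cons by (auto intro!: eq_matI)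
  have A: "?A = bidiagonal k (z - \<nu>) (-1)"
    by (rule eq_matI) (auto simp: bidiagonal_def jordan_block_def)
  have "?A *\<^sub>v ?y = unit_vec k (k - 1)"
  proof (rule eq_vecI)
    fix i assume "i < dim_vec (unit_vec k (k - 1) :: complex vec)"
    then have i: "i < k" by simp
    have "(?A *\<^sub>v ?y) $ i = (z - \<nu>) * (1 / (z - \<nu>)) ^ (k - i) +
        (if Suc i < k then (-1) * (1 / (z - \<nu>)) ^ (k - Suc i) else 0)"
      unfolding A using i by (subst bidiagonal_mult_vec) auto
    also have "k - i = Suc (k - Suc i)" using i by simp
    also have "(z - \<nu>) * (1 / (z - \<nu>)) ^ Suc (k - Suc i) = (1 / (z - \<nu>)) ^ (k - Suc i)"
      using z by simp
    finally show "(?A *\<^sub>v ?y) $ i = unit_vec k (k - 1) $ i" using i k by (cases "Suc i < k") auto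
  qed (auto simp: A)
  moreover have "?D *\<^sub>v resolvent_vec z bs = last_entries bs" using Cons by auto
  moreover have "four_block_mat ?A (0\<^sub>m k ?n) (0\<^sub>m ?n k) ?D *\<^sub>v (?y @\<^sub>v resolvent_vec z bs) =
      ?A *\<^sub>v ?y @\<^sub>v ?D *\<^sub>v resolvent_vec z bs"
    by (rule mult_mat_vec_split) (auto intro: minus_carrier_mat)
  ultimately show ?case using split t by simp
qed

lemma first_entries_resolvent_vec:
  "\<forall>(k, \<nu>)\<in>set bs. k > 0 \<Longrightarrow>
     first_entries bs \<bullet> resolvent_vec z bs = (\<Sum>(k, \<nu>)\<leftarrow>bs. (1 / (z - \<nu>)) ^ k)"
proof (induct bs)
  case (Cons t bs)
  obtain k \<nu> where t: "t = (k, \<nu>)" by (cases t)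
  let ?y = "vec k (\<lambda>i. (1 / (z - \<nu>)) ^ (k - i))"
  have "first_entries (t # bs) \<bullet> resolvent_vec z (t # bs) =
      unit_vec k 0 \<bullet> ?y + first_entries bs \<bullet> resolvent_vec z bs"
    unfolding t by (simp, rule scalar_prod_append[of _ k _ "sum_list (map fst bs)"]) auto
  also have "unit_vec k 0 \<bullet> ?y = (1 / (z - \<nu>)) ^ k"
    using Cons.prems t by (simp add: scalar_prod_left_unit)
  finally show ?case using Cons t by simp
qed simp

definition charpoly_blocks :: "(nat \<times> complex) list \<Rightarrow> complex poly" where
  "charpoly_blocks bs = (\<Prod>(k, \<nu>)\<leftarrow>bs. [:-\<nu>, 1:] ^ k)"

lemma charpoly_blocks_simps[simp]:
  "charpoly_blocks [] = 1" "charpoly_blocks ((k, \<nu>) # bs) = [:-\<nu>, 1:] ^ k * charpoly_blocks bs"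
  by (simp_all add: charpoly_blocks_def)

text \<open>The numerator of \<open>\<Sum>\<^sub>b (x - \<nu>\<^sub>b)\<^sup>-\<^sup>k\<^sup>b\<close> over the common denominator
  \<open>charpoly_blocks\<close>.\<close>

fun resolvent_numerator :: "(nat \<times> complex) list \<Rightarrow> complex poly" where
  "resolvent_numerator [] = 0"
| "resolvent_numerator ((k, \<nu>) # bs) =
     charpoly_blocks bs + [:-\<nu>, 1:] ^ k * resolvent_numerator bs"

lemma poly_resolvent_numerator:
  "\<forall>(k, \<nu>)\<in>set bs. z \<noteq> \<nu> \<Longrightarrow> poly (resolvent_numerator bs) z =
     poly (charpoly_blocks bs) z * (\<Sum>(k, \<nu>)\<leftarrow>bs. (1 / (z - \<nu>)) ^ k)"
proof (induct bs)
  case (Cons t bs)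
  obtain k \<nu> where t: "t = (k, \<nu>)" by (cases t)
  then have "z - \<nu> \<noteq> 0" using Cons.prems by auto
  then have "(z - \<nu>) ^ k * (1 / (z - \<nu>)) ^ k = 1" by (simp add: power_one_over)
  moreover have "poly [:-\<nu>, 1:] z = z - \<nu>" by simp
  ultimately show ?case using Cons t by (simp add: algebra_simps)
qed simp

lemma charpoly_blocks_root:
  "\<forall>(k, \<nu>)\<in>set bs. k > 0 \<Longrightarrow> poly (charpoly_blocks bs) z = 0 \<longleftrightarrow> z \<in> snd ` set bs"
  by (induct bs) auto

lemma resolvent_numerator_coprime:
  assumes "\<forall>(k, \<nu>)\<in>set bs. k > 0" "distinct (map snd bs)" "poly (charpoly_blocks bs) z = 0"
  shows "poly (resolvent_numerator bs) z \<noteq> 0"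
  using assms
proof (induct bs)
  case (Cons t bs)
  obtain k \<nu> where t: "t = (k, \<nu>)" by (cases t)
  have k: "k > 0" using Cons.prems t by auto
  show ?case
  proof (cases "z = \<nu>")
    case True
    with Cons.prems t have "z \<notin> snd ` set bs" by auto
    then have "poly (charpoly_blocks bs) z \<noteq> 0" using Cons.prems(1) by (subst charpoly_blocks_root) auto
    then show ?thesis using True t k by (simp add: zero_power)
  next
    case False
    with Cons.prems t have "poly (charpoly_blocks bs) z = 0" by auto
    with Cons False t show ?thesis by auto
  qed
qed simp

text \<open>Away from the spectrum both sides are \<open>det (z I - J) (1 - \<epsilon> f \<bullet> (z I - J)\<^sup>-\<^sup>1 e)\<close>, and polynomials
that agree at infinitely many points are equal.\<close>

lemma char_poly_rank_one_update:
  fixes \<epsilon> :: complex and bs :: "(nat \<times> complex) list"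
  assumes pos: "\<forall>(k, \<nu>)\<in>set bs. k > 0"
  defines "n \<equiv> sum_list (map fst bs)"
  defines "U \<equiv> mat n 1 (\<lambda>(i, j). \<epsilon> * last_entries bs $ i)" and "V \<equiv> mat 1 n (\<lambda>(i, j). first_entries bs $ j)"
  shows "char_poly (jordan_matrix bs + U * V) = charpoly_blocks bs - Polynomial.smult \<epsilon> (resolvent_numerator bs)"
    (is "?p = ?q")
proof -
  let ?J = "jordan_matrix bs"
  have J: "?J \<in> carrier_mat n n" and U: "U \<in> carrier_mat n 1" and V: "V \<in> carrier_mat 1 n"
    by (auto simp: n_def U_def V_def)
  have "poly ?p z = poly ?q z" if z: "z \<notin> snd ` set bs" for z
  proof -
    let ?M = "z \<cdot>\<^sub>m 1\<^sub>m n - ?J"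
    define Y where "Y = mat n 1 (\<lambda>(i, j). - \<epsilon> * resolvent_vec z bs $ i)"
    have M: "?M \<in> carrier_mat n n" by (rule minus_carrier_mat[OF J])
    have Y: "Y \<in> carrier_mat n 1" by (simp add: Y_def)
    have z': "\<forall>(k, \<nu>)\<in>set bs. k > 0 \<and> z \<noteq> \<nu>" using z pos by force
    have c: "dim_vec (resolvent_vec z bs) = n" "dim_vec (last_entries bs) = n" "dim_vec (first_entries bs) = n"
      using entries_carrier(1,2)[of bs] entries_carrier(3)[of z bs] by (auto simp: n_def)
    have MY: "?M * Y = - U"
    proof (rule eq_matI)
      fix i j assume "i < dim_row (- U)" "j < dim_col (- U)"
      then have ij: "i < n" "j = 0" using U by auto
      have "(?M * Y) $$ (i, j) = - \<epsilon> * (?M *\<^sub>v resolvent_vec z bs) $ i"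
        using ij unfolding n_def
        by (simp add: Y_def n_def scalar_prod_def sum_distrib_left sum_negf mult.left_commute
            carrier_vecD[OF entries_carrier(3)])
      also have "\<dots> = - \<epsilon> * last_entries bs $ i" using resolvent_vec[OF z'] by (simp add: n_def)
      finally show "(?M * Y) $$ (i, j) = (- U) $$ (i, j)" using ij by (simp add: U_def)
    qed (use U Y J in auto)
    have VY: "(V * Y) $$ (0, 0) = - \<epsilon> * (first_entries bs \<bullet> resolvent_vec z bs)"
      using c by (simp add: V_def Y_def scalar_prod_def sum_distrib_left sum_negf mult.left_commute)
    have UV: "?J + U * V \<in> carrier_mat n n" using U V by auto
    have "poly ?p z = det (- char_matrix (?J + U * V) z)" by (rule char_poly_matrix[OF UV])
    also have "- char_matrix (?J + U * V) z = ?M + ?M * Y * V"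
      unfolding MY using J U V by (intro eq_matI) (auto simp: char_matrix_def)
    also have "det \<dots> = det ?M * (1 + (V * Y) $$ (0, 0))" by (rule det_rank_one_update[OF M Y V])
    also have "det ?M = poly (char_poly ?J) z"
      unfolding char_poly_matrix[OF J] by (rule arg_cong[of _ _ det], rule eq_matI)
        (use J in \<open>auto simp: char_matrix_def\<close>)
    also have "char_poly ?J = charpoly_blocks bs"
      unfolding jordan_matrix_char_poly charpoly_blocks_def ..
    also have "poly (charpoly_blocks bs) z * (1 + (V * Y) $$ (0, 0)) = poly ?q z"
      unfolding VY first_entries_resolvent_vec[OF pos] using poly_resolvent_numerator[of bs z] z'
      by (auto simp: algebra_simps case_prod_beta)
    finally show ?thesis .
  qed
  then have "- (snd ` set bs) \<subseteq> {z. poly (?p - ?q) z = 0}" by auto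
  moreover have "infinite (- (snd ` set bs))" using infinite_UNIV_char_0 by (simp add: Compl_eq_Diff_UNIV)
  ultimately have "?p - ?q = 0" using poly_roots_finite finite_subset by blast
  then show ?thesis by simp
qed

text \<open>Where \<open>m - \<epsilon> h\<close> has a multiple zero, the Wronskian \<open>m h' - m' h\<close> vanishes. If \<open>m\<close> and \<open>h\<close>
  have no common zero, such an \<open>\<epsilon>\<close> is the value of \<open>m / h\<close> at one of the finitely many zeros of the
  Wronskian.\<close>

lemma pencil_of_polys_simple_roots:
  fixes m h :: "complex poly"
  assumes cop: "\<And>z. poly m z = 0 \<Longrightarrow> poly h z \<noteq> 0" and W: "m * pderiv h - pderiv m * h \<noteq> 0"
    and F: "finite F"
  shows "\<exists>\<epsilon>. \<forall>z. poly (m - Polynomial.smult \<epsilon> h) z = 0 \<longrightarrow>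
    z \<notin> F \<and> poly (pderiv (m - Polynomial.smult \<epsilon> h)) z \<noteq> 0"
proof -
  let ?W = "m * pderiv h - pderiv m * h"
  let ?bad = "(\<lambda>z. poly m z / poly h z) ` (F \<union> {z. poly ?W z = 0})"
  have "finite ?bad" using F poly_roots_finite[OF W] by simp
  then obtain \<epsilon> where \<epsilon>: "\<epsilon> \<notin> ?bad" using ex_new_if_finite[OF infinite_UNIV_char_0] by blast
  have "z \<notin> F \<and> poly (pderiv (m - Polynomial.smult \<epsilon> h)) z \<noteq> 0"
    if z: "poly (m - Polynomial.smult \<epsilon> h) z = 0" for z
  proof -
    have mz: "poly m z = \<epsilon> * poly h z" using z by simp
    have hz: "poly h z \<noteq> 0" using cop[of z] mz by auto
    have e: "\<epsilon> = poly m z / poly h z" using mz hz by simp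
    have "z \<notin> F \<union> {z. poly ?W z = 0}" using \<epsilon> e by blast
    moreover have "poly ?W z = 0" if "poly (pderiv (m - Polynomial.smult \<epsilon> h)) z = 0"
    proof -
      have "poly (pderiv m) z = \<epsilon> * poly (pderiv h) z" using that by (simp add: pderiv_diff pderiv_smult)
      with mz show ?thesis by simp
    qed
    ultimately show ?thesis by blast
  qed
  then show ?thesis by blast
qed

text \<open>At a zero \<open>\<nu>\<close> of \<open>m\<close> of order \<open>k\<close> the product \<open>m' h\<close> vanishes to order \<open>k - 1\<close> only, but \<open>m h'\<close>
to order at least \<open>k\<close>.\<close>

lemma resolvent_wronskian_nonzero:
  assumes "bs \<noteq> []" "\<forall>(k, \<nu>)\<in>set bs. k > 0" "distinct (map snd bs)"
  shows "charpoly_blocks bs * pderiv (resolvent_numerator bs) -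
     pderiv (charpoly_blocks bs) * resolvent_numerator bs \<noteq> 0"
proof
  obtain k \<nu> bs' where bs: "bs = (k, \<nu>) # bs'" using assms(1) by (metis list.exhaust surj_pair)
  have k: "k > 0" using assms(2) bs by simp
  let ?l = "[:-\<nu>, 1:]" and ?m = "charpoly_blocks bs'" and ?h = "resolvent_numerator bs"
  assume "charpoly_blocks bs * pderiv ?h - pderiv (charpoly_blocks bs) * ?h = 0"
  moreover have "charpoly_blocks bs = ?l ^ (k - 1) * ?l * ?m" using k bs by (simp only: charpoly_blocks_simps power_minus_mult)
  moreover have "pderiv (charpoly_blocks bs) =
      Polynomial.smult (of_nat k) (?l ^ (k - 1)) * ?m + ?l ^ (k - 1) * ?l * pderiv ?m"
  proof -
    have "pderiv (?l ^ k) = Polynomial.smult (of_nat k) (?l ^ (k - 1))"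
      using k pderiv_power_Suc[of ?l "k - 1"] by (simp add: pderiv_pCons)
    then show ?thesis unfolding bs charpoly_blocks_simps pderiv_mult using k
      by (simp only: power_minus_mult) (simp only: ac_simps)
  qed
  moreover have "P * l * m * h' - (Polynomial.smult a P * m + P * l * m') * h =
      P * (l * (m * h' - m' * h) - Polynomial.smult a (m * h))" for P l m h h' m' :: "complex poly" and a
    by (simp add: algebra_simps)
  ultimately have "?l ^ (k - 1) * (?l * (?m * pderiv ?h - pderiv ?m * ?h) -
      Polynomial.smult (of_nat k) (?m * ?h)) = 0" by metis
  moreover have "?l ^ (k - 1) \<noteq> 0" by simp
  ultimately have "?l * (?m * pderiv ?h - pderiv ?m * ?h) - Polynomial.smult (of_nat k) (?m * ?h) = 0"
    by (metis mult_eq_0_iff)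
  then have "?l * (?m * pderiv ?h - pderiv ?m * ?h) = Polynomial.smult (of_nat k) (?m * ?h)"
    by simp
  from arg_cong[OF this, of "\<lambda>p. poly p \<nu>"] have "poly ?m \<nu> * poly ?h \<nu> = 0" using k by simp
  moreover have "poly ?m \<nu> \<noteq> 0" using assms bs by (subst charpoly_blocks_root) auto
  moreover have "poly ?h \<nu> \<noteq> 0" using k bs
    by (intro resolvent_numerator_coprime[OF assms(2,3)]) simp
  ultimately show False by simp
qed

lemma simple_roots_distinct:
  assumes "\<And>z. poly (\<Prod>a\<leftarrow>as. [:- a, 1:]) z = 0 \<Longrightarrow> poly (pderiv (\<Prod>a\<leftarrow>as. [:- a, 1:])) z \<noteq> 0"
  shows "distinct (as :: complex list)"
proof (rule ccontr)
  assume "\<not> distinct as"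
  then obtain xs ys zs y where as: "as = xs @ [y] @ ys @ [y] @ zs" using not_distinct_decomp by blast
  define g where "g = (\<Prod>a\<leftarrow>xs @ ys @ zs. [:- a, 1:])"
  have "(\<Prod>a\<leftarrow>as. [:- a, 1:]) = [:-y, 1:] * ([:-y, 1:] * g)"
    unfolding as g_def by (simp only: map_append prod_list.append list.map prod_list.Cons prod_list.Nil ac_simps mult_1_left mult_1_right)
  moreover have "poly ([:-y, 1:] * ([:-y, 1:] * g)) y = 0" by simp
  moreover have "poly (pderiv ([:-y, 1:] * ([:-y, 1:] * g))) y = 0"
    by (simp only: pderiv_mult poly_add poly_mult) simp
  ultimately show False using assms[of y] by simp
qed

lemma rank_one_simple_spectrum:
  fixes bs :: "(nat \<times> complex) list"
  assumes pos: "\<forall>(k, \<nu>)\<in>set bs. k > 0" and dist: "distinct (map snd bs)" and F: "finite F"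
  defines "n \<equiv> sum_list (map fst bs)"
  shows "\<exists>U V rs. U \<in> carrier_mat n 1 \<and> V \<in> carrier_mat 1 n \<and> distinct rs \<and> set rs \<inter> F = {} \<and>
    char_poly (jordan_matrix bs + U * V) = (\<Prod>a\<leftarrow>rs. [:- a, 1:])"
proof -
  define U where "U \<epsilon> = mat n 1 (\<lambda>(i, j). \<epsilon> * last_entries bs $ i)" for \<epsilon>
  define V where "V = mat 1 n (\<lambda>(i, j). first_entries bs $ j)"
  have U: "U \<epsilon> \<in> carrier_mat n 1" and V: "V \<in> carrier_mat 1 n" for \<epsilon> by (auto simp: U_def V_def)
  have J: "jordan_matrix bs \<in> carrier_mat n n" by (auto simp: n_def)
  have A: "jordan_matrix bs + U \<epsilon> * V \<in> carrier_mat n n" for \<epsilon>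
    by (rule add_carrier_mat[OF mult_carrier_mat[OF U V]])
  have cp: "char_poly (jordan_matrix bs + U \<epsilon> * V) =
      charpoly_blocks bs - Polynomial.smult \<epsilon> (resolvent_numerator bs)" for \<epsilon>
    unfolding U_def V_def n_def by (rule char_poly_rank_one_update[OF pos])
  show ?thesis
  proof (cases "bs = []")
    case True
    then have "n = 0" by (simp add: n_def)
    obtain rs where "char_poly (jordan_matrix bs + U 0 * V) = (\<Prod>a\<leftarrow>rs. [:- a, 1:])" "length rs = n"
      using char_poly_factorized[OF A] by blast
    with \<open>n = 0\<close> U V show ?thesis by (intro exI[of _ "U 0"] exI[of _ V] exI[of _ rs]) auto
  next
    case False
    obtain \<epsilon> where \<epsilon>: "\<And>z. poly (charpoly_blocks bs - Polynomial.smult \<epsilon> (resolvent_numerator bs)) z = 0 \<Longrightarrow>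
        z \<notin> F \<and> poly (pderiv (charpoly_blocks bs - Polynomial.smult \<epsilon> (resolvent_numerator bs))) z \<noteq> 0"
      using pencil_of_polys_simple_roots[OF resolvent_numerator_coprime[OF pos dist]
          resolvent_wronskian_nonzero[OF False pos dist] F] by blast
    obtain rs where rs: "char_poly (jordan_matrix bs + U \<epsilon> * V) = (\<Prod>a\<leftarrow>rs. [:- a, 1:])"
      using char_poly_factorized[OF A] by blast
    have "distinct rs" using \<epsilon> unfolding cp[symmetric] rs by (intro simple_roots_distinct) blast
    moreover have "poly (\<Prod>a\<leftarrow>rs. [:- a, 1:]) z = 0" if "z \<in> set rs" for z
      using that by (auto simp: poly_prod_list prod_list_zero_iff image_iff)
    then have "set rs \<inter> F = {}" using \<epsilon> unfolding cp[symmetric] rs by blast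
    ultimately show ?thesis using U V rs by blast
  qed
qed

lemma block_sizes_mset:
  assumes "mset bs = mset bs'" shows "block_sizes P bs = block_sizes P bs'"
proof -
  have "mset (map fst (filter (\<lambda>(k, a). P a) bs)) = mset (map fst (filter (\<lambda>(k, a). P a) bs'))"
    using assms by simp
  then show ?thesis unfolding block_sizes_def by (metis sorted_list_of_multiset_mset)
qed

lemma block_sizes_append:
  "mset (block_sizes P (xs @ ys)) = mset (block_sizes P xs) + mset (block_sizes P ys)"
  by (simp add: block_sizes_def)

text \<open>Removing such a layer deletes the largest entry from every list of multiplicities, and a layer with distinct eigenvalues
can be treated by a single rank one term.\<close>

lemma largest_blocks_layer:
  fixes bs :: "(nat \<times> 'b) list"
  shows "\<exists>G rest. mset bs = mset (G @ rest) \<and> distinct (map snd G) \<and>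
    snd ` set rest \<subseteq> snd ` set G \<and> (\<forall>x\<in>set G. \<forall>y\<in>set rest. snd y = snd x \<longrightarrow> fst y \<le> fst x)"
proof (induct bs)
  case Nil
  then show ?case by (intro exI[of _ "[]"]) auto
next
  case (Cons t bs)
  obtain k \<nu> where t: "t = (k, \<nu>)" by (cases t)
  from Cons obtain G rest where IH: "mset bs = mset (G @ rest)" "distinct (map snd G)"
    "snd ` set rest \<subseteq> snd ` set G"
    "\<forall>x\<in>set G. \<forall>y\<in>set rest. snd y = snd x \<longrightarrow> fst y \<le> fst x" by blast
  show ?case
  proof (cases "\<nu> \<in> snd ` set G")
    case False
    then have "\<nu> \<notin> snd ` set rest" using IH(3) by auto
    then have "\<forall>x\<in>set (t # G). \<forall>y\<in>set rest. snd y = snd x \<longrightarrow> fst y \<le> fst x"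
      using IH(4) t by (auto simp: image_iff)
    then show ?thesis using False IH(1-3) t by (intro exI[of _ "t # G"] exI[of _ rest]) auto
  next
    case True
    then obtain k0 where "(k0, \<nu>) \<in> set G" by auto
    then obtain G1 G2 where G: "G = G1 @ (k0, \<nu>) # G2" by (metis split_list)
    have u: "\<nu> \<notin> snd ` set G1" "\<nu> \<notin> snd ` set G2" using IH(2) G by auto
    show ?thesis
    proof (cases "k \<le> k0")
      case True
      have "\<forall>x\<in>set G. \<forall>y\<in>set (t # rest). snd y = snd x \<longrightarrow> fst y \<le> fst x"
        using IH(4) True t u unfolding G by (auto simp: image_iff)
      moreover have "snd ` set (t # rest) \<subseteq> snd ` set G" using IH(3) t G by auto
      ultimately show ?thesis using IH(1,2) by (intro exI[of _ G] exI[of _ "t # rest"]) auto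
    next
      case False
      have "fst y \<le> k" if "y \<in> set rest" "snd y = \<nu>" for y
        using IH(4) that False unfolding G by fastforce
      then have "\<forall>x\<in>set (G1 @ t # G2). \<forall>y\<in>set ((k0, \<nu>) # rest). snd y = snd x \<longrightarrow> fst y \<le> fst x"
        using IH(4) False t u unfolding G by (auto simp: image_iff)
      moreover have "snd ` set ((k0, \<nu>) # rest) \<subseteq> snd ` set (G1 @ t # G2)" using IH(3) t G by auto
      moreover have "distinct (map snd (G1 @ t # G2))" using IH(2) t G by simp
      moreover have "mset (t # bs) = mset ((G1 @ t # G2) @ (k0, \<nu>) # rest)" using IH(1) G by simp
      ultimately show ?thesis by blast
    qed
  qed
qed

lemma block_sizes_layer:
  fixes bs G rest :: "(nat \<times> 'b) list"
  assumes m: "mset bs = mset (G @ rest)" and d: "distinct (map snd G)"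
    and sub: "snd ` set rest \<subseteq> snd ` set G"
    and le: "\<forall>x\<in>set G. \<forall>y\<in>set rest. snd y = snd x \<longrightarrow> fst y \<le> fst x"
  shows "block_sizes (\<lambda>x. x = \<nu>) rest = drop 1 (block_sizes (\<lambda>x. x = \<nu>) bs)"
proof -
  have empty: "filter (\<lambda>(k, a). a = \<nu>) xs = []" if "\<nu> \<notin> snd ` set xs" for xs :: "(nat \<times> 'b) list"
    using that by (auto simp: filter_empty_conv image_iff)
  show ?thesis
  proof (cases "\<nu> \<in> snd ` set G")
    case False
    then have "filter (\<lambda>(k, a). a = \<nu>) (G @ rest) = []" "filter (\<lambda>(k, a). a = \<nu>) rest = []"
      using sub empty[of G] empty[of rest] by auto
    then have "block_sizes (\<lambda>x. x = \<nu>) (G @ rest) = []" "block_sizes (\<lambda>x. x = \<nu>) rest = []"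
      unfolding block_sizes_def by simp_all
    then show ?thesis using block_sizes_mset[OF m] by simp
  next
    case True
    then obtain k where k: "(k, \<nu>) \<in> set G" by auto
    then obtain G1 G2 where G: "G = G1 @ (k, \<nu>) # G2" by (metis split_list)
    then have "filter (\<lambda>(k, a). a = \<nu>) G1 = []" "filter (\<lambda>(k, a). a = \<nu>) G2 = []"
      using d by (auto intro!: empty)
    then have "block_sizes (\<lambda>x. x = \<nu>) G = [k]" unfolding block_sizes_def G by simp
    then have ms: "mset (block_sizes (\<lambda>x. x = \<nu>) bs) = mset (k # block_sizes (\<lambda>x. x = \<nu>) rest)"
      using block_sizes_append[of "\<lambda>x. x = \<nu>" G rest] block_sizes_mset[OF m] by simp
    have "\<forall>k'\<in>set (block_sizes (\<lambda>x. x = \<nu>) rest). k' \<le> k"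
      using le k unfolding block_sizes_def by fastforce
    then have "sorted (rev (k # block_sizes (\<lambda>x. x = \<nu>) rest))"
      using block_sizes_sorted[of _ rest] by (simp add: sorted_append)
    with ms have "rev (block_sizes (\<lambda>x. x = \<nu>) bs) = rev (k # block_sizes (\<lambda>x. x = \<nu>) rest)"
      by (metis block_sizes_sorted mset_rev properties_for_sort)
    then have "block_sizes (\<lambda>x. x = \<nu>) bs = k # block_sizes (\<lambda>x. x = \<nu>) rest"
      by (simp only: rev_is_rev_conv)
    then show ?thesis by simp
  qed
qed

lemma char_poly_direct_sum:
  assumes A: "(A :: complex mat) \<in> carrier_mat n n" and B: "B \<in> carrier_mat m m"
  shows "char_poly (four_block_mat A (0\<^sub>m n m) (0\<^sub>m m n) B) = char_poly A * char_poly B"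
proof -
  have "char_poly_matrix (four_block_mat A (0\<^sub>m n m) (0\<^sub>m m n) B) =
      four_block_mat (char_poly_matrix A) (0\<^sub>m n m) (0\<^sub>m m n) (char_poly_matrix B)"
    using A B by (intro eq_matI) (auto simp: char_poly_matrix_def)
  then show ?thesis unfolding char_poly_def
    using det_four_block_mat_upper_right_zero[OF char_poly_matrix_closed[OF A] refl zero_carrier_mat
        char_poly_matrix_closed[OF B]] by simp
qed

lemma four_block_diag_mult_rect:
  assumes "A \<in> carrier_mat n r" "B \<in> carrier_mat m s" "C \<in> carrier_mat r n" "D \<in> carrier_mat s m"
  shows "four_block_mat A (0\<^sub>m n s) (0\<^sub>m m r) B * four_block_mat C (0\<^sub>m r m) (0\<^sub>m s n) D =
    four_block_mat (A * C) (0\<^sub>m n m) (0\<^sub>m m n) (B * D :: 'a::comm_ring_1 mat)"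
  using assms by (subst mult_four_block_mat[of _ n r _ s _ m _ _ n _ m]) auto

text \<open>Each rank one term removes the layer of largest remaining blocks and puts simple eigenvalues
  in its place.\<close>

theorem jordan_matrix_low_rank_perturbation:
  assumes "0 \<notin> fst ` set bs" "finite F"
  shows "\<exists>U V rs bs'. U \<in> carrier_mat (sum_list (map fst bs)) r \<and> V \<in> carrier_mat r (sum_list (map fst bs)) \<and>
    distinct rs \<and> set rs \<inter> F = {} \<and> set bs' \<subseteq> set bs \<and>
    char_poly (jordan_matrix bs + U * V) = charpoly_blocks bs' * (\<Prod>a\<leftarrow>rs. [:- a, 1:]) \<and>
    (\<forall>\<nu>. block_sizes (\<lambda>x. x = \<nu>) bs' = drop r (block_sizes (\<lambda>x. x = \<nu>) bs))"
  using assms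
proof (induct r arbitrary: bs F)
  case 0
  let ?n = "sum_list (map fst bs)"
  have "jordan_matrix bs + 0\<^sub>m ?n 0 * 0\<^sub>m 0 ?n = jordan_matrix bs" by (rule eq_matI) (auto simp: scalar_prod_def)
  then have "char_poly (jordan_matrix bs + 0\<^sub>m ?n 0 * 0\<^sub>m 0 ?n) = charpoly_blocks bs"
    by (simp add: jordan_matrix_char_poly charpoly_blocks_def)
  then show ?case by (intro exI[of _ "0\<^sub>m ?n 0"] exI[of _ "0\<^sub>m 0 ?n"] exI[of _ "[]"] exI[of _ bs]) auto
next
  case (Suc r)
  obtain G rest where Gr: "mset bs = mset (G @ rest)" "distinct (map snd G)"
    "snd ` set rest \<subseteq> snd ` set G" "\<forall>x\<in>set G. \<forall>y\<in>set rest. snd y = snd x \<longrightarrow> fst y \<le> fst x"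
    using largest_blocks_layer[of bs] by blast
  have set: "set bs = set G \<union> set rest" using arg_cong[OF Gr(1), of set_mset] by simp
  let ?g = "sum_list (map fst G)" and ?m = "sum_list (map fst rest)"
  have n: "sum_list (map fst bs) = ?g + ?m"
    using arg_cong[OF Gr(1), of "\<lambda>M. sum_mset (image_mset fst M)"] by (simp flip: sum_mset_sum_list)
  have posG: "\<forall>(k, \<nu>)\<in>set G. k > 0" using Suc.prems(1) set by force
  obtain u v rs1 where 1: "u \<in> carrier_mat ?g 1" "v \<in> carrier_mat 1 ?g" "distinct rs1" "set rs1 \<inter> F = {}"
    "char_poly (jordan_matrix G + u * v) = (\<Prod>a\<leftarrow>rs1. [:- a, 1:])"
    using rank_one_simple_spectrum[OF posG Gr(2) Suc.prems(2)] by blast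
  have "0 \<notin> fst ` set rest" using Suc.prems(1) set by auto
  from Suc.hyps[OF this, of "F \<union> set rs1"] obtain U V rs2 bs' where
    2: "U \<in> carrier_mat ?m r" "V \<in> carrier_mat r ?m" "distinct rs2" "set rs2 \<inter> (F \<union> set rs1) = {}"
    "set bs' \<subseteq> set rest"
    "char_poly (jordan_matrix rest + U * V) = charpoly_blocks bs' * (\<Prod>a\<leftarrow>rs2. [:- a, 1:])"
    "\<forall>\<nu>. block_sizes (\<lambda>x. x = \<nu>) bs' = drop r (block_sizes (\<lambda>x. x = \<nu>) rest)"
    using Suc.prems(2) by auto
  let ?n = "?g + ?m"
  let ?U = "four_block_mat u (0\<^sub>m ?g r) (0\<^sub>m ?m 1) U" and ?V = "four_block_mat v (0\<^sub>m 1 ?m) (0\<^sub>m r ?g) V"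
  let ?J = "jordan_matrix (G @ rest)"
  have c: "?U \<in> carrier_mat ?n (1 + r)" "?V \<in> carrier_mat (1 + r) ?n" using 1 2 by auto
  have J: "?J \<in> carrier_mat ?n ?n" using jordan_matrix_carrier[of "G @ rest"] by simp
  have Jbs: "jordan_matrix bs \<in> carrier_mat ?n ?n" using jordan_matrix_carrier[of bs] n by simp
  have uv: "u * v \<in> carrier_mat ?g ?g" and UV: "U * V \<in> carrier_mat ?m ?m" using 1 2 by auto
  have "?J + ?U * ?V = four_block_mat (jordan_matrix G + u * v) (0\<^sub>m ?g ?m) (0\<^sub>m ?m ?g) (jordan_matrix rest + U * V)"
    unfolding jordan_matrix_append four_block_diag_mult_rect[OF 1(1) 2(1) 1(2) 2(2)]
    by (subst add_four_block_mat[of _ ?g ?g _ ?m _ ?m]) (use uv UV in auto)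
  then have cp: "char_poly (?J + ?U * ?V) =
      (\<Prod>a\<leftarrow>rs1. [:- a, 1:]) * (charpoly_blocks bs' * (\<Prod>a\<leftarrow>rs2. [:- a, 1:]))"
    using char_poly_direct_sum[OF add_carrier_mat[OF uv] add_carrier_mat[OF UV], of "jordan_matrix G" "jordan_matrix rest"]
      1(5) 2(6) by simp
  obtain S T where "similar_mat_wit (jordan_matrix bs) ?J S T"
    using similar_jordan_matrix_perm[OF Gr(1)] unfolding similar_mat_def by blast
  note w = similar_mat_witD2[OF Jbs this]
  have SU: "S * ?U \<in> carrier_mat ?n (1 + r)" "?V * T \<in> carrier_mat (1 + r) ?n" using w c by auto
  have UV': "?U * ?V \<in> carrier_mat ?n ?n" using c by auto
  have "S * (?J + ?U * ?V) = S * ?J + S * (?U * ?V)" by (rule mult_add_distrib_mat[OF w(6) J UV'])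
  moreover have "(S * ?J + S * (?U * ?V)) * T = S * ?J * T + S * (?U * ?V) * T"
    by (rule add_mult_distrib_mat[OF mult_carrier_mat[OF w(6) J] mult_carrier_mat[OF w(6) UV'] w(7)])
  moreover have "S * (?U * ?V) * T = (S * ?U) * (?V * T)"
    using assoc_mult_mat[OF w(6) c] assoc_mult_mat[OF mult_carrier_mat[OF w(6) c(1)] c(2) w(7)] by simp
  ultimately have "jordan_matrix bs + (S * ?U) * (?V * T) = S * (?J + ?U * ?V) * T"
    using w(3) by simp
  then have "similar_mat_wit (jordan_matrix bs + (S * ?U) * (?V * T)) (?J + ?U * ?V) S T"
    by (rule similar_mat_witI[OF w(1,2) _ add_carrier_mat[OF mult_carrier_mat[OF SU]]
          add_carrier_mat[OF UV'] w(6,7)])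
  then have "char_poly (jordan_matrix bs + (S * ?U) * (?V * T)) = char_poly (?J + ?U * ?V)"
    by (intro char_poly_similar) (auto simp: similar_mat_def)
  also have "\<dots> = charpoly_blocks bs' * (\<Prod>a\<leftarrow>rs1 @ rs2. [:- a, 1:])" unfolding cp by (simp add: ac_simps)
  finally have final: "char_poly (jordan_matrix bs + (S * ?U) * (?V * T)) =
      charpoly_blocks bs' * (\<Prod>a\<leftarrow>rs1 @ rs2. [:- a, 1:])" .
  have sizes: "block_sizes (\<lambda>x. x = \<nu>) bs' = drop (Suc r) (block_sizes (\<lambda>x. x = \<nu>) bs)" for \<nu>
    using 2(7) block_sizes_layer[OF Gr, of \<nu>] by simp
  show ?case unfolding n
    by (rule exI[of _ "S * ?U"], rule exI[of _ "?V * T"], rule exI[of _ "rs1 @ rs2"], rule exI[of _ bs'],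
        intro conjI allI)
       (use SU 1(3,4) 2(3-5) final sizes set in auto)
qed

section \<open>Detecting multiple roots\<close>

text \<open>The Sylvester matrix of \<open>p\<close> and \<open>q\<close> for formal degrees \<open>d\<close> and \<open>d - 1\<close>: its rows hold the coefficients
  of \<open>x\<^sup>i p\<close> and \<open>x\<^sup>i q\<close>. For \<open>d = 0\<close> it is empty, because \<open>2 * d - 1\<close> is 0.\<close>

definition shifted_row :: "nat \<Rightarrow> 'a::comm_semiring_1 poly \<Rightarrow> 'a poly \<Rightarrow> nat \<Rightarrow> 'a poly" where
  "shifted_row d p q i = (if i < d - 1 then monom 1 i * p else monom 1 (i - (d - 1)) * q)"

definition sylvester_formal :: "nat \<Rightarrow> 'a::comm_semiring_1 poly \<Rightarrow> 'a poly \<Rightarrow> 'a mat" where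
  "sylvester_formal d p q = mat (2 * d - 1) (2 * d - 1) (\<lambda>(i, j). coeff (shifted_row d p q i) j)"

lemma sylvester_formal_carrier[simp]: "sylvester_formal d p q \<in> carrier_mat (2 * d - 1) (2 * d - 1)"
  by (simp add: sylvester_formal_def)

lemma degree_shifted_row:
  fixes p q :: "'a::field poly"
  assumes "degree p \<le> d" "degree q \<le> d - 1" "i < 2 * d - 1"
  shows "degree (shifted_row d p q i) < 2 * d - 1"
proof -
  have "degree (monom 1 k * f) \<le> k + degree f" for k and f :: "'a poly"
    using degree_mult_le[of "monom 1 k" f] by (simp add: degree_monom_eq)
  from this[of i p] this[of "i - (d - 1)" q] assms show ?thesis
    by (auto simp: shifted_row_def)
qed

lemma poly_as_coeff_sum:
  fixes p :: "'a::comm_semiring_1 poly"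
  assumes "degree p < N" shows "poly p z = (\<Sum>j = 0..<N. coeff p j * z ^ j)"
  unfolding poly_altdef by (rule sum.mono_neutral_left) (use assms in \<open>auto simp: coeff_eq_0\<close>)

lemma sylvester_formal_common_root:
  fixes p q :: "'a::field poly"
  assumes deg: "degree p \<le> d" "degree q \<le> d - 1" and d: "d > 0" and z: "poly p z = 0" "poly q z = 0"
  shows "det (sylvester_formal d p q) = 0"
proof -
  let ?N = "2 * d - 1"
  let ?v = "vec ?N (\<lambda>j. z ^ j)"
  have "sylvester_formal d p q *\<^sub>v ?v = 0\<^sub>v ?N"
  proof (rule eq_vecI)
    fix i assume "i < dim_vec (0\<^sub>v ?N :: 'a vec)"
    then have i: "i < ?N" by simp
    have "(sylvester_formal d p q *\<^sub>v ?v) $ i = poly (shifted_row d p q i) z"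
      unfolding poly_as_coeff_sum[OF degree_shifted_row[OF deg i]] using i
      by (simp add: sylvester_formal_def scalar_prod_def)
    also have "\<dots> = 0" using z by (simp add: shifted_row_def)
    finally show "(sylvester_formal d p q *\<^sub>v ?v) $ i = 0\<^sub>v ?N $ i" using i by simp
  qed (simp add: sylvester_formal_def)
  moreover have "?v \<noteq> 0\<^sub>v ?N"
  proof
    assume "?v = 0\<^sub>v ?N"
    from arg_cong[OF this, of "\<lambda>v. v $ 0"] d show False by simp
  qed
  ultimately show ?thesis
    unfolding det_0_iff_vec_prod_zero[OF sylvester_formal_carrier] by (intro exI[of _ ?v]) auto
qed

text \<open>A linear dependence of the rows is a relation \<open>u p + w q = 0\<close> with \<open>w\<close> of degree less than \<open>d\<close>;
  then \<open>w\<close> vanishes at all the \<open>d\<close> roots of \<open>p\<close>.\<close>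

lemma sylvester_formal_det_nonzero:
  fixes p q :: "'a::field poly"
  assumes deg: "degree p \<le> d" "degree q \<le> d - 1" and p: "p \<noteq> 0"
    and roots: "card {z. poly p z = 0} = d" and cop: "\<And>z. poly p z = 0 \<Longrightarrow> poly q z \<noteq> 0"
  shows "det (sylvester_formal d p q) \<noteq> 0"
proof
  let ?S = "sylvester_formal d p q" and ?N = "2 * d - 1"
  assume "det ?S = 0"
  then have "det (transpose_mat ?S) = 0" by (simp add: det_transpose[OF sylvester_formal_carrier])
  then obtain v where v: "v \<in> carrier_vec ?N" "v \<noteq> 0\<^sub>v ?N" "transpose_mat ?S *\<^sub>v v = 0\<^sub>v ?N"
    using det_0_iff_vec_prod_zero[OF transpose_carrier_mat[THEN iffD2, OF sylvester_formal_carrier]] by blast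
  define u where "u = (\<Sum>i<d - 1. monom (v $ i) i)"
  define w where "w = (\<Sum>i<d. monom (v $ (d - 1 + i)) i)"
  have N: "?N = (d - 1) + d" by simp
  have low: "shifted_row d p q (d - 1 + i) = monom 1 i * q" for i
    unfolding shifted_row_def by (subst if_not_P) auto
  have "u * p + w * q = (\<Sum>i<?N. Polynomial.smult (v $ i) (shifted_row d p q i))"
  proof -
    have "(\<Sum>i<?N. Polynomial.smult (v $ i) (shifted_row d p q i)) =
      (\<Sum>i<d - 1. Polynomial.smult (v $ i) (shifted_row d p q i)) +
      (\<Sum>i<d. Polynomial.smult (v $ (d - 1 + i)) (shifted_row d p q (d - 1 + i)))"
      unfolding N lessThan_atLeast0 using sum.atLeastLessThan_concat[of 0 "d - 1" "d - 1 + d",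
          of "\<lambda>i. Polynomial.smult (v $ i) (shifted_row d p q i)"]
        sum.shift_bounds_nat_ivl[of "\<lambda>i. Polynomial.smult (v $ i) (shifted_row d p q i)" 0 "d - 1" d]
      by (simp add: add.commute)
    also have "\<dots> = u * p + w * q"
      unfolding u_def w_def sum_distrib_right low
      by (intro arg_cong2[of _ _ _ _ "(+)"] sum.cong)
         (simp_all add: shifted_row_def smult_monom flip: mult_smult_left)
    finally show ?thesis by simp
  qed
  also have "\<dots> = 0"
  proof (rule poly_eqI)
    fix j
    show "coeff (\<Sum>i<?N. Polynomial.smult (v $ i) (shifted_row d p q i)) j = coeff 0 j"
    proof (cases "j < ?N")
      case True
      have "(transpose_mat ?S *\<^sub>v v) $ j = (\<Sum>i = 0..<?N. coeff (shifted_row d p q i) j * v $ i)"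
        using True v(1) by (simp add: sylvester_formal_def scalar_prod_def)
      with v(3) True show ?thesis by (simp add: coeff_sum lessThan_atLeast0 mult.commute)
    next
      case False
      have "coeff (shifted_row d p q i) j = 0" if "i < ?N" for i
        using degree_shifted_row[OF deg that] False by (intro coeff_eq_0) simp
      then show ?thesis by (simp add: coeff_sum)
    qed
  qed
  finally have rel: "u * p + w * q = 0" .
  have w0: "w = 0"
  proof (rule ccontr)
    assume w: "w \<noteq> 0"
    have "poly w z = 0" if "poly p z = 0" for z
      using arg_cong[OF rel, of "\<lambda>f. poly f z"] that cop[OF that] by simp
    then have "card {z. poly p z = 0} \<le> card {z. poly w z = 0}"
      by (intro card_mono poly_roots_finite[OF w]) auto
    also have "\<dots> \<le> degree w" by (rule card_poly_roots_bound[OF w])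
    finally have "d \<le> degree w" using roots by simp
    moreover have "degree w < d" if "d > 0"
    proof -
      have "degree w \<le> d - 1" unfolding w_def
        by (rule degree_sum_le) (auto intro: order_trans[OF degree_monom_le])
      with that show ?thesis by simp
    qed
    ultimately have "d = 0" by linarith
    with w show False by (simp add: w_def)
  qed
  with rel p have u0: "u = 0" by simp
  have "v $ i = 0" if "i < ?N" for i
  proof (cases "i < d - 1")
    case True
    have "coeff u i = v $ i" using True by (simp add: u_def coeff_sum coeff_monom sum.delta')
    with u0 show ?thesis by simp
  next
    case False
    have "coeff w (i - (d - 1)) = v $ (d - 1 + (i - (d - 1)))"
      using False that by (simp add: w_def coeff_sum coeff_monom sum.delta' del: le_add_diff_inverse add_diff_inverse_nat)
    with w0 False show ?thesis by simp
  qed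
  then have "v = 0\<^sub>v ?N" using v(1) by (intro eq_vecI) auto
  with v(2) show False by simp
qed

lemma simple_root_iff:
  assumes "p \<noteq> (0 :: complex poly)" "poly p z = 0"
  shows "Polynomial.order z p = 1 \<longleftrightarrow> poly (pderiv p) z \<noteq> 0"
proof -
  have "degree p \<noteq> 0"
  proof
    assume "degree p = 0"
    then obtain a where "p = [:a:]" by (rule degree_eq_zeroE)
    with assms show False by simp
  qed
  then have p': "pderiv p \<noteq> 0" by (simp add: pderiv_eq_0_iff)
  have "Polynomial.order z p = Suc (Polynomial.order z (pderiv p))" by (rule order_pderiv[OF assms])
  with p' show ?thesis by (simp add: order_root)
qed

lemma card_simple_roots:
  assumes p: "p \<noteq> (0 :: complex poly)" and simple: "\<And>z. Polynomial.order z p \<le> 1"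
  shows "card {z. poly p z = 0} = degree p" and "\<And>z. poly p z = 0 \<Longrightarrow> poly (pderiv p) z \<noteq> 0"
proof -
  show simple': "poly (pderiv p) z \<noteq> 0" if "poly p z = 0" for z
  proof -
    have "Polynomial.order z p \<noteq> 0" using that p by (simp add: order_root)
    with simple[of z] have "Polynomial.order z p = 1" by linarith
    with simple_root_iff[OF p that] show ?thesis by simp
  qed
  obtain as where as: "Polynomial.smult (coeff p (degree p)) (\<Prod>a\<leftarrow>as. [:- a, 1:]) = p" "length as = degree p"
    using fundamental_theorem_algebra_factorized[of p] by blast
  define f where "f = (\<Prod>a\<leftarrow>as. [:- a, 1:])"
  define e where "e = coeff p (degree p)"
  have e: "e \<noteq> 0" and f: "p = Polynomial.smult e f" using p as by (auto simp: f_def e_def)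
  have "distinct as"
  proof (rule simple_roots_distinct)
    fix z assume "poly (\<Prod>a\<leftarrow>as. [:- a, 1:]) z = 0"
    then have "poly p z = 0" by (simp add: f f_def)
    from simple'[OF this] show "poly (pderiv (\<Prod>a\<leftarrow>as. [:- a, 1:])) z \<noteq> 0"
      unfolding f pderiv_smult f_def[symmetric] by simp
  qed
  moreover have "{z. poly p z = 0} = set as"
    using e unfolding f f_def by (auto simp: poly_prod_list prod_list_zero_iff image_iff)
  ultimately show "card {z. poly p z = 0} = degree p" using as(2) by (simp add: distinct_card)
qed

section \<open>The complexified parametrization\<close>

text \<open>The coordinates of \<open>y\<close> are those of \<open>realify\<close>. At real points \<open>conj_part\<close> is the complex conjugate of
  \<open>complex_part\<close>; over complex coordinates the two are independent.\<close>

definition complex_part :: "nat \<Rightarrow> nat \<Rightarrow> (nat \<Rightarrow> complex) \<Rightarrow> nat \<Rightarrow> complex" where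
  "complex_part p q y k = y (p + k) + \<i> * y (p + q + k)"

definition conj_part :: "nat \<Rightarrow> nat \<Rightarrow> (nat \<Rightarrow> complex) \<Rightarrow> nat \<Rightarrow> complex" where
  "conj_part p q y k = y (p + k) - \<i> * y (p + q + k)"

definition Phi_complexified :: "nat \<Rightarrow> nat \<Rightarrow> nat \<Rightarrow> (nat \<Rightarrow> complex) \<Rightarrow> pencil" where
  "Phi_complexified n r s y =
    (let l = r - 2 * s;
         z = (\<lambda>i k. complex_part (2 * l) ((r + s) * n) y (i * n + k));
         z' = (\<lambda>i k. conj_part (2 * l) ((r + s) * n) y (i * n + k))
     in (mat n n (\<lambda>(p, q). (\<Sum>i<l. y (2 * i) * (z i p * z' i q)) +
           (\<Sum>j<s. z (l + j) p * z' (l + s + j) q + z (l + s + j) p * z' (l + j) q)),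
         mat n n (\<lambda>(p, q). (\<Sum>i<l. y (2 * i + 1) * (z i p * z' i q)) +
           (\<Sum>j<s. z (l + j) p * z' (l + 2 * s + j) q + z (l + 2 * s + j) p * z' (l + j) q))))"

lemma Phi_complexified_carrier: "Phi_complexified n r s y \<in> pencil_carrier n"
  by (simp add: Phi_complexified_def pencil_carrier_def Let_def)

lemma block_index_less:
  fixes i p m n :: nat
  assumes "i < m" "p < n" shows "i * n + p < m * n"
proof -
  have "i * n + p < i * n + n" using assms by simp
  also have "\<dots> = Suc i * n" by simp
  also have "\<dots> \<le> m * n" using assms by (intro mult_le_mono1) simp
  finally show ?thesis .
qed

lemma Phi_eq_complexified:
  assumes x: "x \<in> carrier_vec (2 * (r - 2 * s))" and z: "z \<in> carrier_vec ((r + s) * n)" and s: "s \<le> r div 2"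
  shows "Phi n r s (x, z) = Phi_complexified n r s (\<lambda>i. of_real (realify (x, z) $ i))"
proof -
  let ?l = "r - 2 * s" and ?y = "\<lambda>i. complex_of_real (realify (x, z) $ i)"
  have l: "?l + 3 * s = r + s" using s by simp
  have a: "?y (2 * i) = of_real (x $ (2 * i))" "?y (2 * i + 1) = of_real (x $ (2 * i + 1))" if "i < ?l" for i
    using realify_index(1)[OF x z] that by auto
  have c: "complex_part (2 * ?l) ((r + s) * n) ?y (i * n + k) = block_vec n z i $ k"
    "conj_part (2 * ?l) ((r + s) * n) ?y (i * n + k) = cnj (block_vec n z i $ k)"
    if "i < r + s" "k < n" for i k
    using realify_index(2,3)[OF x z block_index_less[OF that]] that
    by (auto simp: complex_part_def conj_part_def block_vec_def complex_eq_iff)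
  show ?thesis
    unfolding Phi_def Phi_complexified_def Let_def prod.case
    by (intro arg_cong2[of _ _ _ _ Pair] eq_matI)
       (use a c l in \<open>auto intro!: arg_cong2[of _ _ _ _ "(+)"] sum.cong\<close>)
qed

lemma complex_part_polyfun:
  assumes "k < q"
  shows "(\<lambda>y. complex_part p q y k) \<in> polyfun (p + 2 * q)" "(\<lambda>y. conj_part p q y k) \<in> polyfun (p + 2 * q)"
proof -
  have 1: "(\<lambda>y. y (p + k)) \<in> polyfun (p + 2 * q)" "(\<lambda>y. y (p + q + k)) \<in> polyfun (p + 2 * q)"
    using assms by (auto intro: polyfun.var)
  then show "(\<lambda>y. complex_part p q y k) \<in> polyfun (p + 2 * q)"
    unfolding complex_part_def by (intro polyfun.add polyfun.mult polyfun.const)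
  have "(\<lambda>y. y (p + k) + (- \<i>) * y (p + q + k)) \<in> polyfun (p + 2 * q)" using 1
    by (intro polyfun.add polyfun.mult polyfun.const)
  then show "(\<lambda>y. conj_part p q y k) \<in> polyfun (p + 2 * q)" unfolding conj_part_def by simp
qed

lemma pencil_det_add_polyfun:
  assumes L: "L \<in> pencil_carrier n" and s: "s \<le> r div 2"
  shows "(\<lambda>y. pencil_det (pencil_add L (Phi_complexified n r s y))) \<in>
    polyfun_poly (2 * (r - 2 * s) + 2 * ((r + s) * n))" (is "_ \<in> polyfun_poly ?N")
proof -
  let ?l = "r - 2 * s"
  have l: "?l + 3 * s = r + s" using s by simp
  have z: "(\<lambda>y. complex_part (2 * ?l) ((r + s) * n) y (i * n + k)) \<in> polyfun ?N"
    "(\<lambda>y. conj_part (2 * ?l) ((r + s) * n) y (i * n + k)) \<in> polyfun ?N" if "i < r + s" "k < n" for i k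
    by (rule complex_part_polyfun[OF block_index_less[OF that]])+
  have v: "(\<lambda>y. y (2 * i)) \<in> polyfun ?N" "(\<lambda>y. y (2 * i + 1)) \<in> polyfun ?N" if "i < ?l" for i
    using that by (auto intro!: polyfun.var)
  have 1: "(\<lambda>y. fst (Phi_complexified n r s y) $$ (p, q)) \<in> polyfun ?N"
    and 2: "(\<lambda>y. snd (Phi_complexified n r s y) $$ (p, q)) \<in> polyfun ?N" if pq: "p < n" "q < n" for p q
    unfolding Phi_complexified_def Let_def using pq l
    by (auto intro!: polyfun.add polyfun_sum polyfun.mult v[simplified] z)
  have M: "pencil_add L E \<in> pencil_carrier n" if "E \<in> pencil_carrier n" for E
    using that L by (auto simp: pencil_add_def pencil_carrier_def)
  have "(\<lambda>y. pencil_mat (pencil_add L (Phi_complexified n r s y)) $$ (p, q)) \<in> polyfun_poly ?N"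
    if pq: "p < n" "q < n" for p q
  proof -
    have E: "fst (Phi_complexified n r s y) \<in> carrier_mat n n" "snd (Phi_complexified n r s y) \<in> carrier_mat n n"
      for y using Phi_complexified_carrier[of n r s y] by (auto simp: pencil_carrier_def)
    have Lc: "fst L \<in> carrier_mat n n" "snd L \<in> carrier_mat n n" using L by (auto simp: pencil_carrier_def)
    have "pencil_mat (pencil_add L (Phi_complexified n r s y)) $$ (p, q) =
       [:fst L $$ (p, q) + fst (Phi_complexified n r s y) $$ (p, q),
         snd L $$ (p, q) + snd (Phi_complexified n r s y) $$ (p, q):]" for y
      using E[of y] Lc pq by (simp add: pencil_mat_def pencil_add_def)
    then show ?thesis using 1[OF pq] 2[OF pq]
      by (simp only:) (intro polyfun_poly_linear polyfun.add polyfun.const)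
  qed
  then show ?thesis unfolding pencil_det_eq
    by (intro polyfun_poly_det[where n = n] pencil_mat_carrier[OF M[OF Phi_complexified_carrier]])
qed

text \<open>A factorization of rank \<open>r\<close> over the polynomials; the second factors are the functionals whose common kernel
the matrix annihilates.\<close>

definition sum_of_products :: "nat \<Rightarrow> nat \<Rightarrow> complex poly mat \<Rightarrow> bool" where
  "sum_of_products n r W \<longleftrightarrow> W \<in> carrier_mat n n \<and>
     (\<exists>fgs. length fgs = r \<and> (\<forall>p<n. \<forall>q<n. W $$ (p, q) = (\<Sum>(f, g)\<leftarrow>fgs. f p * g q)))"

lemma sum_of_products_kernel:
  assumes "sum_of_products n r W"
  obtains vs where "set vs \<subseteq> carrier_vec n" "length vs \<le> r"
    "\<forall>y\<in>carrier_vec n. (\<forall>v\<in>set vs. v \<bullet> y = 0) \<longrightarrow> W *\<^sub>v y = 0\<^sub>v n"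
proof -
  obtain fgs where W: "W \<in> carrier_mat n n" and len: "length fgs = r"
    and eq: "\<And>p q. p < n \<Longrightarrow> q < n \<Longrightarrow> W $$ (p, q) = (\<Sum>(f, g)\<leftarrow>fgs. f p * g q)"
    using assms unfolding sum_of_products_def by blast
  let ?vs = "map (\<lambda>(f, g). vec n g) fgs"
  have kernel: "W *\<^sub>v y = 0\<^sub>v n" if y: "y \<in> carrier_vec n" and v: "\<And>v. v \<in> set ?vs \<Longrightarrow> v \<bullet> y = 0" for y
  proof (rule eq_vecI)
    fix p assume "p < dim_vec (0\<^sub>v n :: complex poly vec)"
    then have p: "p < n" by simp
    have "(W *\<^sub>v y) $ p = (\<Sum>q = 0..<n. (\<Sum>(f, g)\<leftarrow>fgs. f p * g q) * y $ q)"
      using W y p by (simp add: scalar_prod_def eq)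
    also have "\<dots> = (\<Sum>(f, g)\<leftarrow>fgs. f p * (vec n g \<bullet> y))"
    proof -
      have "(\<Sum>q = 0..<n. (\<Sum>(f, g)\<leftarrow>xs. f p * g q) * y $ q) = (\<Sum>(f, g)\<leftarrow>xs. f p * (vec n g \<bullet> y))" for xs
        using y by (induct xs) (auto simp: distrib_right sum.distrib scalar_prod_def sum_distrib_left mult.assoc)
      then show ?thesis .
    qed
    also have "map (\<lambda>(f, g). f p * (vec n g \<bullet> y)) fgs = map (\<lambda>_. 0) fgs"
    proof (rule map_cong[OF refl])
      fix fg assume "fg \<in> set fgs"
      then show "(case fg of (f, g) \<Rightarrow> f p * (vec n g \<bullet> y)) = 0"
        using v[of "vec n (snd fg)"] by (force simp: case_prod_beta)
    qed
    finally show "(W *\<^sub>v y) $ p = 0\<^sub>v n $ p" using p by simp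
  qed (use W in auto)
  show ?thesis
  proof (rule that[of ?vs])
    show "\<forall>y\<in>carrier_vec n. (\<forall>v\<in>set ?vs. v \<bullet> y = 0) \<longrightarrow> W *\<^sub>v y = 0\<^sub>v n"
      using kernel by blast
  qed (use len in auto)
qed

lemma sum_lessThan_add: "(\<Sum>i<a + (b :: nat). f i) = (\<Sum>i<a. f i) + (\<Sum>j<b. f (a + j) :: 'a::comm_monoid_add)"
  by (induct b) (auto simp: add.assoc)

lemma sum_list_map_upt: "(\<Sum>i\<leftarrow>[0..<m]. f i) = (\<Sum>i<m. f i)"
  by (simp add: interv_sum_list_conv_sum_set_nat lessThan_atLeast0)

lemma Phi_complexified_sum_of_products:
  assumes s: "s \<le> r div 2"
  shows "sum_of_products n r (pencil_mat (Phi_complexified n r s y))"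
    and "sum_of_products n r (pencil_mat (pencil_rev (Phi_complexified n r s y)))"
proof -
  define l where "l = r - 2 * s"
  have r: "r = l + 2 * s" using s by (simp add: l_def)
  define z where "z i k = complex_part (2 * l) ((r + s) * n) y (i * n + k)" for i k
  define z' where "z' i k = conj_part (2 * l) ((r + s) * n) y (i * n + k)" for i k
  let ?p = "\<lambda>a b i p. [:a i * z i p, b i * z i p:]"
  let ?f = "\<lambda>a b g h. map (\<lambda>i. (?p a b i, \<lambda>q. [:z' i q:])) [0..<l] @
    map (\<lambda>j. (\<lambda>p. [:z (l + j) p:], \<lambda>q. [:z' (l + g + j) q, z' (l + h + j) q:])) [0..<s] @
    map (\<lambda>j. (\<lambda>p. [:z (l + g + j) p, z (l + h + j) p:], \<lambda>q. [:z' (l + j) q:])) [0..<s]"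
  let ?A = "\<lambda>a g. mat n n (\<lambda>(p, q). (\<Sum>i<l. a i * (z i p * z' i q)) +
           (\<Sum>j<s. z (l + j) p * z' (l + g + j) q + z (l + g + j) p * z' (l + j) q))"
  have pairs: "[:sum f I, sum g I:] = (\<Sum>i\<in>I. [:f i, g i:])" for f g :: "nat \<Rightarrow> complex" and I
    by (rule poly_eqI) (auto simp: coeff_sum coeff_pCons split: nat.splits)
  have gen: "sum_of_products n r (pencil_mat (?A a g, ?A b h))" for a b :: "nat \<Rightarrow> complex" and g h
    unfolding sum_of_products_def
  proof (intro conjI exI[of _ "?f a b g h"] allI impI)
    fix p q assume pq: "p < n" "q < n"
    have "pencil_mat (?A a g, ?A b h) $$ (p, q) =
       [:\<Sum>i<l. a i * (z i p * z' i q), \<Sum>i<l. b i * (z i p * z' i q):] +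
       ([:\<Sum>j<s. z (l + j) p * z' (l + g + j) q, \<Sum>j<s. z (l + j) p * z' (l + h + j) q:] +
       [:\<Sum>j<s. z (l + g + j) p * z' (l + j) q, \<Sum>j<s. z (l + h + j) p * z' (l + j) q:])"
      using pq by (simp add: pencil_mat_def sum.distrib)
    also have "\<dots> = (\<Sum>(f, g)\<leftarrow>?f a b g h. f p * g q)"
      unfolding pairs by (simp add: o_def sum_list_map_upt ac_simps)
    finally show "pencil_mat (?A a g, ?A b h) $$ (p, q) = (\<Sum>(f, g)\<leftarrow>?f a b g h. f p * g q)" .
  qed (auto simp: r intro!: pencil_mat_carrier simp: pencil_carrier_def)
  have eq: "Phi_complexified n r s y = (?A (\<lambda>i. y (2 * i)) s, ?A (\<lambda>i. y (2 * i + 1)) (2 * s))"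
    by (simp add: Phi_complexified_def Let_def z_def z'_def l_def)
  show "sum_of_products n r (pencil_mat (Phi_complexified n r s y))" unfolding eq by (rule gen)
  show "sum_of_products n r (pencil_mat (pencil_rev (Phi_complexified n r s y)))"
    unfolding eq pencil_rev_def fst_conv snd_conv by (rule gen)
qed

text \<open>With independent conjugate coordinates every pencil \<open>(\<lambda> - c) U V\<close> with \<open>r\<close> columns in \<open>U\<close> is in the
  range: \<open>u\<^sub>i\<close> pairs with its own conjugate variable, \<open>v\<^sub>j\<close> with that of \<open>w\<^sub>j\<close>, and \<open>w\<^sub>j\<close> with that
  of \<open>v\<^sub>j\<close>, which makes \<open>l + 2 s = r\<close> independent rank one terms.\<close>

lemma Phi_complexified_surj_low_rank:
  assumes s: "s \<le> r div 2" and U: "U \<in> carrier_mat n r" and V: "V \<in> carrier_mat r n"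
  shows "\<exists>y. Phi_complexified n r s y = ((- c) \<cdot>\<^sub>m (U * V), U * V)"
proof -
  define l where "l = r - 2 * s"
  have r: "r = l + 2 * s" using s by (simp add: l_def)
  define zz where "zz i k = (if i < l + s then U $$ (k, i) else
    if i < l + 2 * s then - c * U $$ (k, i) else U $$ (k, i - s))" for i k
  define zc where "zc i k = (if i < l then V $$ (i, k) else if i < l + s then V $$ (i + s, k) else
    if i < l + 2 * s then - c * V $$ (i - s, k) else V $$ (i - 2 * s, k))" for i k
  let ?P = "2 * l" and ?Q = "(r + s) * n"
  define y where "y m = (if m < ?P then (if even m then - c else 1)
     else if m < ?P + ?Q then (let k = m - ?P in (zz (k div n) (k mod n) + zc (k div n) (k mod n)) / 2)
     else (let k = m - ?P - ?Q in (zz (k div n) (k mod n) - zc (k div n) (k mod n)) / (2 * \<i>)))" for m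
  have c: "complex_part ?P ?Q y (i * n + k) = zz i k" "conj_part ?P ?Q y (i * n + k) = zc i k"
    if "i < r + s" "k < n" for i k
  proof -
    have lt: "i * n + k < ?Q" by (rule block_index_less[OF that])
    have dm: "(i * n + k) div n = i" "(i * n + k) mod n = k" using that by auto
    have A: "y (?P + (i * n + k)) = (zz i k + zc i k) / 2" using lt dm by (simp add: y_def)
    have B: "y (?P + ?Q + (i * n + k)) = (zz i k - zc i k) / (2 * \<i>)" using dm by (simp add: y_def)
    show "complex_part ?P ?Q y (i * n + k) = zz i k" "conj_part ?P ?Q y (i * n + k) = zc i k"
      unfolding complex_part_def conj_part_def A B by (simp_all add: field_simps)
  qed
  have a: "y (2 * i) = - c" "y (2 * i + 1) = 1" if "i < l" for i using that by (auto simp: y_def)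
  have split: "(U * V) $$ (p, q) = (\<Sum>i<l. U $$ (p, i) * V $$ (i, q)) +
      (\<Sum>j<s. U $$ (p, l + j) * V $$ (l + j, q) + U $$ (p, l + s + j) * V $$ (l + s + j, q))"
    if "p < n" "q < n" for p q
  proof -
    let ?t = "\<lambda>i. U $$ (p, i) * V $$ (i, q)"
    have "(U * V) $$ (p, q) = (\<Sum>i = 0..<l + (s + s). ?t i)"
      using that U V r by (simp add: scalar_prod_def mult_2)
    also have "\<dots> = (\<Sum>i<l. ?t i) + ((\<Sum>j<s. ?t (l + j)) + (\<Sum>j<s. ?t (l + s + j)))"
      by (simp only: lessThan_atLeast0[symmetric] sum_lessThan_add add.assoc)
    finally show ?thesis by (simp add: sum.distrib)
  qed
  have cu: "complex_part ?P ?Q y (i * n + k) = U $$ (k, i)" if "i < l + s" "k < n" for i k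
    using c(1)[of i k] that r by (simp add: zz_def)
  have cw: "complex_part ?P ?Q y ((l + s + j) * n + k) = - c * U $$ (k, l + s + j)"
    "complex_part ?P ?Q y ((l + 2 * s + j) * n + k) = U $$ (k, l + s + j)"
    "conj_part ?P ?Q y ((l + j) * n + k) = V $$ (l + s + j, k)"
    "conj_part ?P ?Q y ((l + s + j) * n + k) = - c * V $$ (l + j, k)"
    "conj_part ?P ?Q y ((l + 2 * s + j) * n + k) = V $$ (l + j, k)" if "j < s" "k < n" for j k
    using c[of "l + s + j" k] c[of "l + 2 * s + j" k] c(2)[of "l + j" k] that r
    by (simp_all add: zz_def zc_def add.commute add.left_commute)
  have cv: "conj_part ?P ?Q y (i * n + k) = V $$ (i, k)" if "i < l" "k < n" for i k
    using c(2)[of i k] that r by (simp add: zc_def)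
  have "Phi_complexified n r s y = ((- c) \<cdot>\<^sub>m (U * V), U * V)"
    unfolding Phi_complexified_def Let_def l_def[symmetric]
  proof (intro arg_cong2[of _ _ _ _ Pair] eq_matI)
    fix p q assume "p < dim_row ((- c) \<cdot>\<^sub>m (U * V))" "q < dim_col ((- c) \<cdot>\<^sub>m (U * V))"
    then have pq: "p < n" "q < n" using U V by auto
    have "(\<Sum>i<l. y (2 * i) * (complex_part ?P ?Q y (i * n + p) * conj_part ?P ?Q y (i * n + q))) +
        (\<Sum>j<s. complex_part ?P ?Q y ((l + j) * n + p) * conj_part ?P ?Q y ((l + s + j) * n + q) +
            complex_part ?P ?Q y ((l + s + j) * n + p) * conj_part ?P ?Q y ((l + j) * n + q)) =
      (\<Sum>i<l. - c * (U $$ (p, i) * V $$ (i, q))) +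
        (\<Sum>j<s. - c * (U $$ (p, l + j) * V $$ (l + j, q) + U $$ (p, l + s + j) * V $$ (l + s + j, q)))"
      by (intro arg_cong2[of _ _ _ _ "(+)"] sum.cong refl)
         (use pq in \<open>simp_all add: cu cv cw a(1) distrib_left\<close>)
    also have "\<dots> = ((- c) \<cdot>\<^sub>m (U * V)) $$ (p, q)"
    proof -
      have "((- c) \<cdot>\<^sub>m (U * V)) $$ (p, q) = - c * (U * V) $$ (p, q)" using pq U V by simp
      then show ?thesis by (simp only: split[OF pq] sum_distrib_left[symmetric] distrib_left[symmetric])
    qed
    finally show "mat n n (\<lambda>(p, q). (\<Sum>i<l. y (2 * i) * (complex_part ?P ?Q y (i * n + p) * conj_part ?P ?Q y (i * n + q))) +
           (\<Sum>j<s. complex_part ?P ?Q y ((l + j) * n + p) * conj_part ?P ?Q y ((l + s + j) * n + q) +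
              complex_part ?P ?Q y ((l + s + j) * n + p) * conj_part ?P ?Q y ((l + j) * n + q))) $$ (p, q) =
       ((- c) \<cdot>\<^sub>m (U * V)) $$ (p, q)"
      using pq by (simp only: index_mat(1) prod.case)
  next
    fix p q assume "p < dim_row (U * V)" "q < dim_col (U * V)"
    then have pq: "p < n" "q < n" using U V by auto
    have "(\<Sum>i<l. y (2 * i + 1) * (complex_part ?P ?Q y (i * n + p) * conj_part ?P ?Q y (i * n + q))) +
        (\<Sum>j<s. complex_part ?P ?Q y ((l + j) * n + p) * conj_part ?P ?Q y ((l + 2 * s + j) * n + q) +
            complex_part ?P ?Q y ((l + 2 * s + j) * n + p) * conj_part ?P ?Q y ((l + j) * n + q)) =
      (U * V) $$ (p, q)"
      unfolding split[OF pq]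
      by (intro arg_cong2[of _ _ _ _ "(+)"] sum.cong refl)
         (use pq a(2) in \<open>simp_all add: cu cv cw\<close>)
    then show "mat n n (\<lambda>(p, q). (\<Sum>i<l. y (2 * i + 1) * (complex_part ?P ?Q y (i * n + p) * conj_part ?P ?Q y (i * n + q))) +
           (\<Sum>j<s. complex_part ?P ?Q y ((l + j) * n + p) * conj_part ?P ?Q y ((l + 2 * s + j) * n + q) +
              complex_part ?P ?Q y ((l + 2 * s + j) * n + p) * conj_part ?P ?Q y ((l + j) * n + q))) $$ (p, q) =
       (U * V) $$ (p, q)"
      using pq by (simp only: index_mat(1) prod.case)
  qed (use U V in auto)
  then show ?thesis by blast
qed

section \<open>Orders and degree of the determinant\<close>

lemma order_eigenfactor:
  "Polynomial.order \<mu> ([:1 - c * \<nu>, \<nu>:] :: complex poly) = (if 1 + (\<mu> - c) * \<nu> = 0 then 1 else 0)"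
proof (cases "1 + (\<mu> - c) * \<nu> = 0")
  case True
  then have "\<nu> \<noteq> 0" by auto
  have "1 - c * \<nu> = - (\<mu> * \<nu>)" by (rule eq_neg_iff_add_eq_0[THEN iffD2]) (use True in \<open>simp add: algebra_simps\<close>)
  then have eq: "[:1 - c * \<nu>, \<nu>:] = Polynomial.smult \<nu> [:-\<mu>, 1:]" by simp
  have "Polynomial.order \<mu> [:1 - c * \<nu>, \<nu>:] = Polynomial.order \<mu> ([:-\<mu>, 1:] ^ 1)"
    unfolding eq order_smult[OF \<open>\<nu> \<noteq> 0\<close>] power_one_right ..
  from trans[OF this order_power_n_n] show ?thesis unfolding if_P[OF True] .
next
  case False
  then have "poly [:1 - c * \<nu>, \<nu>:] \<mu> \<noteq> 0" by (simp add: algebra_simps)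
  then show ?thesis unfolding if_not_P[OF False] by (rule order_0I)
qed

lemma order_power_idom: "p \<noteq> 0 \<Longrightarrow> Polynomial.order x (p ^ k) = k * Polynomial.order x (p :: 'a::idom poly)"
  by (induct k) (simp_all add: order_mult order_1_eq_0)

lemma eigenfactor_nonzero: "[:1 - c * \<nu>, \<nu>:] \<noteq> (0 :: complex poly)"
  by auto

lemma order_eigenfactors:
  assumes "D = Polynomial.smult e (\<Prod>(k, \<nu>)\<leftarrow>bs. [:1 - c * \<nu>, \<nu>:] ^ k)" "e \<noteq> (0::complex)"
  shows "Polynomial.order \<mu> D = sum_list (block_sizes (eigenblock c (Finite \<mu>)) bs)"
proof -
  have "Polynomial.order \<mu> (\<Prod>(k, \<nu>)\<leftarrow>bs. [:1 - c * \<nu>, \<nu>:] ^ k) =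
      (\<Sum>(k, \<nu>)\<leftarrow>bs. if 1 + (\<mu> - c) * \<nu> = 0 then k else 0)"
  proof (induct bs)
    case (Cons t bs)
    obtain k \<nu> where t: "t = (k, \<nu>)" by (cases t)
    have nz: "(\<Prod>(k, \<nu>)\<leftarrow>bs. [:1 - c * \<nu>, \<nu>:] ^ k) \<noteq> 0" by (intro linear_power_list_nonzero eigenfactor_nonzero)
    have pk: "[:1 - c * \<nu>, \<nu>:] ^ k \<noteq> 0" by (rule power_not_zero[OF eigenfactor_nonzero])
    have "Polynomial.order \<mu> ([:1 - c * \<nu>, \<nu>:] ^ k * (\<Prod>(k, \<nu>)\<leftarrow>bs. [:1 - c * \<nu>, \<nu>:] ^ k)) =
      k * Polynomial.order \<mu> [:1 - c * \<nu>, \<nu>:] + Polynomial.order \<mu> (\<Prod>(k, \<nu>)\<leftarrow>bs. [:1 - c * \<nu>, \<nu>:] ^ k)"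
      by (simp only: order_mult[OF no_zero_divisors[OF pk nz]] order_power_idom[OF eigenfactor_nonzero])
    then show ?case using Cons t by (simp add: order_eigenfactor del: mult_pCons_left)
  qed (simp add: order_1_eq_0)
  with assms show ?thesis by (simp add: order_smult sum_list_block_sizes eigenblock_eq)
qed

lemma degree_eigenfactors:
  assumes "D = Polynomial.smult e (\<Prod>(k, \<nu>)\<leftarrow>bs. [:1 - c * \<nu>, \<nu>:] ^ k)" "e \<noteq> (0::complex)"
  shows "degree D + sum_list (block_sizes (eigenblock c Infinite) bs) = sum_list (map fst bs)"
proof -
  have "degree (\<Prod>(k, \<nu>)\<leftarrow>bs. [:1 - c * \<nu>, \<nu>:] ^ k) + (\<Sum>(k, \<nu>)\<leftarrow>bs. if \<nu> = 0 then k else 0) =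
      sum_list (map fst bs)"
  proof (induct bs)
    case (Cons t bs)
    obtain k \<nu> where t: "t = (k, \<nu>)" by (cases t)
    have nz: "(\<Prod>(k, \<nu>)\<leftarrow>bs. [:1 - c * \<nu>, \<nu>:] ^ k) \<noteq> 0" by (intro linear_power_list_nonzero eigenfactor_nonzero)
    have pk: "[:1 - c * \<nu>, \<nu>:] ^ k \<noteq> 0" by (rule power_not_zero[OF eigenfactor_nonzero])
    have "degree ([:1 - c * \<nu>, \<nu>:] ^ k * (\<Prod>(k, \<nu>)\<leftarrow>bs. [:1 - c * \<nu>, \<nu>:] ^ k)) =
      k * degree [:1 - c * \<nu>, \<nu>:] + degree (\<Prod>(k, \<nu>)\<leftarrow>bs. [:1 - c * \<nu>, \<nu>:] ^ k)"
      by (simp only: degree_mult_eq[OF pk nz] degree_power_eq[OF eigenfactor_nonzero] mult.commute[of k])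
    then show ?case using Cons t by (auto simp del: mult_pCons_left)
  qed simp
  with assms show ?thesis by (simp add: sum_list_block_sizes eigenblock_eq)
qed

lemma block_sizes_eq_Nil_iff: "block_sizes P bs = [] \<longleftrightarrow> (\<forall>(k, \<nu>)\<in>set bs. \<not> P \<nu>)"
proof -
  have "set (block_sizes P bs) = fst ` {(k, a) \<in> set bs. P a}" by (auto simp: block_sizes_def)
  then have "set (block_sizes P bs) = {} \<longleftrightarrow> (\<forall>(k, \<nu>)\<in>set bs. \<not> P \<nu>)" by auto
  then show ?thesis by (simp only: set_empty)
qed

lemma poly_power_list_zero:
  "0 \<notin> fst ` set bs \<Longrightarrow> poly (\<Prod>(k, \<nu>)\<leftarrow>bs. f \<nu> ^ k) z = 0 \<longleftrightarrow>
     (\<exists>(k, \<nu>)\<in>set bs. poly (f \<nu>) z = (0 :: complex))"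
  by (induct bs) auto

lemma pencil_eigenvalue_iff:
  assumes "jordan_pencil_form n L c bs"
  shows "pencil_eigenvalue L \<mu> \<longleftrightarrow> block_sizes (eigenblock c \<mu>) bs \<noteq> []"
proof -
  have pos: "0 \<notin> fst ` set bs" using assms by (simp add: jordan_pencil_form_def)
  have ne: "block_sizes P bs \<noteq> [] \<longleftrightarrow> (\<exists>(k, \<nu>)\<in>set bs. P \<nu>)" for P
    unfolding block_sizes_eq_Nil_iff by auto
  show ?thesis
  proof (cases \<mu>)
    case (Finite z)
    obtain d where "d \<noteq> 0" "pencil_det L = Polynomial.smult d (\<Prod>(k, \<nu>)\<leftarrow>bs. [:1 - c * \<nu>, \<nu>:] ^ k)"
      using jordan_pencil_form_det(1)[OF assms] by blast
    then have "poly (pencil_det L) z = 0 \<longleftrightarrow> (\<exists>(k, \<nu>)\<in>set bs. 1 + (z - c) * \<nu> = 0)"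
      by (simp add: poly_power_list_zero[OF pos] algebra_simps)
    then show ?thesis using Finite ne by simp
  next
    case Infinite
    obtain d where "d \<noteq> 0" "pencil_det (pencil_rev L) = Polynomial.smult d (\<Prod>(k, \<nu>)\<leftarrow>bs. [:\<nu>, 1 - c * \<nu>:] ^ k)"
      using jordan_pencil_form_det(2)[OF assms] by blast
    then have "poly (pencil_det (pencil_rev L)) 0 = 0 \<longleftrightarrow> (\<exists>(k, \<nu>)\<in>set bs. \<nu> = 0)"
      by (simp add: poly_power_list_zero[OF pos])
    then show ?thesis using Infinite ne by simp
  qed
qed

lemma prod_linear_powers_dvd:
  assumes "finite \<Lambda>" "\<And>\<mu>. \<mu> \<in> \<Lambda> \<Longrightarrow> e \<mu> \<le> Polynomial.order \<mu> p"
  shows "(\<Prod>\<mu>\<in>\<Lambda>. [:-\<mu>, 1:] ^ e \<mu>) dvd (p :: complex poly)"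
  using assms
proof (induct \<Lambda> rule: finite_induct)
  case (insert \<mu> \<Lambda>)
  let ?h = "\<Prod>\<mu>\<in>\<Lambda>. [:-\<mu>, 1:] ^ e \<mu>"
  from insert obtain t where t: "p = ?h * t" by (auto elim: dvdE)
  have "poly ?h \<mu> \<noteq> 0" using insert.hyps by (auto simp: poly_prod)
  moreover have "[:-\<mu>, 1:] ^ e \<mu> dvd ?h * t"
    using insert.prems[of \<mu>] t by (metis insertI1 order_divides)
  ultimately have "[:-\<mu>, 1:] ^ e \<mu> dvd t" by (rule linear_power_dvd_mult_cancel)
  then show ?case using insert.hyps t by (simp add: mult.commute mult_dvd_mono)
qed simp

lemma order_prod_linear_powers:
  assumes "finite \<Lambda>"
  shows "Polynomial.order \<mu> (\<Prod>\<mu>\<in>\<Lambda>. [:-\<mu>, 1:] ^ e \<mu> :: complex poly) = (if \<mu> \<in> \<Lambda> then e \<mu> else 0)"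
  using assms
proof (induct \<Lambda> rule: finite_induct)
  case empty
  show ?case by (simp add: order_1_eq_0)
next
  case (insert x \<Lambda>)
  have "[:-x, 1:] ^ e x * (\<Prod>\<mu>\<in>\<Lambda>. [:-\<mu>, 1:] ^ e \<mu>) \<noteq> 0" using insert.hyps by simp
  moreover have "Polynomial.order \<mu> ([:-x, 1:] ^ e x) = (if \<mu> = x then e x else 0)"
  proof (cases "\<mu> = x")
    case True
    then show ?thesis by (simp only: order_power_n_n simp_thms if_True)
  next
    case False
    then have "poly ([:-x, 1:] ^ e x) \<mu> \<noteq> 0" by simp
    then show ?thesis unfolding if_not_P[OF False] by (rule order_0I)
  qed
  ultimately show ?case using insert by (simp add: order_mult)
qed

section \<open>A perturbation with the generic behaviour\<close>

text \<open>For \<open>t = z - c \<noteq> 0\<close> the matrix \<open>I + t K\<close> is \<open>-t\<close> times \<open>(-1/t) I - K\<close>.\<close>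

lemma det_one_plus_charpoly_blocks:
  assumes K: "K \<in> carrier_mat n n" and cp: "char_poly K = charpoly_blocks bs"
  shows "det (pencil_mat (1\<^sub>m n - c \<cdot>\<^sub>m K, K)) = (\<Prod>(k, \<nu>)\<leftarrow>bs. [:1 - c * \<nu>, \<nu>:] ^ k)" (is "?D = ?P")
    and "sum_list (map fst bs) = n"
proof -
  have "degree (charpoly_blocks xs) = sum_list (map fst xs) \<and> charpoly_blocks xs \<noteq> 0" for xs
  proof (induct xs)
    case (Cons t xs)
    obtain k \<nu> where "t = (k, \<nu>)" by (cases t)
    moreover have "degree ([:-\<nu>, 1:] ^ k) = k" by (simp add: degree_power_eq)
    ultimately show ?case using Cons by (simp add: degree_mult_eq)
  qed simp
  then show n: "sum_list (map fst bs) = n" using degree_monic_char_poly[OF K] cp by simp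
  have J: "(1\<^sub>m n - c \<cdot>\<^sub>m K, K) \<in> pencil_carrier n" using K by (simp add: pencil_carrier_def minus_carrier_mat)
  have "poly ?D z = poly ?P z" if z: "z \<noteq> c" for z
  proof -
    define t where "t = z - c"
    have t: "t \<noteq> 0" using z by (simp add: t_def)
    let ?M = "1\<^sub>m n + t \<cdot>\<^sub>m K"
    have M: "?M \<in> carrier_mat n n" using K by simp
    have "poly ?D z = det ?M"
      by (rule poly_det_cong[OF M pencil_mat_carrier[OF J]])
         (use K in \<open>auto simp: pencil_mat_def t_def algebra_simps\<close>)
    also have "?M = (- t) \<cdot>\<^sub>m (- char_matrix K (- 1 / t))"
      using K t by (intro eq_matI) (auto simp: char_matrix_def field_simps)
    also have "det \<dots> = (- t) ^ n * det (- char_matrix K (- 1 / t))"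
      using char_matrix_closed[OF K, of "- 1 / t"] by (auto simp: det_smult)
    also have "det (- char_matrix K (- 1 / t)) = poly (charpoly_blocks bs) (- 1 / t)"
      using char_poly_matrix[OF K, of "- 1 / t"] cp by simp
    also have "(- t) ^ n * poly (charpoly_blocks bs) (- 1 / t) = (\<Prod>(k, \<nu>)\<leftarrow>bs. (1 + t * \<nu>) ^ k)"
      unfolding n[symmetric]
    proof (induct bs)
      case (Cons b bs)
      obtain k \<nu> where b: "b = (k, \<nu>)" by (cases b)
      have "(- t) * (- 1 / t - \<nu>) = 1 + t * \<nu>" using t by (simp add: field_simps)
      then have e1: "(- t) ^ k * (- 1 / t - \<nu>) ^ k = (1 + t * \<nu>) ^ k"
        by (simp only: power_mult_distrib[symmetric])
      have "poly [:-\<nu>, 1:] (- 1 / t) = - 1 / t - \<nu>" by simp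
      then have e2: "poly (charpoly_blocks (b # bs)) (- 1 / t) =
          (- 1 / t - \<nu>) ^ k * poly (charpoly_blocks bs) (- 1 / t)"
        by (simp only: b charpoly_blocks_simps poly_mult poly_power)
      have "(- t) ^ sum_list (map fst (b # bs)) * poly (charpoly_blocks (b # bs)) (- 1 / t) =
          ((- t) ^ k * (- 1 / t - \<nu>) ^ k) *
          ((- t) ^ sum_list (map fst bs) * poly (charpoly_blocks bs) (- 1 / t))"
        unfolding e2 by (simp only: b list.map sum_list.Cons fst_conv power_add mult_ac)
      then show ?case unfolding e1 Cons b by simp
    qed simp
    also have "\<dots> = poly ?P z"
      by (induct bs) (auto simp: t_def algebra_simps)
    finally show ?thesis .
  qed
  then have "- {c} \<subseteq> {z. poly (?D - ?P) z = 0}" by auto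
  moreover have "infinite (- {c})" using infinite_UNIV_char_0 by (simp add: Compl_eq_Diff_UNIV)
  ultimately have "?D - ?P = 0" using poly_roots_finite finite_subset by blast
  then show "?D = ?P" by simp
qed

lemma charpoly_blocks_append:
  "charpoly_blocks (xs @ ys) = charpoly_blocks xs * charpoly_blocks ys"
  by (simp add: charpoly_blocks_def)

lemma charpoly_blocks_simple: "charpoly_blocks (map (\<lambda>a. (1, a)) rs) = (\<Prod>a\<leftarrow>rs. [:- a, 1:])"
  by (simp add: charpoly_blocks_def o_def)

text \<open>The new eigenvalues \<open>rs\<close> of \<open>J + U V\<close> are chosen outside the spectrum of \<open>J\<close> and different from 0: the
perturbed pencil then has them neither at eigenvalues of \<open>L\<close> nor at infinity.\<close>

lemma generic_perturbation_exists:
  assumes L: "jordan_pencil_form n L c bs" and s: "s \<le> r div 2"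
  obtains y e bs' rs where "e \<noteq> 0" "distinct rs" "set rs \<inter> insert 0 (snd ` set bs) = {}" "set bs' \<subseteq> set bs"
    "\<forall>\<nu>. block_sizes (\<lambda>x. x = \<nu>) bs' = drop r (block_sizes (\<lambda>x. x = \<nu>) bs)"
    "sum_list (map fst (bs' @ map (\<lambda>a. (1, a)) rs)) = n"
    "pencil_det (pencil_add L (Phi_complexified n r s y)) = Polynomial.smult e
       (\<Prod>(k, \<nu>)\<leftarrow>bs' @ map (\<lambda>a. (1, a)) rs. [:1 - c * \<nu>, \<nu>:] ^ k)"
proof -
  have pos: "0 \<notin> fst ` set bs" and n: "sum_list (map fst bs) = n" and Lc: "L \<in> pencil_carrier n"
    using L by (auto simp: jordan_pencil_form_def pencil_equiv_def)
  obtain U V rs bs' where *: "U \<in> carrier_mat n r" "V \<in> carrier_mat r n" "distinct rs"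
    "set rs \<inter> insert 0 (snd ` set bs) = {}" "set bs' \<subseteq> set bs"
    "char_poly (jordan_matrix bs + U * V) = charpoly_blocks bs' * (\<Prod>a\<leftarrow>rs. [:- a, 1:])"
    "\<forall>\<nu>. block_sizes (\<lambda>x. x = \<nu>) bs' = drop r (block_sizes (\<lambda>x. x = \<nu>) bs)"
    using jordan_matrix_low_rank_perturbation[OF pos, of "insert 0 (snd ` set bs)" r] n by auto
  let ?J = "jordan_matrix bs" and ?bs = "bs' @ map (\<lambda>a. (1, a)) rs"
  let ?K = "?J + U * V"
  have J: "?J \<in> carrier_mat n n" using n by auto
  have UV: "U * V \<in> carrier_mat n n" using * by auto
  have K: "?K \<in> carrier_mat n n" using J UV by auto
  have "char_poly ?K = charpoly_blocks ?bs"
    using *(6) by (simp only: charpoly_blocks_append charpoly_blocks_simple)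
  note D = det_one_plus_charpoly_blocks[OF K this]
  obtain P Q where PQ: "P \<in> carrier_mat n n" "Q \<in> carrier_mat n n" "invertible_mat P" "invertible_mat Q"
    "P * fst L * Q = 1\<^sub>m n - c \<cdot>\<^sub>m ?J" "P * snd L * Q = ?J"
    using L unfolding jordan_pencil_form_def pencil_equiv_def by auto
  obtain P' where P': "P' \<in> carrier_mat n n" "P' * P = 1\<^sub>m n" "P * P' = 1\<^sub>m n" using inverse_matE[OF PQ(1,3)] .
  obtain Q' where Q': "Q' \<in> carrier_mat n n" "Q' * Q = 1\<^sub>m n" "Q * Q' = 1\<^sub>m n" using inverse_matE[OF PQ(2,4)] .
  let ?U = "P' * U" and ?V = "V * Q'"
  have UV': "?U \<in> carrier_mat n r" "?V \<in> carrier_mat r n" using * P' Q' by auto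
  obtain y where y: "Phi_complexified n r s y = ((- c) \<cdot>\<^sub>m (?U * ?V), ?U * ?V)"
    using Phi_complexified_surj_low_rank[OF s UV'] by blast
  let ?E = "Phi_complexified n r s y"
  have X: "?U * ?V \<in> carrier_mat n n" using UV' by auto
  have PX: "P * (?U * ?V) * Q = U * V"
  proof -
    have "P * ?U = U" using assoc_mult_mat[OF PQ(1) P'(1) *(1)] P'(3) *(1) by simp
    moreover have "?V * Q = V" using assoc_mult_mat[OF *(2) Q'(1) PQ(2)] Q'(2) *(2) by simp
    moreover have "P * (?U * ?V) * Q = (P * ?U) * (?V * Q)"
      using assoc_mult_mat[OF PQ(1) UV'] assoc_mult_mat[OF mult_carrier_mat[OF PQ(1) UV'(1)] UV'(2) PQ(2)] by simp
    ultimately show ?thesis by simp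
  qed
  have Lf: "fst L \<in> carrier_mat n n" "snd L \<in> carrier_mat n n" using Lc by (auto simp: pencil_carrier_def)
  have conj_add: "P * (A + B) * Q = P * A * Q + P * B * Q" if "A \<in> carrier_mat n n" "B \<in> carrier_mat n n" for A B
    using mult_add_distrib_mat[OF PQ(1) that] add_mult_distrib_mat[OF mult_carrier_mat[OF PQ(1) that(1)]
      mult_carrier_mat[OF PQ(1) that(2)] PQ(2)] by simp
  have conj_smult: "P * ((- c) \<cdot>\<^sub>m (?U * ?V)) * Q = (- c) \<cdot>\<^sub>m (U * V)"
    using mult_smult_distrib[OF PQ(1) X, of "- c"] mult_smult_assoc_mat[OF mult_carrier_mat[OF PQ(1) X] PQ(2), of "- c"] PX
    by simp
  have M: "pencil_add L ?E \<in> pencil_carrier n"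
    using Lf X by (auto simp: pencil_add_def pencil_carrier_def y)
  have "P * fst (pencil_add L ?E) * Q = 1\<^sub>m n - c \<cdot>\<^sub>m ?K"
  proof -
    have "P * fst (pencil_add L ?E) * Q = (1\<^sub>m n - c \<cdot>\<^sub>m ?J) + (- c) \<cdot>\<^sub>m (U * V)"
      unfolding pencil_add_def y fst_conv using conj_add[OF Lf(1), of "(- c) \<cdot>\<^sub>m (?U * ?V)"] X conj_smult PQ(5) by simp
    also have "\<dots> = 1\<^sub>m n - c \<cdot>\<^sub>m ?K" using n *(1,2) by (intro eq_matI) (auto simp: algebra_simps)
    finally show ?thesis .
  qed
  moreover have "P * snd (pencil_add L ?E) * Q = ?K"
    unfolding pencil_add_def y snd_conv using conj_add[OF Lf(2) X] PX PQ(6) by simp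
  ultimately have "const_mat P * pencil_mat (pencil_add L ?E) * const_mat Q = pencil_mat (1\<^sub>m n - c \<cdot>\<^sub>m ?K, ?K)"
    using PQ(1,2) by (intro pencil_mat_equiv[OF M]) auto
  then have "det (const_mat P * pencil_mat (pencil_add L ?E) * const_mat Q) =
      (\<Prod>(k, \<nu>)\<leftarrow>?bs. [:1 - c * \<nu>, \<nu>:] ^ k)" by (simp only: D(1))
  moreover have "det (const_mat P * pencil_mat (pencil_add L ?E) * const_mat Q) =
      Polynomial.smult (det P * det Q) (pencil_det (pencil_add L ?E))"
    using pencil_mat_carrier[OF M] PQ(1,2)
    by (simp add: det_mult[of _ n] det_const_mat pencil_det_eq mult.commute)
  moreover have d: "det P * det Q \<noteq> 0" using invertible_mat_det_nonzero PQ by auto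
  ultimately have "pencil_det (pencil_add L ?E) =
      Polynomial.smult (inverse (det P * det Q)) (\<Prod>(k, \<nu>)\<leftarrow>?bs. [:1 - c * \<nu>, \<nu>:] ^ k)"
    by (metis left_inverse smult_1_left smult_smult)
  moreover have "inverse (det P * det Q) \<noteq> 0" using d by simp
  ultimately show ?thesis by (intro that[of _ rs bs' y] *(3,4,5,7) D(2))
qed

section \<open>Perturbed pencils\<close>

lemma pencil_add_carrier:
  "L \<in> pencil_carrier n \<Longrightarrow> E \<in> pencil_carrier n \<Longrightarrow> pencil_add L E \<in> pencil_carrier n"
  by (auto simp: pencil_add_def pencil_carrier_def)

lemma pencil_rev_add: "pencil_rev (pencil_add L E) = pencil_add (pencil_rev L) (pencil_rev E)"
  by (simp add: pencil_rev_def pencil_add_def)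

lemma pencil_mat_add:
  "L \<in> pencil_carrier n \<Longrightarrow> E \<in> pencil_carrier n \<Longrightarrow>
     pencil_mat (pencil_add L E) = pencil_mat L + pencil_mat E"
  unfolding pencil_mat_def pencil_add_def pencil_carrier_def by (intro eq_matI) auto

lemma pencil_mat_add_on_kernel:
  assumes L: "L \<in> pencil_carrier n" and E: "E \<in> pencil_carrier n" and y: "y \<in> carrier_vec n"
    and "pencil_mat E *\<^sub>v y = 0\<^sub>v n"
  shows "pencil_mat (pencil_add L E) *\<^sub>v y = pencil_mat L *\<^sub>v y"
  unfolding pencil_mat_add[OF L E]
    add_mult_distrib_mat_vec[OF pencil_mat_carrier[OF L] pencil_mat_carrier[OF E] y] assms(4)
  by (rule right_zero_vec[OF mult_mat_vec_carrier[OF pencil_mat_carrier[OF L] y]])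

lemma perturbed_count_ge:
  assumes L: "jordan_pencil_form n L c bs" and E: "E \<in> pencil_carrier n"
    and rank: "sum_of_products n r (pencil_mat E)" "sum_of_products n r (pencil_mat (pencil_rev E))"
    and M: "jordan_pencil_form n (pencil_add L E) c' bs'" and k: "k > 0"
  shows "count_ge k (block_sizes (eigenblock c \<mu>) bs) \<le> count_ge k (block_sizes (eigenblock c' \<mu>) bs') + r"
proof -
  have Lc: "L \<in> pencil_carrier n" using L by (simp add: jordan_pencil_form_def pencil_equiv_def)
  obtain vs where vs: "set vs \<subseteq> carrier_vec n" "length vs \<le> r"
    "\<forall>y\<in>carrier_vec n. (\<forall>v\<in>set vs. v \<bullet> y = 0) \<longrightarrow> pencil_mat E *\<^sub>v y = 0\<^sub>v n"
    using sum_of_products_kernel[OF rank(1)] .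
  obtain vs' where vs': "set vs' \<subseteq> carrier_vec n" "length vs' \<le> r"
    "\<forall>y\<in>carrier_vec n. (\<forall>v\<in>set vs'. v \<bullet> y = 0) \<longrightarrow> pencil_mat (pencil_rev E) *\<^sub>v y = 0\<^sub>v n"
    using sum_of_products_kernel[OF rank(2)] .
  show ?thesis
  proof (rule partial_mults_interlacing[OF L M vs(1) vs'(1) vs(2) vs'(2) _ _ k])
    fix y assume y: "y \<in> carrier_vec n" "\<And>v. v \<in> set vs \<Longrightarrow> v \<bullet> y = 0"
    show "pencil_mat (pencil_add L E) *\<^sub>v y = pencil_mat L *\<^sub>v y"
      using vs(3) y by (intro pencil_mat_add_on_kernel[OF Lc E y(1)]) blast
  next
    fix y assume y: "y \<in> carrier_vec n" "\<And>v. v \<in> set vs' \<Longrightarrow> v \<bullet> y = 0"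
    show "pencil_mat (pencil_rev (pencil_add L E)) *\<^sub>v y = pencil_mat (pencil_rev L) *\<^sub>v y"
      unfolding pencil_rev_add
      using vs'(3) y
      by (intro pencil_mat_add_on_kernel[OF pencil_rev_carrier[OF Lc] pencil_rev_carrier[OF E] y(1)]) blast
  qed
qed

lemma jordan_pencil_form_order_degree:
  assumes "jordan_pencil_form n M c bs"
  shows "Polynomial.order \<mu> (pencil_det M) = sum_list (block_sizes (eigenblock c (Finite \<mu>)) bs)"
    and "degree (pencil_det M) + sum_list (block_sizes (eigenblock c Infinite) bs) = n"
proof -
  obtain e where e: "e \<noteq> 0" "pencil_det M = Polynomial.smult e (\<Prod>(k, \<nu>)\<leftarrow>bs. [:1 - c * \<nu>, \<nu>:] ^ k)"
    using jordan_pencil_form_det(1)[OF assms] by blast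
  show "Polynomial.order \<mu> (pencil_det M) = sum_list (block_sizes (eigenblock c (Finite \<mu>)) bs)"
    by (rule order_eigenfactors[OF e(2,1)])
  show "degree (pencil_det M) + sum_list (block_sizes (eigenblock c Infinite) bs) = n"
    using degree_eigenfactors[OF e(2,1)] assms by (simp add: jordan_pencil_form_def)
qed

text \<open>The order of the determinant at \<open>\<mu>\<close> is the sum of the partial multiplicities, and the multiplicity of infinity
is the defect of the degree. Both bounds are sums of the interlacing inequalities.\<close>

lemma perturbed_algebraic_multiplicity_ge:
  assumes L: "jordan_pencil_form n L c bs" and E: "E \<in> pencil_carrier n"
    and rank: "sum_of_products n r (pencil_mat E)" "sum_of_products n r (pencil_mat (pencil_rev E))"
    and reg: "regular_pencil (pencil_add L E)"
  shows "sum_list (drop r (block_sizes (eigenblock c (Finite \<mu>)) bs)) \<le>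
      Polynomial.order \<mu> (pencil_det (pencil_add L E))"
    and "degree (pencil_det (pencil_add L E)) + sum_list (drop r (block_sizes (eigenblock c Infinite) bs)) \<le> n"
proof -
  have Lc: "L \<in> pencil_carrier n" using L by (simp add: jordan_pencil_form_def pencil_equiv_def)
  obtain c' bs' where M: "jordan_pencil_form n (pencil_add L E) c' bs'"
    using jordan_pencil_form_exists[OF pencil_add_carrier[OF Lc E] reg] by blast
  have "sum_list (drop r (block_sizes (eigenblock c \<mu>) bs)) \<le> sum_list (block_sizes (eigenblock c' \<mu>) bs')" for \<mu>
    by (rule sum_list_drop_le_of_count_ge[OF block_sizes_sorted perturbed_count_ge[OF L E rank M]])
  from this[of "Finite \<mu>"] this[of Infinite] jordan_pencil_form_order_degree[OF M]
  show "sum_list (drop r (block_sizes (eigenblock c (Finite \<mu>)) bs)) \<le>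
      Polynomial.order \<mu> (pencil_det (pencil_add L E))"
    "degree (pencil_det (pencil_add L E)) + sum_list (drop r (block_sizes (eigenblock c Infinite) bs)) \<le> n"
    by (simp, metis add_le_cancel_left)
qed

lemma perturbed_partial_mults:
  assumes L: "jordan_pencil_form n L c bs" and E: "E \<in> pencil_carrier n"
    and rank: "sum_of_products n r (pencil_mat E)" "sum_of_products n r (pencil_mat (pencil_rev E))"
    and M: "jordan_pencil_form n (pencil_add L E) c' bs'"
    and le: "sum_list (block_sizes (eigenblock c' \<mu>) bs') \<le> sum_list (drop r (block_sizes (eigenblock c \<mu>) bs))"
  shows "block_sizes (eigenblock c' \<mu>) bs' = drop r (block_sizes (eigenblock c \<mu>) bs)"
proof -
  have pos: "0 \<notin> fst ` set bs" "0 \<notin> fst ` set bs'" using L M by (simp_all add: jordan_pencil_form_def)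
  show ?thesis
    by (rule eq_drop_of_count_ge[OF block_sizes_sorted block_sizes_nonzero[OF pos(1)] block_sizes_sorted
        block_sizes_nonzero[OF pos(2)] perturbed_count_ge[OF L E rank M] le])
qed

section \<open>Generic perturbations\<close>

theorem theorem17:
  fixes n r s \<kappa> :: nat and L :: pencil
    and ev :: "nat \<Rightarrow> eigval" and ns :: "nat \<Rightarrow> nat list"
  assumes "L \<in> pencil_carrier n"
    and "hermitian_pencil L"
    and "regular_pencil L"
    and "inj_on ev {1..\<kappa>}"
    and "ev ` {1..\<kappa>} = {\<mu>. pencil_eigenvalue L \<mu>}"
    and "\<And>i. i \<in> {1..\<kappa>} \<Longrightarrow> has_partial_mults L (ev i) (ns i)"
    and "r > 0"
    and "s \<le> r div 2"
  shows "\<exists>G. generic_real_complex (2 * (r - 2 * s)) ((r + s) * n) G \<and>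
           (\<forall>E \<in> Phi n r s ` G.
              regular_pencil (pencil_add L E) \<and>
              (\<forall>i\<in>{1..\<kappa>}.
                 has_partial_mults (pencil_add L E) (ev i) (drop r (ns i)) \<and>
                 (length (ns i) \<le> r \<longrightarrow> \<not> pencil_eigenvalue (pencil_add L E) (ev i))) \<and>
              (\<forall>\<mu>. pencil_eigenvalue (pencil_add L E) \<mu> \<and> \<not> pencil_eigenvalue L \<mu> \<longrightarrow>
                 simple_eigenvalue (pencil_add L E) \<mu>))"
proof -
  note s = assms(8)
  obtain c bs where L: "jordan_pencil_form n L c bs" using jordan_pencil_form_exists[OF assms(1,3)] by blast
  define sz where "sz \<mu> = block_sizes (eigenblock c \<mu>) bs" for \<mu>
  define a where "a \<mu> = sum_list (drop r (sz \<mu>))" for \<mu>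
  define \<Lambda> where "\<Lambda> = {\<mu>. poly (pencil_det L) \<mu> = 0}"
  have fin: "finite \<Lambda>" unfolding \<Lambda>_def using assms(3) by (intro poly_roots_finite) (simp add: regular_pencil_def)
  \<comment> \<open>\<open>h\<close> is the part of the determinant that no admissible perturbation can remove.\<close>
  define h where "h = (\<Prod>\<mu>\<in>\<Lambda>. [:-\<mu>, 1:] ^ a (Finite \<mu>))"
  have h0: "h \<noteq> 0" using fin by (simp add: h_def)
  have ordh: "Polynomial.order \<mu> h = (if \<mu> \<in> \<Lambda> then a (Finite \<mu>) else 0)" for \<mu>
    unfolding h_def by (rule order_prod_linear_powers[OF fin])
  define d where "d = n - a Infinite - degree h"
  define E where "E y = Phi_complexified n r s y" for y
  define D where "D y = pencil_det (pencil_add L (E y))" for y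
  define q where "q y = D y div h" for y
  have Ec: "E y \<in> pencil_carrier n" for y unfolding E_def by (rule Phi_complexified_carrier)
  have rank: "sum_of_products n r (pencil_mat (E y))" "sum_of_products n r (pencil_mat (pencil_rev (E y)))" for y
    unfolding E_def by (rule Phi_complexified_sum_of_products[OF s])+
  have D_reg: "regular_pencil (pencil_add L (E y)) \<longleftrightarrow> D y \<noteq> 0" for y
    by (simp add: regular_pencil_def D_def)
  have ord_ge: "a (Finite \<mu>) \<le> Polynomial.order \<mu> (D y)" and deg_le: "degree (D y) + a Infinite \<le> n"
    if "D y \<noteq> 0" for y \<mu>
    using perturbed_algebraic_multiplicity_ge(1)[OF L Ec[of y] rank[of y], of \<mu>]
      perturbed_algebraic_multiplicity_ge(2)[OF L Ec[of y] rank[of y]] that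
    by (simp_all add: D_reg a_def sz_def D_def[symmetric])
  have "h dvd D y" for y
  proof (cases "D y = 0")
    case False
    then show ?thesis unfolding h_def by (intro prod_linear_powers_dvd fin ord_ge)
  qed simp
  then have Dq: "D y = h * q y" for y by (simp add: q_def)
  have degq: "degree (q y) \<le> d" for y
  proof (cases "D y = 0")
    case False
    then have "degree (D y) = degree h + degree (q y)" using Dq[of y] by (metis degree_mult_eq mult_eq_0_iff)
    with deg_le[OF False] show ?thesis by (simp add: d_def)
  qed (simp add: q_def)
  have degD: "degree (D y) \<le> n" for y
    using deg_le[of y] by (cases "D y = 0") auto
  have degq': "degree (pderiv (q y)) \<le> d - 1" for y using degq[of y] by (simp add: degree_pderiv)
  define N where "N = 2 * (r - 2 * s) + 2 * ((r + s) * n)"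
  \<comment> \<open>The factors prevent a drop of the degree (that is, an excess multiplicity at infinity), multiple roots
    of \<open>q\<close>, and an excess multiplicity at the old eigenvalues.\<close>
  define F where "F y = coeff (q y) d * det (sylvester_formal d (q y) (pderiv (q y))) *
    (\<Prod>\<mu>\<in>\<Lambda>. poly (q y) \<mu>)" for y
  have F: "F \<in> polyfun N"
  proof -
    have "D \<in> polyfun_poly N" unfolding D_def E_def N_def by (rule pencil_det_add_polyfun[OF assms(1) s])
    then have q: "(\<lambda>y. q y) \<in> polyfun_poly N" unfolding q_def by (rule polyfun_poly_div[OF _ degD])
    have row: "(\<lambda>y. shifted_row d (q y) (pderiv (q y)) i) \<in> polyfun_poly N" for i
      unfolding shifted_row_def using polyfun_poly_mult[OF polyfun_poly_const q]
        polyfun_poly_mult[OF polyfun_poly_const polyfun_poly_pderiv[OF q]] by (cases "i < d - 1") simp_all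
    have "(\<lambda>y. det (sylvester_formal d (q y) (pderiv (q y)))) \<in> polyfun N"
    proof (rule polyfun_det[OF sylvester_formal_carrier])
      fix i j assume "i < 2 * d - 1" "j < 2 * d - 1"
      then show "(\<lambda>y. sylvester_formal d (q y) (pderiv (q y)) $$ (i, j)) \<in> polyfun N"
        using row[of i] by (simp add: sylvester_formal_def polyfun_poly_def)
    qed
    moreover have "(\<lambda>y. coeff (q y) d) \<in> polyfun N" using q by (simp add: polyfun_poly_def)
    moreover have "(\<lambda>y. \<Prod>\<mu>\<in>\<Lambda>. poly (q y) \<mu>) \<in> polyfun N"
      by (intro polyfun_prod polyfun_poly_eval[OF q degq])
    ultimately have "(\<lambda>y. F y) \<in> polyfun N" unfolding F_def by (intro polyfun.mult)
    then show ?thesis by simp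
  qed
  obtain y0 where "F y0 \<noteq> 0"
  proof -
    obtain y e bs' rs where ex: "e \<noteq> 0" "distinct rs" "set rs \<inter> insert 0 (snd ` set bs) = {}" "set bs' \<subseteq> set bs"
      "\<forall>\<nu>. block_sizes (\<lambda>x. x = \<nu>) bs' = drop r (block_sizes (\<lambda>x. x = \<nu>) bs)"
      "sum_list (map fst (bs' @ map (\<lambda>a. (1, a)) rs)) = n"
      "pencil_det (pencil_add L (Phi_complexified n r s y)) = Polynomial.smult e
         (\<Prod>(k, \<nu>)\<leftarrow>bs' @ map (\<lambda>a. (1, a)) rs. [:1 - c * \<nu>, \<nu>:] ^ k)"
      using generic_perturbation_exists[OF L s] .
    let ?bs = "bs' @ map (\<lambda>a. (1, a)) rs"
    note Dy = ex(7)[folded E_def, folded D_def]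
    have "(\<Prod>(k, \<nu>)\<leftarrow>?bs. [:1 - c * \<nu>, \<nu>:] ^ k) \<noteq> 0"
      by (intro linear_power_list_nonzero eigenfactor_nonzero)
    then have D0: "D y \<noteq> 0" unfolding Dy smult_eq_0_iff using ex(1) by blast
    have q0: "q y \<noteq> 0" using D0 Dq[of y] by auto
    have rs_part: "sum_list (block_sizes P ?bs) = sum_list (block_sizes P bs') + length (filter P rs)" for P
      by (induct rs) (auto simp: sum_list_block_sizes o_def)
    have at_block: "sum_list (block_sizes P ?bs) = sum_list (drop r (block_sizes P bs))"
      if P: "P = (\<lambda>x. x = \<nu>)" and "\<nu> \<notin> set rs" for P \<nu>
    proof -
      have "filter P rs = []" using that by (auto simp: filter_empty_conv)
      then show ?thesis unfolding rs_part using ex(5) P by simp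
    qed
    have "degree (D y) + a Infinite = n"
      using degree_eigenfactors[OF Dy ex(1)] ex(3,6) at_block[OF eigenblock_eq(2)]
      by (simp add: a_def sz_def)
    moreover have "degree (D y) = degree h + degree (q y)" using Dq[of y] h0 q0 by (simp add: degree_mult_eq)
    ultimately have dq: "degree (q y) = d" by (simp add: d_def)
    have ordD: "Polynomial.order \<mu> (D y) = a (Finite \<mu>)" if "\<mu> \<in> \<Lambda>" for \<mu>
    proof -
      have "pencil_eigenvalue L (Finite \<mu>)" using that by (simp add: \<Lambda>_def)
      then obtain k \<nu> where \<nu>: "(k, \<nu>) \<in> set bs" "1 + (\<mu> - c) * \<nu> = 0"
        unfolding pencil_eigenvalue_iff[OF L] block_sizes_eq_Nil_iff by auto
      have "1 + (\<mu> - c) * x = 0 \<longleftrightarrow> x = \<nu>" for x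
        using \<nu>(2) by (metis add_left_cancel mult_cancel_left mult_zero_left add.right_neutral zero_neq_one)
      then have "eigenblock c (Finite \<mu>) = (\<lambda>x. x = \<nu>)" by (simp add: eigenblock_eq)
      moreover have "\<nu> \<notin> set rs" using ex(3) \<nu>(1) by force
      ultimately show ?thesis
        unfolding order_eigenfactors[OF Dy ex(1)] a_def sz_def by (rule at_block)
    qed
    have ordq: "Polynomial.order \<mu> (D y) = Polynomial.order \<mu> h + Polynomial.order \<mu> (q y)" for \<mu>
      using Dq[of y] D0 by (simp add: order_mult)
    have q\<Lambda>: "Polynomial.order \<mu> (q y) = 0" if "\<mu> \<in> \<Lambda>" for \<mu>
      using ordq[of \<mu>] ordD[OF that] ordh[of \<mu>] that by simp
    have simple: "Polynomial.order \<mu> (q y) \<le> 1" for \<mu>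
    proof (cases "\<mu> \<in> \<Lambda>")
      case False
      have no: "\<not> eigenblock c (Finite \<mu>) \<nu>" if "(k, \<nu>) \<in> set bs" for k \<nu>
        using False that unfolding \<Lambda>_def mem_Collect_eq pencil_eigenvalue.simps[symmetric] pencil_eigenvalue_iff[OF L]
          block_sizes_eq_Nil_iff by auto
      then have "block_sizes (eigenblock c (Finite \<mu>)) bs' = []"
        using ex(4) unfolding block_sizes_eq_Nil_iff by auto
      then have "Polynomial.order \<mu> (q y) \<le> length (filter (eigenblock c (Finite \<mu>)) rs)"
        using ordq[of \<mu>] order_eigenfactors[OF Dy ex(1), of \<mu>, unfolded rs_part] by simp
      also have "\<dots> = card (set (filter (eigenblock c (Finite \<mu>)) rs))"
        using ex(2) by (simp only: distinct_card distinct_filter)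
      also have "\<dots> \<le> card {- 1 / (\<mu> - c)}"
      proof (rule card_mono)
        show "set (filter (eigenblock c (Finite \<mu>)) rs) \<subseteq> {- 1 / (\<mu> - c)}"
        proof
          fix x assume "x \<in> set (filter (eigenblock c (Finite \<mu>)) rs)"
          then have x: "1 + (\<mu> - c) * x = 0" by simp
          then have "\<mu> - c \<noteq> 0" by auto
          moreover have "(\<mu> - c) * x = - 1" using x by (simp add: eq_neg_iff_add_eq_0 add.commute)
          ultimately have "x = - 1 / (\<mu> - c)" by (metis nonzero_mult_div_cancel_left)
          then show "x \<in> {- 1 / (\<mu> - c)}" by simp
        qed
      qed simp
      finally show ?thesis by simp
    qed (simp add: q\<Lambda>)
    note roots = card_simple_roots[OF q0 simple]
    have "coeff (q y) d \<noteq> 0" using q0 dq by (metis leading_coeff_0_iff)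
    moreover have "det (sylvester_formal d (q y) (pderiv (q y))) \<noteq> 0"
      using roots dq by (intro sylvester_formal_det_nonzero degq degq' q0) auto
    moreover have "(\<Prod>\<mu>\<in>\<Lambda>. poly (q y) \<mu>) \<noteq> 0"
      using q\<Lambda> q0 fin by (simp add: order_root)
    ultimately show ?thesis using that[of y] by (simp add: F_def)
  qed
  define G where "G = {(x, z) \<in> carrier_vec (2 * (r - 2 * s)) \<times> carrier_vec ((r + s) * n).
     F (\<lambda>i. of_real (realify (x, z) $ i)) \<noteq> 0}"
  have gen: "generic_real_complex (2 * (r - 2 * s)) ((r + s) * n) G"
    unfolding G_def by (rule generic_real_complex_nonvanishing[OF F[unfolded N_def] \<open>F y0 \<noteq> 0\<close>])
  have main: "regular_pencil (pencil_add L (E y)) \<and>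
      (\<forall>i\<in>{1..\<kappa>}. has_partial_mults (pencil_add L (E y)) (ev i) (drop r (ns i)) \<and>
         (length (ns i) \<le> r \<longrightarrow> \<not> pencil_eigenvalue (pencil_add L (E y)) (ev i))) \<and>
      (\<forall>\<mu>. pencil_eigenvalue (pencil_add L (E y)) \<mu> \<and> \<not> pencil_eigenvalue L \<mu> \<longrightarrow>
         simple_eigenvalue (pencil_add L (E y)) \<mu>)" if Fy: "F y \<noteq> 0" for y
  proof -
    have lead: "coeff (q y) d \<noteq> 0" and syl: "det (sylvester_formal d (q y) (pderiv (q y))) \<noteq> 0"
      and nz: "\<And>\<mu>. \<mu> \<in> \<Lambda> \<Longrightarrow> poly (q y) \<mu> \<noteq> 0"
      using Fy fin by (auto simp: F_def)
    have q0: "q y \<noteq> 0" using lead by auto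
    have D0: "D y \<noteq> 0" using Dq[of y] q0 h0 by simp
    then have reg: "regular_pencil (pencil_add L (E y))" by (simp add: D_reg)
    obtain c' bs' where M: "jordan_pencil_form n (pencil_add L (E y)) c' bs'"
      using jordan_pencil_form_exists[OF pencil_add_carrier[OF assms(1) Ec] reg] by blast
    define sz' where "sz' \<mu> = block_sizes (eigenblock c' \<mu>) bs'" for \<mu>
    have ord: "sum_list (sz' (Finite \<mu>)) = Polynomial.order \<mu> h + Polynomial.order \<mu> (q y)" for \<mu>
      using jordan_pencil_form_order_degree(1)[OF M, of \<mu>] Dq[of y] D0
      by (simp add: sz'_def D_def[symmetric] order_mult)
    have inf: "sum_list (sz' Infinite) \<le> a Infinite"
    proof -
      have "d \<le> degree (q y)" using lead by (rule le_degree)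
      moreover have "degree (D y) = degree h + degree (q y)" using Dq[of y] h0 q0 by (simp add: degree_mult_eq)
      moreover have "degree (D y) + sum_list (sz' Infinite) = n"
        using jordan_pencil_form_order_degree(2)[OF M] by (simp add: D_def sz'_def)
      ultimately show ?thesis by (simp add: d_def)
    qed
    have drop_eq: "sz' \<mu> = drop r (sz \<mu>)" if "sum_list (sz' \<mu>) \<le> a \<mu>" for \<mu>
      unfolding sz'_def sz_def
      by (rule perturbed_partial_mults[OF L Ec rank M]) (use that in \<open>simp add: a_def sz_def sz'_def\<close>)
    have old: "sz' \<mu> = drop r (sz \<mu>)" if "pencil_eigenvalue L \<mu> \<or> \<mu> = Infinite" for \<mu>
    proof (cases \<mu>)
      case (Finite z)
      with that have z: "z \<in> \<Lambda>" by (simp add: \<Lambda>_def)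
      have "Polynomial.order z (q y) = 0" using nz[OF z] by (rule order_0I)
      then show ?thesis using ord[of z] ordh[of z] z Finite by (intro drop_eq) simp
    next
      case Infinite
      then show ?thesis using inf by (intro drop_eq) simp
    qed
    have "has_partial_mults (pencil_add L (E y)) (ev i) (drop r (ns i)) \<and>
         (length (ns i) \<le> r \<longrightarrow> \<not> pencil_eigenvalue (pencil_add L (E y)) (ev i))" if i: "i \<in> {1..\<kappa>}" for i
    proof -
      have "ns i = sz (ev i)" using assms(6)[OF i] has_partial_mults_iff[OF L] by (simp add: sz_def)
      moreover have "pencil_eigenvalue L (ev i)" using assms(5) i by blast
      ultimately have "sz' (ev i) = drop r (ns i)" using old by simp
      then show ?thesis
        using has_partial_mults_iff[OF M, of "ev i"] pencil_eigenvalue_iff[OF M, of "ev i"] by (simp add: sz'_def)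
    qed
    moreover have "simple_eigenvalue (pencil_add L (E y)) \<mu>"
      if new: "pencil_eigenvalue (pencil_add L (E y)) \<mu>" "\<not> pencil_eigenvalue L \<mu>" for \<mu>
    proof -
      have "sz \<mu> = []" "sz' \<mu> \<noteq> []"
        using new pencil_eigenvalue_iff[OF L] pencil_eigenvalue_iff[OF M] by (auto simp: sz_def sz'_def)
      then have "\<mu> \<noteq> Infinite" using old[of \<mu>] by auto
      then obtain z where \<mu>: "\<mu> = Finite z" by (cases \<mu>) auto
      with new have z: "z \<notin> \<Lambda>" "poly (D y) z = 0" by (simp_all add: \<Lambda>_def D_def)
      have "Polynomial.order z h = 0" using ordh z by simp
      then have "poly h z \<noteq> 0" using h0 by (simp add: order_root)
      then have qz: "poly (q y) z = 0" using z(2) Dq[of y] by simp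
      have "d > 0"
      proof (rule ccontr)
        assume "\<not> d > 0"
        then have "degree (q y) = 0" using degq[of y] by simp
        then obtain e where "q y = [:e:]" by (rule degree_eq_zeroE)
        with qz q0 show False by simp
      qed
      then have "poly (pderiv (q y)) z \<noteq> 0"
        using sylvester_formal_common_root[OF degq degq' _ qz] syl by blast
      then have "Polynomial.order z (q y) = 1" using simple_root_iff[OF q0 qz] by simp
      then have "sum_list (sz' \<mu>) = 1" using ord[of z] ordh[of z] z(1) \<mu> by simp
      moreover have "has_partial_mults (pencil_add L (E y)) \<mu> (sz' \<mu>)"
        using has_partial_mults_iff[OF M] by (simp add: sz'_def)
      ultimately have "has_alg_mult (pencil_add L (E y)) \<mu> 1" unfolding has_alg_mult_def by metis
      with new(1) show ?thesis by (simp add: simple_eigenvalue_def)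
    qed
    ultimately show ?thesis using reg by blast
  qed
  show ?thesis
  proof (intro exI[of _ G] conjI gen ballI)
    fix P assume "P \<in> Phi n r s ` G"
    then obtain x z where xz: "x \<in> carrier_vec (2 * (r - 2 * s))" "z \<in> carrier_vec ((r + s) * n)"
      "F (\<lambda>i. of_real (realify (x, z) $ i)) \<noteq> 0" "P = Phi n r s (x, z)" by (auto simp: G_def)
    then have "P = E (\<lambda>i. of_real (realify (x, z) $ i))"
      using Phi_eq_complexified[OF xz(1,2) s] by (simp add: E_def)
    note m = main[OF xz(3), folded this]
    show "regular_pencil (pencil_add L P)" using m by blast
    show "\<forall>\<mu>. pencil_eigenvalue (pencil_add L P) \<mu> \<and> \<not> pencil_eigenvalue L \<mu> \<longrightarrow>
         simple_eigenvalue (pencil_add L P) \<mu>" using m by blast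
    fix i assume "i \<in> {1..\<kappa>}"
    with m show "has_partial_mults (pencil_add L P) (ev i) (drop r (ns i))"
      "length (ns i) \<le> r \<longrightarrow> \<not> pencil_eigenvalue (pencil_add L P) (ev i)" by blast+
  qed
qed

end
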